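(* Let $n\ge1$, $s\in(0,1)$ and $u\in H^{2s}(\mathbb R^n)$. Then $$\operatorname{Div}^s\operatorname{Grad}^su=D_{n,s}\,(-\Delta)^su,$$ where $D_{n,s}$ is the negative real constant for which $$\int_{|\boldsymbol\theta|=1}\int_{|\boldsymbol\theta'|=1}\boldsymbol\theta\cdot\boldsymbol\theta'\,(i\boldsymbol\theta\cdot\boldsymbol\xi)^s(i\boldsymbol\theta'\cdot\boldsymbol\xi)^s\,d\boldsymbol\theta\,d\boldsymbol\theta'=D_{n,s}|\boldsymbol\xi|^{2s}\quad\text{for all }\boldsymbol\xi\in\mathbb R^n.$$
   Context: Here $(iy)^s=|y|^se^{i\,\mathrm{sgn}(y)\pi s/2}$ for real $y$, and $d\boldsymbol\theta$ is surface measure on the unit sphere of $\mathbb R^n$. $\mathbf H^s(\mathbb R^n)$ denotes vector fields with components in $H^s(\mathbb R^n)$. For a unit vector $\boldsymbol\theta$, $D^s_{\boldsymbol\theta}$ is the fractional directional derivative (positive Riemann–Liouville derivative of order $s$ in direction $\boldsymbol\theta$), whose Fourier transform is $\mathcal F[D^s_{\boldsymbol\theta}u](\boldsymbol\xi)=(i\boldsymbol\xi\cdot\boldsymbol\theta)^s\hat u(\boldsymbol\xi)$. The directional fractional gradient and divergence are $$\operatorname{Grad}^su=\int_{|\boldsymbol\theta|=1}\boldsymbol\theta D^s_{\boldsymbol\theta}u\,d\boldsymbol\theta,\qquad\operatorname{Div}^s\mathbf v=\int_{|\boldsymbol\theta|=1}\boldsymbol\theta\cdot D^s_{\boldsymbol\theta}\mathbf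 v\,d\boldsymbol\theta,$$ with Fourier transforms $$\mathcal F[\operatorname{Grad}^su](\boldsymbol\xi)=\int_{|\boldsymbol\theta|=1}\boldsymbol\theta(i\boldsymbol\xi\cdot\boldsymbol\theta)^s\hat u(\boldsymbol\xi)\,d\boldsymbol\theta,\qquad\mathcal F[\operatorname{Div}^s\mathbf v](\boldsymbol\xi)=\int_{|\boldsymbol\theta|=1}(i\boldsymbol\xi\cdot\boldsymbol\theta)^s\,\hat{\mathbf v}(\boldsymbol\xi)\cdot\boldsymbol\theta\,d\boldsymbol\theta.$$ The fractional Laplacian is (principal value) $$(-\Delta)^su(\mathbf x)=C_{n,s}\int_{\mathbb R^n}\frac{u(\mathbf x)-u(\mathbf y)}{|\mathbf x-\mathbf y|^{n+2s}}d\mathbf y,\qquad C_{n,s}=\frac{4^s\Gamma(s+\frac n2)}{\pi^{n/2}|\Gamma(-s)|},$$ equivalently the Fourier multiplier operator with symbol $|\boldsymbol\xi|^{2s}$. *)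

theory Defs
  imports "HOL-Analysis.Analysis"
begin

text \<open>
  The space $R^n$ is \<^typ>\<open>real ^ 'n\<close> with $n = CARD('n)$. Functions are complex valued; elements of
  $L^2$ are represented by Borel functions, and identities in $L^2$ are identities almost everywhere.
\<close>

definition square_integrable :: "(real ^ 'n \<Rightarrow> complex) \<Rightarrow> bool" where
  "square_integrable f \<longleftrightarrow>
     f \<in> borel_measurable lborel \<and> integrable lborel (\<lambda>x. (cmod (f x))\<^sup>2)"

text \<open>Convergence in $L^2$. The extended integral is used because the Bochner integral of a
  non-integrable function is 0.\<close>

definition L2_tendsto ::
    "('k \<Rightarrow> real ^ 'n \<Rightarrow> complex) \<Rightarrow> (real ^ 'n \<Rightarrow> complex) \<Rightarrow> 'k filter \<Rightarrow> bool" where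
  "L2_tendsto f g F \<longleftrightarrow>
     ((\<lambda>k. \<integral>\<^sup>+ x. ennreal ((cmod (f k x - g x))\<^sup>2) \<partial>lborel) \<longlongrightarrow> 0) F"

text \<open>The Fourier transform on $L^2$, with kernel $e^{-i \xi \cdot x}$, as the $L^2$ limit of the
  transforms of the truncations to balls.\<close>

definition has_fourier :: "(real ^ 'n \<Rightarrow> complex) \<Rightarrow> (real ^ 'n \<Rightarrow> complex) \<Rightarrow> bool" where
  "has_fourier u U \<longleftrightarrow> square_integrable U \<and>
     L2_tendsto (\<lambda>R \<xi>. LINT x:cball 0 R|lborel. u x * cis (- (\<xi> \<bullet> x))) U at_top"

definition sobolev :: "real \<Rightarrow> (real ^ 'n \<Rightarrow> complex) set" where
  "sobolev r = {u. square_integrable u \<and>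
     (\<exists>U. has_fourier u U \<and>
        square_integrable (\<lambda>\<xi>. of_real ((1 + (norm \<xi>)\<^sup>2) powr (r / 2)) * U \<xi>))}"

text \<open>\<open>ipow s y\<close> is $(iy)^s$.\<close>

definition ipow :: "real \<Rightarrow> real \<Rightarrow> complex" where
  "ipow s y = of_real (\<bar>y\<bar> powr s) * cis (sgn y * pi * s / 2)"

text \<open>Surface measure on the unit sphere, in the form given by polar coordinates: a Borel set $E$ of
  the sphere has measure $n$ times the volume of the cone of all $r\theta$ with $\theta$ in $E$ and
  $0 < r < 1$. It is regarded as a measure on $R^n$ (the point \<open>sgn 0 = 0\<close> carries no mass); for
  $n = 1$ it is the counting measure on $1$ and $-1$.\<close>

definition sphere_measure :: "(real ^ 'n) measure" where
  "sphere_measure =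
     scale_measure (of_nat CARD('n)) (distr (restrict_space lborel (ball 0 1)) borel sgn)"

text \<open>The Riemann-Liouville integral of order \<open>a\<close> along the ray from \<open>x\<close> in direction \<open>\<theta>\<close>; it is the
  formal adjoint of the positive (left-sided) integral, in which \<open>x + t \<theta>\<close> is replaced by
  \<open>x - t \<theta>\<close>.\<close>

definition RL_integral_adj ::
    "real \<Rightarrow> real ^ 'n \<Rightarrow> (real ^ 'n \<Rightarrow> complex) \<Rightarrow> real ^ 'n \<Rightarrow> complex" where
  "RL_integral_adj a \<theta> g x =
     (LINT t:{0<..}|lborel. (t powr (a - 1)) *\<^sub>R g (x + t *\<^sub>R \<theta>)) /\<^sub>R Gamma a"

definition test_function :: "(real ^ 'n \<Rightarrow> complex) \<Rightarrow> bool" where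
  "test_function \<phi> \<longleftrightarrow>
     (\<forall>x. \<phi> differentiable (at x)) \<and>
     (\<forall>v. continuous_on UNIV (\<lambda>x. frechet_derivative \<phi> (at x) v)) \<and>
     compact (closure {x. \<phi> x \<noteq> 0})"

text \<open>
  For $0 < s < 1$ the positive Riemann-Liouville derivative of order $s$ in direction $\theta$ is
  $D^s_\theta u = \partial_\theta I^{1-s}_\theta u$, where
  $I^a_\theta u (x) = \Gamma(a)^{-1} \int_0^\infty t^{a-1} u(x - t\theta)\, dt$.
  The inner integral need not converge for $u$ in $L^2$, so the derivative is understood in the
  distributional sense: both operators are moved to the test function,
  $\langle D^s_\theta u, \phi\rangle = - \langle u, (I^{1-s}_\theta)^* \partial_\theta \phi\rangle$.
  Since only first derivatives occur, $C^1$ test functions with compact support are used.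
\<close>

definition has_frac_deriv ::
    "real \<Rightarrow> real ^ 'n \<Rightarrow> (real ^ 'n \<Rightarrow> complex) \<Rightarrow> (real ^ 'n \<Rightarrow> complex) \<Rightarrow> bool" where
  "has_frac_deriv s \<theta> u v \<longleftrightarrow> square_integrable v \<and>
     (\<forall>\<phi>. test_function \<phi> \<longrightarrow>
        (LINT x|lborel. v x * \<phi> x) =
        - (LINT x|lborel. u x *
             RL_integral_adj (1 - s) \<theta> (\<lambda>y. frechet_derivative \<phi> (at y) \<theta>) x))"

text \<open>\<open>g\<close> is the integral over the unit sphere of the $L^2$-valued function \<open>F\<close>, in the weak sense
  (tested against all of $L^2$). This does not depend on the choice of representatives \<open>F \<theta>\<close>.\<close>

definition has_sphere_integral ::
    "(real ^ 'n \<Rightarrow> real ^ 'n \<Rightarrow> complex) \<Rightarrow> (real ^ 'n \<Rightarrow> complex) \<Rightarrow> bool" where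
  "has_sphere_integral F g \<longleftrightarrow> square_integrable g \<and>
     (\<forall>\<theta>\<in>sphere 0 1. square_integrable (F \<theta>)) \<and>
     (\<forall>h. square_integrable h \<longrightarrow>
        has_bochner_integral sphere_measure (\<lambda>\<theta>. LINT x|lborel. F \<theta> x * h x)
          (LINT x|lborel. g x * h x))"

definition has_Grad ::
    "real \<Rightarrow> (real ^ 'n \<Rightarrow> complex) \<Rightarrow> (real ^ 'n \<Rightarrow> complex ^ 'n) \<Rightarrow> bool" where
  "has_Grad s u g \<longleftrightarrow>
     (\<exists>F. (\<forall>\<theta>\<in>sphere 0 1. has_frac_deriv s \<theta> u (F \<theta>)) \<and>
          (\<forall>j. has_sphere_integral (\<lambda>\<theta> x. of_real (\<theta> $ j) * F \<theta> x) (\<lambda>x. g x $ j)))"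

definition has_Div ::
    "real \<Rightarrow> (real ^ 'n \<Rightarrow> complex ^ 'n) \<Rightarrow> (real ^ 'n \<Rightarrow> complex) \<Rightarrow> bool" where
  "has_Div s v d \<longleftrightarrow>
     (\<exists>F. (\<forall>\<theta>\<in>sphere 0 1. \<forall>j. has_frac_deriv s \<theta> (\<lambda>x. v x $ j) (\<lambda>x. F \<theta> x $ j)) \<and>
          has_sphere_integral (\<lambda>\<theta> x. \<Sum>j\<in>UNIV. of_real (\<theta> $ j) * F \<theta> x $ j) d)"

definition frac_laplacian_const :: "'n::finite itself \<Rightarrow> real \<Rightarrow> real" where
  "frac_laplacian_const _ s =
     4 powr s * Gamma (s + real CARD('n) / 2) / (pi powr (real CARD('n) / 2) * \<bar>Gamma (- s)\<bar>)"

text \<open>The principal value is taken in $L^2$: the integrals over \<open>dist x y > \<epsilon>\<close> converge in $L^2$.\<close>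

definition has_frac_laplacian ::
    "real \<Rightarrow> (real ^ 'n \<Rightarrow> complex) \<Rightarrow> (real ^ 'n \<Rightarrow> complex) \<Rightarrow> bool" where
  "has_frac_laplacian s u w \<longleftrightarrow> square_integrable w \<and>
     L2_tendsto
       (\<lambda>\<epsilon> x. of_real (frac_laplacian_const TYPE('n) s) *
          (LINT y:{y. \<epsilon> < dist x y}|lborel.
             (u x - u y) / of_real (norm (x - y) powr (real CARD('n) + 2 * s))))
       w (at_right 0)"

text \<open>The operators themselves; their values are determined up to null sets whenever they exist.\<close>

definition Grad :: "real \<Rightarrow> (real ^ 'n \<Rightarrow> complex) \<Rightarrow> real ^ 'n \<Rightarrow> complex ^ 'n" where
  "Grad s u = (SOME g. has_Grad s u g)"

definition Div :: "real \<Rightarrow> (real ^ 'n \<Rightarrow> complex ^ 'n) \<Rightarrow> real ^ 'n \<Rightarrow> complex" where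
  "Div s v = (SOME d. has_Div s v d)"

definition frac_laplacian :: "real \<Rightarrow> (real ^ 'n \<Rightarrow> complex) \<Rightarrow> real ^ 'n \<Rightarrow> complex" where
  "frac_laplacian s u = (SOME w. has_frac_laplacian s u w)"

end

theory Submission
  imports Defs "HOL-Probability.Probability" "HOL-Real_Asymp.Real_Asymp"
begin

text \<open>
  The $L^2$ Fourier transform of \<open>has_fourier\<close> is a bijection of $L^2$ satisfying Parseval's identity; on
  $L^1 \cap L^2$ the bound and the inversion formula come from Gaussian regularisation, and the rest
  is density.

  The adjoint Riemann-Liouville integral of $\partial_\theta \phi$ is a Marchaud integral
  of the increments of $\phi$ along $\theta$. Its Fourier symbol is a boundary value of
  $H(z) = \int_0^\infty t^{-s-1} (e^{-tz} - 1)\, dt$, and $H(z) = H(1)\, z^s$ because $H$ is holomorphic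
  and homogeneous of degree $s$. By duality $D^s_\theta$ is the multiplier $(i\xi\cdot\theta)^s$.
  Integrating over the sphere, the gradient and the divergence become the multipliers
  $A_j(\xi) = \int \theta_j (i\theta\cdot\xi)^s d\theta$. The vector $A(\xi)$ is equivariant under
  rotations and reflections, hence $A(\xi) = i \sin(\pi s/2)\, \kappa\, |\xi|^{s-1} \xi$ with
  $\kappa > 0$, and $D_{n,s} |\xi|^{2s} = \sum_j A_j(\xi)^2 = - \sin^2(\pi s/2)\, \kappa^2 |\xi|^{2s}$.

  The singular integrals truncated at $\epsilon$ are multipliers that increase to
  $C_{n,s} \int (1 - \cos (\xi\cdot z)) |z|^{-n-2s} dz$ as $\epsilon \to 0$. Writing $|z|^{-n-2s}$ as a mixture of
  Gaussians evaluates this integral, so it equals $|\xi|^{2s}$.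
\<close>

section \<open>Square integrable functions\<close>

text \<open>The operators are relations between L^2 classes, and \<open>Grad\<close>,
  \<open>Div\<close> and \<open>frac_laplacian\<close> are arbitrary choices satisfying them. Each
  multiplier statement is therefore proved twice over: some function satisfies the relation, and
  every such function has the expected transform. The obstacle is that u is merely square
  integrable: its fractional integral along a ray may diverge, and the derivatives chosen for the
  various \<theta> need not be jointly measurable in \<theta> and x. So limits are taken on test
  functions, and Fubini over the sphere is applied to explicit symbols in frequency. Pairings are
  bilinear, hence reflections x -> - x stand where conjugates would be expected. Exactly this
  reflection turns the adjoint symbol, a power of - i \<xi> \<bullet> \<theta>, into the symbol of
  the derivative. The sine in D_{n,s} arises because (i y)^s splits into an even part with a cosine,
  which integrates to 0 against \<theta>, and an odd part with i times a sine. The Sobolev order 2 s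
  is what leaves |\<xi>|^s times the transform of the gradient in L^2, so that the divergence can be
  applied.\<close>

definition nnL2 :: "(real ^ 'n \<Rightarrow> complex) \<Rightarrow> ennreal" where
  "nnL2 f = (\<integral>\<^sup>+ x. ennreal ((cmod (f x))\<^sup>2) \<partial>lborel)"

lemma L2_tendsto_nnL2: "L2_tendsto f g F \<longleftrightarrow> ((\<lambda>k. nnL2 (\<lambda>x. f k x - g x)) \<longlongrightarrow> 0) F"
  by (simp add: L2_tendsto_def nnL2_def)

lemma square_integrable_measurable [measurable_dest]:
  "square_integrable f \<Longrightarrow> f \<in> borel_measurable borel"
  by (simp add: square_integrable_def)

lemma square_integrable_iff:
  "square_integrable f \<longleftrightarrow> f \<in> borel_measurable borel \<and> nnL2 f < \<infinity>"
  by (auto simp: square_integrable_def nnL2_def integrable_iff_bounded)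

lemma square_integrableD: "square_integrable f \<Longrightarrow> integrable lborel (\<lambda>x. (cmod (f x))\<^sup>2)"
  by (simp add: square_integrable_def)

lemma nnL2_eq_integral:
  "square_integrable f \<Longrightarrow> nnL2 f = ennreal (LINT x|lborel. (cmod (f x))\<^sup>2)"
  unfolding nnL2_def by (intro nn_integral_eq_integral) (auto simp: square_integrable_def)

lemma nnL2_mono: "(AE x in lborel. cmod (f x) \<le> cmod (g x)) \<Longrightarrow> nnL2 f \<le> nnL2 g"
  unfolding nnL2_def by (intro nn_integral_mono_AE) (auto elim!: eventually_mono intro!: ennreal_leI power_mono)

lemma nnL2_cong: "(AE x in lborel. cmod (f x) = cmod (g x)) \<Longrightarrow> nnL2 f = nnL2 g"
  unfolding nnL2_def by (intro nn_integral_cong_AE) (auto elim!: eventually_mono)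

lemma nnL2_cmult:
  assumes [measurable]: "f \<in> borel_measurable borel"
  shows "nnL2 (\<lambda>x. c * f x) = ennreal ((cmod c)\<^sup>2) * nnL2 f"
  unfolding nnL2_def
  by (subst nn_integral_cmult[symmetric]) (auto simp: norm_mult power_mult_distrib ennreal_mult')

text \<open>The square of the norm is used instead of the norm, so the triangle inequality costs a
  factor 2. This is harmless: only finiteness, vanishing or convergence to 0 of such squares is
  deduced from it.\<close>

lemma nnL2_add:
  assumes [measurable]: "f \<in> borel_measurable borel" "g \<in> borel_measurable borel"
  shows "nnL2 (\<lambda>x. f x + g x) \<le> 2 * nnL2 f + 2 * nnL2 g"
proof -
  have pt: "(cmod (a + b))\<^sup>2 \<le> 2 * (cmod a)\<^sup>2 + 2 * (cmod b)\<^sup>2" for a b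
  proof -
    have "(cmod (a + b))\<^sup>2 \<le> (cmod a + cmod b)\<^sup>2"
      by (intro power_mono norm_triangle_ineq) auto
    also have "\<dots> \<le> 2 * (cmod a)\<^sup>2 + 2 * (cmod b)\<^sup>2"
      using sum_squares_bound[of "cmod a" "cmod b"] by (simp add: power2_sum)
    finally show ?thesis .
  qed
  have "nnL2 (\<lambda>x. f x + g x) \<le> (\<integral>\<^sup>+ x. 2 * ennreal ((cmod (f x))\<^sup>2) + 2 * ennreal ((cmod (g x))\<^sup>2) \<partial>lborel)"
    unfolding nnL2_def
  proof (intro nn_integral_mono)
    fix x
    have "ennreal ((cmod (f x + g x))\<^sup>2) \<le> ennreal (2 * (cmod (f x))\<^sup>2 + 2 * (cmod (g x))\<^sup>2)"
      by (intro ennreal_leI pt)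
    also have "\<dots> = 2 * ennreal ((cmod (f x))\<^sup>2) + 2 * ennreal ((cmod (g x))\<^sup>2)"
      by (simp add: ennreal_plus ennreal_mult)
    finally show "ennreal ((cmod (f x + g x))\<^sup>2) \<le> 2 * ennreal ((cmod (f x))\<^sup>2) + 2 * ennreal ((cmod (g x))\<^sup>2)" .
  qed
  also have "\<dots> = 2 * nnL2 f + 2 * nnL2 g"
    unfolding nnL2_def by (simp add: nn_integral_add nn_integral_cmult)
  finally show ?thesis .
qed

lemma nnL2_minus_commute: "nnL2 (\<lambda>x. f x - g x) = nnL2 (\<lambda>x. g x - f x)"
  by (simp add: nnL2_def norm_minus_commute)

lemma nnL2_diff_triangle:
  assumes [measurable]: "f \<in> borel_measurable borel" "g \<in> borel_measurable borel" "h \<in> borel_measurable borel"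
  shows "nnL2 (\<lambda>x. f x - h x) \<le> 2 * nnL2 (\<lambda>x. f x - g x) + 2 * nnL2 (\<lambda>x. g x - h x)"
  using nnL2_add[of "\<lambda>x. f x - g x" "\<lambda>x. g x - h x"] by simp

lemma nnL2_eq_0:
  assumes [measurable]: "f \<in> borel_measurable borel" and "nnL2 f = 0"
  shows "AE x in lborel. f x = 0"
proof -
  have "AE x in lborel. ennreal ((cmod (f x))\<^sup>2) = 0"
    using assms(2) unfolding nnL2_def by (subst (asm) nn_integral_0_iff_AE) auto
  then show ?thesis by (auto elim!: eventually_mono simp: ennreal_eq_0_iff)
qed

lemma square_integrable_add:
  "square_integrable f \<Longrightarrow> square_integrable g \<Longrightarrow> square_integrable (\<lambda>x. f x + g x)"
  using nnL2_add[of f g]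
  by (auto simp: square_integrable_iff ennreal_mult_eq_top_iff less_top[symmetric] top_unique)

lemma square_integrable_cmult:
  "square_integrable f \<Longrightarrow> square_integrable (\<lambda>x. c * f x)"
  by (auto simp: square_integrable_iff nnL2_cmult ennreal_mult_less_top)

lemma square_integrable_minus: "square_integrable f \<Longrightarrow> square_integrable (\<lambda>x. - f x)"
  using square_integrable_cmult[of f "-1"] by simp

lemma square_integrable_diff:
  "square_integrable f \<Longrightarrow> square_integrable g \<Longrightarrow> square_integrable (\<lambda>x. f x - g x)"
  using square_integrable_add[of f "\<lambda>x. - g x"] square_integrable_minus[of g] by simp

lemma square_integrable_zero [simp]: "square_integrable (\<lambda>x. 0)"
  by (simp add: square_integrable_def)

lemma square_integrable_sum:
  "(\<And>i. i \<in> I \<Longrightarrow> square_integrable (f i)) \<Longrightarrow> square_integrable (\<lambda>x. \<Sum>i\<in>I. f i x)"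
  by (induction I rule: infinite_finite_induct) (auto intro!: square_integrable_add)

lemma square_integrable_bound:
  "square_integrable g \<Longrightarrow> f \<in> borel_measurable borel \<Longrightarrow> (\<And>x. cmod (f x) \<le> cmod (g x))
     \<Longrightarrow> square_integrable f"
  using nnL2_mono[of f g] by (auto simp: square_integrable_iff)

lemma square_integrable_mult_bounded:
  assumes "square_integrable g" "m \<in> borel_measurable borel" "\<And>x. cmod (m x) \<le> C"
  shows "square_integrable (\<lambda>x. m x * g x)"
proof (rule square_integrable_bound[OF square_integrable_cmult[OF assms(1), of C]])
  have [measurable]: "g \<in> borel_measurable borel" using assms(1) by measurable
  show "(\<lambda>x. m x * g x) \<in> borel_measurable borel" using assms(2) by measurable
  have "0 \<le> C" using assms(3) norm_ge_zero order_trans by blast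
  then show "cmod (m x * g x) \<le> cmod (C * g x)" for x
    using assms(3)[of x] by (auto simp: norm_mult intro!: mult_right_mono)
qed

lemma square_integrable_cong_AE:
  "square_integrable f \<Longrightarrow> g \<in> borel_measurable borel \<Longrightarrow> (AE x in lborel. f x = g x) \<Longrightarrow> square_integrable g"
  by (subst (asm) square_integrable_iff, subst square_integrable_iff, subst nnL2_cong[of g f])
    (auto elim: eventually_mono)

lemma integrable_square_integrable_bounded:
  assumes "integrable lborel f" "\<And>x. cmod (f x) \<le> C"
  shows "square_integrable f"
proof -
  have [measurable]: "f \<in> borel_measurable borel" using assms(1) by measurable
  have "integrable lborel (\<lambda>x. (cmod (f x))\<^sup>2)"
  proof (rule Bochner_Integration.integrable_bound[of _ "\<lambda>x. C * cmod (f x)"])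
    show "integrable lborel (\<lambda>x. C * cmod (f x))" using assms(1) by auto
    show "AE x in lborel. norm ((cmod (f x))\<^sup>2) \<le> norm (C * cmod (f x))"
    proof (intro AE_I2)
      fix x
      have "0 \<le> C" using assms(2) norm_ge_zero order_trans by blast
      then show "norm ((cmod (f x))\<^sup>2) \<le> norm (C * cmod (f x))"
        using assms(2)[of x] by (auto simp: power2_eq_square intro!: mult_right_mono)
    qed
  qed measurable
  then show ?thesis by (simp add: square_integrable_def)
qed

text \<open>The free parameter a replaces the Cauchy-Schwarz inequality: a caller picks it so that
  both halves of the bound are small, and no square roots of integrals occur.\<close>

lemma young_cmod:
  assumes "0 < (a::real)"
  shows "cmod (z * w) \<le> (a * (cmod z)\<^sup>2 + (cmod w)\<^sup>2 / a) / 2"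
proof -
  have "0 \<le> (a * cmod z - cmod w)\<^sup>2 / a" using assms by simp
  also have "\<dots> = a * (cmod z)\<^sup>2 + (cmod w)\<^sup>2 / a - 2 * (cmod z * cmod w)"
    using assms by (simp add: power2_diff field_simps power2_eq_square)
  finally show ?thesis by (simp add: norm_mult)
qed

lemma square_integrable_mult_integrable:
  assumes "square_integrable f" "square_integrable g"
  shows "integrable lborel (\<lambda>x. f x * g x)"
proof (rule Bochner_Integration.integrable_bound[of _ "\<lambda>x. (1 * (cmod (f x))\<^sup>2 + (cmod (g x))\<^sup>2 / 1) / 2"])
  have [measurable]: "f \<in> borel_measurable borel" "g \<in> borel_measurable borel" using assms by measurable
  show "(\<lambda>x. f x * g x) \<in> borel_measurable lborel" by measurable
  show "integrable lborel (\<lambda>x. (1 * (cmod (f x))\<^sup>2 + (cmod (g x))\<^sup>2 / 1) / 2)"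
    using square_integrableD[OF assms(1)] square_integrableD[OF assms(2)] by auto
  show "AE x in lborel. norm (f x * g x) \<le> norm ((1 * (cmod (f x))\<^sup>2 + (cmod (g x))\<^sup>2 / 1) / 2)"
    using young_cmod[of 1] by (intro AE_I2) (simp add: order_trans)
qed

lemma norm_integral_mult_le:
  assumes "square_integrable f" "square_integrable g" "0 < (a::real)"
  shows "cmod (LINT x|lborel. f x * g x) \<le>
     (a * (LINT x|lborel. (cmod (f x))\<^sup>2) + (LINT x|lborel. (cmod (g x))\<^sup>2) / a) / 2"
proof -
  note i = square_integrableD[OF assms(1)] square_integrableD[OF assms(2)]
  have "cmod (LINT x|lborel. f x * g x) \<le> (LINT x|lborel. (a * (cmod (f x))\<^sup>2 + (cmod (g x))\<^sup>2 / a) / 2)"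
  proof (rule Bochner_Integration.integral_norm_bound_integral)
    show "integrable lborel (\<lambda>x. f x * g x)"
      by (intro square_integrable_mult_integrable assms(1,2))
    show "integrable lborel (\<lambda>x. (a * (cmod (f x))\<^sup>2 + (cmod (g x))\<^sup>2 / a) / 2)" using i by auto
    show "norm (f x * g x) \<le> (a * (cmod (f x))\<^sup>2 + (cmod (g x))\<^sup>2 / a) / 2" for x
      by (rule young_cmod[OF assms(3)])
  qed
  also have "\<dots> = (a * (LINT x|lborel. (cmod (f x))\<^sup>2) + (LINT x|lborel. (cmod (g x))\<^sup>2) / a) / 2"
    using i by simp
  finally show ?thesis .
qed

lemma L2_tendsto_integral_mult:
  assumes f: "\<And>k. square_integrable (f k)" and g: "square_integrable g" and h: "square_integrable h"
    and lim: "L2_tendsto f g F"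
  shows "((\<lambda>k. LINT x|lborel. f k x * h x) \<longlongrightarrow> (LINT x|lborel. g x * h x)) F"
proof (rule tendstoI)
  fix e :: real assume e: "0 < e"
  define B where "B = (LINT x|lborel. (cmod (h x))\<^sup>2)"
  have B: "0 \<le> B" by (simp add: B_def)
  \<comment> \<open>The bound will be the mean of \<open>a * A\<close> and \<open>B / a\<close>.
    This choice makes the second smaller than e, and closeness \<open>e / a\<close> in L^2 makes the
    first smaller than e. The \<open>+ 1\<close> keeps a positive when B is 0.\<close>
  define a where "a = (B + 1) / e"
  have a: "0 < a" using e B by (simp add: a_def)
  have "\<forall>\<^sub>F k in F. nnL2 (\<lambda>x. f k x - g x) < ennreal (e / a)"
    using lim a e unfolding L2_tendsto_nnL2 by (intro order_tendstoD(2)[where y=0]) auto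
  then show "\<forall>\<^sub>F k in F. dist (LINT x|lborel. f k x * h x) (LINT x|lborel. g x * h x) < e"
  proof eventually_elim
    case (elim k)
    have d: "square_integrable (\<lambda>x. f k x - g x)" by (intro square_integrable_diff f g)
    define A where "A = (LINT x|lborel. (cmod (f k x - g x))\<^sup>2)"
    have "A < e / a" using elim nnL2_eq_integral[OF d] a e
      by (simp add: A_def ennreal_less_iff)
    then have "a * A < e" using a by (simp add: field_simps)
    moreover have "B / a < e" using e B by (simp add: a_def field_simps)
    moreover have "cmod (LINT x|lborel. (f k x - g x) * h x) \<le> (a * A + B / a) / 2"
      unfolding A_def B_def by (rule norm_integral_mult_le[OF d h a])
    moreover have "(LINT x|lborel. (f k x - g x) * h x) = (LINT x|lborel. f k x * h x) - (LINT x|lborel. g x * h x)"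
      using square_integrable_mult_integrable[OF f h] square_integrable_mult_integrable[OF g h]
      by (simp add: left_diff_distrib)
    ultimately show ?case by (simp add: dist_norm)
  qed
qed

lemma ennreal_tendsto_0_le:
  assumes "\<And>k. f k \<le> g k" "(g \<longlongrightarrow> (0::ennreal)) F"
  shows "(f \<longlongrightarrow> 0) F"
  by (rule tendsto_sandwich[OF _ _ tendsto_const assms(2)]) (auto simp: assms(1))

lemma ennreal_tendsto_cmult_0:
  assumes "c < \<infinity>" "(g \<longlongrightarrow> (0::ennreal)) F"
  shows "((\<lambda>k. c * g k) \<longlongrightarrow> 0) F"
  using ennreal_tendsto_cmult[OF _ assms(2), of c] assms(1) by simp

lemma L2_tendsto_unique:
  assumes [measurable]: "\<And>k. f k \<in> borel_measurable borel" "g \<in> borel_measurable borel" "h \<in> borel_measurable borel"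
    and "L2_tendsto f g F" "L2_tendsto f h F" "F \<noteq> bot"
  shows "AE x in lborel. g x = h x"
proof -
  have "nnL2 (\<lambda>x. g x - h x) \<le> 2 * nnL2 (\<lambda>x. f k x - g x) + 2 * nnL2 (\<lambda>x. f k x - h x)" for k
    using nnL2_diff_triangle[of g "f k" h] nnL2_minus_commute[of g "f k"] by simp
  moreover have "((\<lambda>k. 2 * nnL2 (\<lambda>x. f k x - g x) + 2 * nnL2 (\<lambda>x. f k x - h x)) \<longlongrightarrow> 0 + 0) F"
    using assms(4,5) unfolding L2_tendsto_nnL2 by (intro tendsto_add ennreal_tendsto_cmult_0) auto
  ultimately have "nnL2 (\<lambda>x. g x - h x) = 0"
    using tendsto_lowerbound[of "\<lambda>k. 2 * nnL2 (\<lambda>x. f k x - g x) + 2 * nnL2 (\<lambda>x. f k x - h x)" 0 F] \<open>F \<noteq> bot\<close>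
    by (simp add: le_zero_eq)
  from nnL2_eq_0[OF _ this] show ?thesis by simp
qed

text \<open>Riesz-Fischer in quantitative form. The rate 4^(-k) leaves room for the weights 2^k,
  which force convergence almost everywhere of the whole sequence, without extracting a subsequence.
  The rate survives in the limit, as the construction of the transform requires.\<close>

lemma L2_complete:
  fixes f :: "nat \<Rightarrow> real ^ 'n \<Rightarrow> complex"
  assumes f: "\<And>k. square_integrable (f k)" and C: "C < (\<infinity>::ennreal)"
    and Cauchy: "\<And>k m. k \<le> m \<Longrightarrow> nnL2 (\<lambda>x. f m x - f k x) \<le> C * ennreal ((1/4)^k)"
  shows "\<exists>g. square_integrable g \<and> (\<forall>k. nnL2 (\<lambda>x. f k x - g x) \<le> C * ennreal ((1/4)^k))"
proof -
  have [measurable]: "f k \<in> borel_measurable borel" for k using f[of k] by measurable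
  have "(\<integral>\<^sup>+x. (\<Sum>k. ennreal (2^k * (cmod (f (Suc k) x - f k x))\<^sup>2)) \<partial>lborel)
      = (\<Sum>k. \<integral>\<^sup>+x. ennreal (2^k * (cmod (f (Suc k) x - f k x))\<^sup>2) \<partial>lborel)"
    by (rule nn_integral_suminf) measurable
  also have "\<dots> = (\<Sum>k. ennreal (2^k) * nnL2 (\<lambda>x. f (Suc k) x - f k x))"
    by (simp add: nnL2_def ennreal_mult' nn_integral_cmult)
  also have "\<dots> \<le> (\<Sum>k. ennreal (2^k) * (C * ennreal ((1/4)^k)))"
    by (intro suminf_le mult_left_mono Cauchy) auto
  also have "\<dots> = (\<Sum>k. C * ennreal ((1/2)^k))"
  proof (rule suminf_cong)
    fix k :: nat
    have "ennreal (2^k) * (C * ennreal ((1/4)^k)) = C * (ennreal (2^k) * ennreal ((1/4)^k))"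
      by (simp add: ac_simps)
    also have "ennreal (2^k) * ennreal ((1/4)^k) = ennreal ((1/2)^k)"
      by (simp add: ennreal_mult[symmetric] power_mult_distrib[symmetric])
    finally show "ennreal (2^k) * (C * ennreal ((1/4)^k)) = C * ennreal ((1/2)^k)" .
  qed
  also have "\<dots> = C * (\<Sum>k. ennreal ((1/2)^k))" by simp
  also have "(\<Sum>k. ennreal ((1/2)^k)) = ennreal (\<Sum>k. (1/2)^k)"
    by (intro suminf_ennreal2) auto
  finally have "(\<integral>\<^sup>+x. (\<Sum>k. ennreal (2^k * (cmod (f (Suc k) x - f k x))\<^sup>2)) \<partial>lborel) \<noteq> \<infinity>"
    using C by (auto simp: top_unique ennreal_mult_eq_top_iff)
  then have "AE x in lborel. (\<Sum>k. ennreal (2^k * (cmod (f (Suc k) x - f k x))\<^sup>2)) \<noteq> \<infinity>"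
    by (intro nn_integral_PInf_AE) auto
  then have conv: "AE x in lborel. convergent (\<lambda>k. f k x)"
  proof eventually_elim
    case (elim x)
    \<comment> \<open>Finiteness of the weighted sum forces 2^k a_k^2 to tend to 0, so a_k is
      eventually at most (1 / sqrt 2)^k: the increments are absolutely summable and telescope to
      convergence of the values at x.\<close>
    define a where "a k = cmod (f (Suc k) x - f k x)" for k
    have "summable (\<lambda>k. 2^k * (a k)\<^sup>2)"
      using elim unfolding a_def by (intro summable_suminf_not_top) auto
    then have "(\<lambda>k. 2^k * (a k)\<^sup>2) \<longlonglongrightarrow> 0" by (rule summable_LIMSEQ_zero)
    then have "\<forall>\<^sub>F k in sequentially. 2^k * (a k)\<^sup>2 < 1"
      by (rule order_tendstoD) simp
    then have "\<forall>\<^sub>F k in sequentially. norm (a k) \<le> (1 / sqrt 2)^k"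
    proof eventually_elim
      case (elim k)
      then have "(a k)\<^sup>2 \<le> (1/2)^k" by (simp add: field_simps power_one_over)
      also have "(1/2::real)^k = ((1 / sqrt 2)\<^sup>2)^k" by (simp add: power_divide)
      also have "\<dots> = ((1 / sqrt 2)^k)\<^sup>2"
        by (simp only: power_mult[symmetric] mult.commute)
      finally have "a k \<le> (1 / sqrt 2)^k" by (rule power2_le_imp_le) simp
      then show ?case by (simp add: a_def)
    qed
    then have "summable a"
      by (rule summable_comparison_test_ev) (auto intro!: summable_geometric)
    then have "summable (\<lambda>k. f (Suc k) x - f k x)"
      unfolding a_def by (rule summable_norm_cancel)
    then have "convergent (\<lambda>n. \<Sum>k<n. (f (Suc k) x - f k x))"
      by (simp add: summable_iff_convergent)
    then have "convergent (\<lambda>n. f n x - f 0 x)" using sum_lessThan_telescope[of "\<lambda>k. f k x"] by simp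
    then have "convergent (\<lambda>n. (f n x - f 0 x) + f 0 x)"
      by (intro convergent_add convergent_const)
    then show ?case by simp
  qed
  define g where "g x = lim (\<lambda>k. f k x)" for x
  have [measurable]: "g \<in> borel_measurable borel"
    unfolding g_def by (intro borel_measurable_lim_metric) auto
  \<comment> \<open>Fatou's lemma as m tends to infinity; the index m + k keeps the Cauchy
    hypothesis applicable, which compares k only with later indices.\<close>
  have bnd: "nnL2 (\<lambda>x. f k x - g x) \<le> C * ennreal ((1/4)^k)" for k
  proof -
    have "nnL2 (\<lambda>x. f k x - g x) = (\<integral>\<^sup>+x. liminf (\<lambda>m. ennreal ((cmod (f k x - f (m + k) x))\<^sup>2)) \<partial>lborel)"
      unfolding nnL2_def
    proof (intro nn_integral_cong_AE)
      show "AE x in lborel. ennreal ((cmod (f k x - g x))\<^sup>2) = liminf (\<lambda>m. ennreal ((cmod (f k x - f (m + k) x))\<^sup>2))"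
        using conv
      proof eventually_elim
        case (elim x)
        then have "(\<lambda>m. f m x) \<longlonglongrightarrow> g x" by (simp add: g_def convergent_LIMSEQ_iff)
        then have "(\<lambda>m. f (m + k) x) \<longlonglongrightarrow> g x" by (rule LIMSEQ_ignore_initial_segment)
        then have "(\<lambda>m. ennreal ((cmod (f k x - f (m + k) x))\<^sup>2)) \<longlonglongrightarrow> ennreal ((cmod (f k x - g x))\<^sup>2)"
          by (intro tendsto_intros)
        from lim_imp_Liminf[OF _ this] show ?case by simp
      qed
    qed
    also have "\<dots> \<le> liminf (\<lambda>m. \<integral>\<^sup>+x. ennreal ((cmod (f k x - f (m + k) x))\<^sup>2) \<partial>lborel)"
      by (intro nn_integral_liminf) measurable
    also have "\<dots> \<le> liminf (\<lambda>m. C * ennreal ((1/4)^k))"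
      using Cauchy[of k "_ + k"] nnL2_minus_commute[of "f k"]
      by (intro Liminf_mono always_eventually) (simp add: nnL2_def)
    also have "\<dots> = C * ennreal ((1/4)^k)" by (simp add: Liminf_const)
    finally show ?thesis .
  qed
  have "nnL2 (\<lambda>x. f 0 x - g x) < \<infinity>"
    using bnd[of 0] C by (auto simp: le_less_trans)
  then have "square_integrable (\<lambda>x. f 0 x - g x)" by (simp add: square_integrable_iff)
  from square_integrable_diff[OF f[of 0] this] have "square_integrable g" by simp
  with bnd show ?thesis by blast
qed

section \<open>Test functions\<close>

text \<open>The regularity half of \<open>test_function\<close>, kept apart because the
  one-coordinate factors of \<open>box_bump\<close> are in general supported in slabs, which are not
  compact.\<close>

definition C1_function :: "(real ^ 'n \<Rightarrow> complex) \<Rightarrow> bool" where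
  "C1_function \<phi> \<longleftrightarrow> (\<forall>x. \<phi> differentiable (at x)) \<and>
     (\<forall>v. continuous_on UNIV (\<lambda>x. frechet_derivative \<phi> (at x) v))"

lemma C1_functionI:
  assumes "\<And>x. (f has_derivative f' x) (at x)" "\<And>v. continuous_on UNIV (\<lambda>x. f' x v)"
  shows "C1_function f"
proof -
  have "frechet_derivative f (at x) = f' x" for x
    using frechet_derivative_at[OF assms(1)] by simp
  then show ?thesis using assms by (auto simp: C1_function_def differentiable_def)
qed

lemma C1_function_has_derivative:
  "C1_function f \<Longrightarrow> (f has_derivative frechet_derivative f (at x)) (at x)"
  by (simp add: C1_function_def frechet_derivative_works)

lemma C1_function_continuous: "C1_function f \<Longrightarrow> continuous_on UNIV f"
  by (auto simp: C1_function_def intro!: continuous_at_imp_continuous_on differentiable_imp_continuous_within)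

lemma C1_function_mult:
  assumes "C1_function f" "C1_function g"
  shows "C1_function (\<lambda>x. f x * g x)"
proof (rule C1_functionI)
  show "((\<lambda>x. f x * g x) has_derivative
      (\<lambda>v. f x * frechet_derivative g (at x) v + frechet_derivative f (at x) v * g x)) (at x)" for x
    by (intro has_derivative_mult C1_function_has_derivative assms)
  show "continuous_on UNIV (\<lambda>x. f x * frechet_derivative g (at x) v + frechet_derivative f (at x) v * g x)" for v
    using assms C1_function_continuous[of f] C1_function_continuous[of g]
    by (intro continuous_intros) (auto simp: C1_function_def)
qed

lemma C1_function_prod:
  "finite I \<Longrightarrow> (\<And>i. i \<in> I \<Longrightarrow> C1_function (f i)) \<Longrightarrow> C1_function (\<lambda>x. \<Prod>i\<in>I. f i x)"
proof (induction I rule: finite_induct)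
  case empty
  show ?case by (auto intro!: C1_functionI[where f'="\<lambda>x v. 0"])
next
  case (insert i I)
  then show ?case using C1_function_mult[of "f i" "\<lambda>x. \<Prod>i\<in>I. f i x"] by simp
qed

text \<open>The square makes the functions $C^1$; they increase to the indicator of the positive reals.\<close>

definition bump :: "nat \<Rightarrow> real \<Rightarrow> real" where
  "bump k t = real k * (max 0 t)\<^sup>2 / (1 + real k * (max 0 t)\<^sup>2)"

lemma bump_bounds: "0 \<le> bump k t" "bump k t \<le> 1"
  by (auto simp: bump_def divide_le_eq_1 add_pos_nonneg intro!: divide_nonneg_pos)

lemma bump_nonpos: "t \<le> 0 \<Longrightarrow> bump k t = 0"
  by (simp add: bump_def)

lemma bump_tendsto:
  assumes "0 < t"
  shows "(\<lambda>k. bump k t) \<longlonglongrightarrow> 1"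
proof -
  have "(\<lambda>k. 1 - 1 / (1 + real k * t\<^sup>2)) \<longlonglongrightarrow> 1 - 0"
    using assms
    by (intro tendsto_intros real_tendsto_divide_at_top[where c=1] filterlim_tendsto_add_at_top[where c=1]
        filterlim_at_top_mult_tendsto_pos[where c="t\<^sup>2"] filterlim_real_sequentially) auto
  moreover have "1 - 1 / (1 + real k * t\<^sup>2) = bump k t" for k
  proof -
    have "0 < 1 + real k * t\<^sup>2" by (intro add_pos_nonneg) auto
    then show ?thesis using assms by (simp add: bump_def field_simps)
  qed
  ultimately show ?thesis by simp
qed

lemma max_square_has_derivative:
  "((\<lambda>t::real. (max 0 t)\<^sup>2) has_real_derivative 2 * max 0 t) (at t)"
proof (cases t "0::real" rule: linorder_cases)
  case less
  have "((\<lambda>t::real. 0) has_real_derivative 2 * max 0 t) (at t)"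
    using less by simp
  then show ?thesis
    by (rule has_field_derivative_transform_within_open[of _ _ _ "{..<0}"]) (use less in auto)
next
  case greater
  have "((\<lambda>t::real. t\<^sup>2) has_real_derivative 2 * max 0 t) (at t)"
    using greater by (auto intro!: derivative_eq_intros)
  then show ?thesis
    by (rule has_field_derivative_transform_within_open[of _ _ _ "{0<..}"]) (use greater in auto)
next
  case equal
  have "((\<lambda>h::real. (max 0 h)\<^sup>2 / h) \<longlongrightarrow> 0) (at 0)"
  proof (rule Lim_null_comparison)
    have "norm ((max 0 h)\<^sup>2 / h) \<le> \<bar>h\<bar>" for h :: real
      by (auto simp: max_def power2_eq_square)
    then show "\<forall>\<^sub>F h::real in at 0. norm ((max 0 h)\<^sup>2 / h) \<le> \<bar>h\<bar>" by simp
    show "((\<lambda>h::real. \<bar>h\<bar>) \<longlongrightarrow> 0) (at 0)" by (rule tendsto_eq_intros refl | simp)+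
  qed
  then show ?thesis using equal by (simp add: has_field_derivative_iff)
qed

text \<open>For a < b the quadratic (x_i - a)(b - x_i) is positive exactly between a and b, so one
  profile that vanishes on the negative half-line serves both end points.\<close>

lemma C1_function_bump:
  fixes i :: "'n::finite"
  shows "C1_function (\<lambda>x::real^'n. complex_of_real (bump k ((x $ i - a) * (b - x $ i))))"
proof (rule C1_functionI)
  define r where "r x = (x $ i - a) * (b - x $ i)" for x :: "real ^ 'n"
  define r' where "r' x v = v $ i * (b - x $ i) - (x $ i - a) * v $ i" for x v :: "real ^ 'n"
  define q' where "q' t = real k * (2 * max 0 t) / (1 + real k * (max 0 t)\<^sup>2)\<^sup>2" for t
  have pos: "1 + real k * (max 0 t)\<^sup>2 \<noteq> 0" for t
    by (metis add_pos_nonneg less_irrefl mult_nonneg_nonneg of_nat_0_le_iff zero_le_power2 zero_less_one)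
  have q: "(bump k has_real_derivative q' t) (at t)" for t
  proof -
    have "((\<lambda>t. real k * (max 0 t)\<^sup>2 / (1 + real k * (max 0 t)\<^sup>2)) has_real_derivative
      (real k * (2 * max 0 t) * (1 + real k * (max 0 t)\<^sup>2) - real k * (max 0 t)\<^sup>2 * (0 + real k * (2 * max 0 t)))
        / ((1 + real k * (max 0 t)\<^sup>2) * (1 + real k * (max 0 t)\<^sup>2))) (at t)"
      by (intro DERIV_divide DERIV_add DERIV_cmult max_square_has_derivative DERIV_const pos)
    moreover have "(real k * (2 * max 0 t) * (1 + real k * (max 0 t)\<^sup>2) - real k * (max 0 t)\<^sup>2 * (0 + real k * (2 * max 0 t)))
        / ((1 + real k * (max 0 t)\<^sup>2) * (1 + real k * (max 0 t)\<^sup>2)) = q' t"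
      by (simp add: q'_def power2_eq_square algebra_simps)
    ultimately show ?thesis unfolding bump_def[abs_def] by simp
  qed
  have r: "(r has_derivative r' x) (at x)" for x
    unfolding r_def[abs_def] r'_def[abs_def]
    by (auto intro!: derivative_eq_intros bounded_linear.has_derivative[OF bounded_linear_vec_nth] simp: algebra_simps)
  show "((\<lambda>x. complex_of_real (bump k ((x $ i - a) * (b - x $ i)))) has_derivative
      (\<lambda>v. complex_of_real (q' (r x) * r' x v))) (at x)" for x
  proof -
    have "((\<lambda>x. bump k (r x)) has_derivative (\<lambda>v. q' (r x) * r' x v)) (at x)"
      using has_derivative_compose[OF r q[unfolded has_field_derivative_def]] by simp
    from has_derivative_of_real[OF this] show ?thesis by (simp add: r_def)
  qed
  show "continuous_on UNIV (\<lambda>x. complex_of_real (q' (r x) * r' x v))" for v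
    unfolding q'_def r_def r'_def using pos by (intro continuous_intros) auto
qed

definition box_bump :: "nat \<Rightarrow> real ^ 'n \<Rightarrow> real ^ 'n \<Rightarrow> real ^ 'n \<Rightarrow> complex" where
  "box_bump k a b x = (\<Prod>i\<in>UNIV. complex_of_real (bump k ((x $ i - a $ i) * (b $ i - x $ i))))"

lemma box_bump_outside:
  assumes "box a b \<noteq> {}" "x \<notin> box a b"
  shows "box_bump k a b x = 0"
proof -
  obtain i where i: "\<not> (a $ i < x $ i \<and> x $ i < b $ i)" using assms(2) by (auto simp: mem_box_cart)
  \<comment> \<open>Nonemptiness enters here: with reversed end points both factors would be
    negative between them and their product positive.\<close>
  have "a $ i < b $ i" using assms(1) by (metis all_not_in_conv less_trans mem_box_cart(1))
  then have "(x $ i - a $ i) * (b $ i - x $ i) \<le> 0"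
    using i by (auto simp: mult_le_0_iff)
  then show ?thesis by (auto simp: box_bump_def intro!: bump_nonpos)
qed

lemma box_bump_norm: "cmod (box_bump k a b x) \<le> 1"
  unfolding box_bump_def prod_norm[symmetric]
  using bump_bounds by (intro prod_le_1) (auto simp: abs_of_nonneg)

lemma box_bump_tendsto:
  assumes "x \<in> box a b"
  shows "(\<lambda>k. box_bump k a b x) \<longlonglongrightarrow> 1"
proof -
  have "(\<lambda>k. box_bump k a b x) \<longlonglongrightarrow> (\<Prod>i\<in>(UNIV::'a set). complex_of_real 1)"
    unfolding box_bump_def using assms
    by (intro tendsto_prod tendsto_of_real bump_tendsto) (auto simp: mem_box_cart)
  then show ?thesis by simp
qed

lemma test_function_box_bump:
  assumes "box a b \<noteq> {}"
  shows "test_function (box_bump k a b)"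
proof -
  have "C1_function (box_bump k a b)"
    unfolding box_bump_def[abs_def] by (intro C1_function_prod C1_function_bump) auto
  moreover have "{x. box_bump k a b x \<noteq> 0} \<subseteq> cbox a b"
    using box_bump_outside[OF assms] box_subset_cbox by blast
  then have "compact (closure {x. box_bump k a b x \<noteq> 0})"
    using bounded_subset bounded_cbox compact_closure by blast
  ultimately show ?thesis by (simp add: test_function_def C1_function_def)
qed

lemma square_integrable_indicator:
  assumes [measurable]: "A \<in> sets borel" and A: "emeasure lborel A < \<infinity>"
  shows "square_integrable (indicator A)"
proof (rule integrable_square_integrable_bounded[where C=1])
  have "integrable lborel (\<lambda>x. complex_of_real (indicator A x))"
    using A by (intro integrable_of_real integrable_real_indicator) auto
  moreover have "complex_of_real (indicator A x) = indicator A x" for x by (simp add: indicator_def)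
  ultimately show "integrable lborel (indicator A :: _ \<Rightarrow> complex)" by simp
qed (simp add: indicator_def)

text \<open>Fundamental lemma of the calculus of variations. The functions \<open>box_bump\<close>
  converge boundedly to the indicator of a box, so w has integral 0 over every box; boxes form an
  intersection-stable generator, and a Dynkin argument passes to Borel sets.\<close>

lemma AE_zero_of_test_functions:
  fixes w :: "real ^ 'n \<Rightarrow> complex"
  assumes w: "square_integrable w"
    and test: "\<And>\<phi>. test_function \<phi> \<Longrightarrow> (LINT x|lborel. w x * \<phi> x) = 0"
  shows "AE x in lborel. w x = 0"
proof -
  have [measurable]: "w \<in> borel_measurable borel" using w by measurable
  have wi: "integrable lborel (\<lambda>x. w x * indicator (box a b) x)" for a b
    by (rule square_integrable_mult_integrable[OF w square_integrable_indicator])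
    (use emeasure_lborel_box_finite[of a b] in auto)
  have box0: "(LINT x|lborel. w x * indicator (box a b) x) = 0" for a b
  proof (cases "box a b = {}")
    case False
    have "(\<lambda>k. LINT x|lborel. w x * box_bump k a b x) \<longlonglongrightarrow> (LINT x|lborel. w x * indicator (box a b) x)"
    proof (rule integral_dominated_convergence)
      show "integrable lborel (\<lambda>x. norm (w x * indicator (box a b) x))" using wi by (rule integrable_norm)
      show "(\<lambda>x. w x * box_bump k a b x) \<in> borel_measurable lborel" for k
        using test_function_box_bump[OF False, of k] C1_function_continuous[of "box_bump k a b"]
        by (auto simp: test_function_def C1_function_def intro!: borel_measurable_times[OF _ borel_measurable_continuous_onI])
      show "AE x in lborel. (\<lambda>k. w x * box_bump k a b x) \<longlonglongrightarrow> w x * indicator (box a b) x"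
      proof (intro AE_I2 tendsto_mult tendsto_const)
        show "(\<lambda>k. box_bump k a b x) \<longlonglongrightarrow> indicator (box a b) x" for x
          using box_bump_tendsto[of x a b] box_bump_outside[OF False, of x] by (cases "x \<in> box a b") auto
      qed
      show "AE x in lborel. norm (w x * box_bump k a b x) \<le> norm (w x * indicator (box a b) x)" for k
      proof (intro AE_I2)
        show "norm (w x * box_bump k a b x) \<le> norm (w x * indicator (box a b) x)" for x
          using box_bump_norm[of k a b x] box_bump_outside[OF False, of x k]
          by (cases "x \<in> box a b") (auto simp: norm_mult intro!: mult_left_le)
      qed
    qed measurable
    then show ?thesis
      using test[OF test_function_box_bump[OF False]] by (simp add: LIMSEQ_const_iff)
  qed simp
  \<comment> \<open>A square integrable w need not be integrable on the whole space. Cutting it to a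
    bounded box gives an integrable f, as uniqueness of densities and the complement step of the
    induction require.\<close>
  define B where "B N = box (- (real N *\<^sub>R One)) (real N *\<^sub>R One :: real ^ 'n)" for N :: nat
  have "AE x in lborel. w x * indicator (B N) x = 0" for N
  proof (rule sigma_finite_measure.density_zero[OF sigma_finite_lborel])
    define f where "f x = w x * indicator (B N) x" for x
    have f: "integrable lborel f" unfolding f_def B_def by (rule wi)
    then show "integrable lborel (\<lambda>x. w x * indicator (B N) x)" by (simp add: f_def[abs_def])
    fix A :: "(real ^ 'n) set" assume "A \<in> sets lborel"
    then have A: "A \<in> sigma_sets UNIV (range (\<lambda>(a, b). box a b))"
      by (simp add: borel_eq_box)
    have sets: "sigma_sets UNIV (range (\<lambda>(a, b). box a b::(real^'n) set)) = sets borel"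
      by (simp add: borel_eq_box)
    have st: "Int_stable (range (\<lambda>(a, b). box a b :: (real ^ 'n) set))"
      by (auto simp: Int_stable_def box_Int_box)
    have cl: "range (\<lambda>(a, b). box a b :: (real ^ 'n) set) \<subseteq> Pow UNIV" by simp
    have "(LINT x:A|lborel. f x) = 0"
      using st cl A
    proof (induction A rule: sigma_sets_induct_disjoint)
      case (basic A)
      then obtain a b where "A = box a b" by auto
      then obtain a' b' where "A \<inter> B N = box a' b'" by (auto simp: B_def box_Int_box)
      then have *: "(\<lambda>x. indicat_real A x *\<^sub>R f x) = (\<lambda>x. w x * indicator (box a' b') x)"
        by (auto simp: f_def fun_eq_iff indicator_def split: if_splits)
      show "(LINT x:A|lborel. f x) = 0" unfolding set_lebesgue_integral_def * by (rule box0)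
    next
      case empty
      show ?case by (simp add: set_lebesgue_integral_def)
    next
      case (compl A)
      have "(LINT x:UNIV - A|lborel. f x) = (LINT x|lborel. f x) - (LINT x:A|lborel. f x)"
      proof -
        have [measurable]: "A \<in> sets borel" using compl(1) sets by simp
        have "(LINT x:UNIV - A|lborel. f x) = (LINT x|lborel. f x - indicat_real A x *\<^sub>R f x)"
          unfolding set_lebesgue_integral_def by (intro Bochner_Integration.integral_cong) (auto simp: indicator_def)
        also have "\<dots> = (LINT x|lborel. f x) - (LINT x:A|lborel. f x)"
          unfolding set_lebesgue_integral_def
          by (intro Bochner_Integration.integral_diff f integrable_mult_indicator) auto
        finally show ?thesis .
      qed
      moreover have "(LINT x|lborel. f x) = 0" unfolding f_def B_def by (rule box0)
      ultimately show ?case using compl by simp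
    next
      case (union A)
      then have [measurable]: "A i \<in> sets borel" for i using sets by auto
      have "(LINT x:(\<Union>i. A i)|lborel. f x) = (\<Sum>i. LINT x:A i|lborel. f x)"
        using union(1) f by (intro lebesgue_integral_countable_add)
          (auto simp: disjoint_family_on_def set_integrable_def intro!: integrable_mult_indicator)
      then show ?case using union(3) by simp
    qed
    then show "(LINT x:A|lborel. w x * indicator (B N) x) = 0" by (simp add: f_def[abs_def])
  qed
  then have *: "AE x in lborel. \<forall>N. w x * indicator (B N) x = 0" by (subst AE_all_countable) auto
  have ex: "\<exists>N. x \<in> B N" for x using UN_box_eq_UNIV[where 'a="real^'n"] unfolding B_def by blast
  from * show ?thesis
  proof (elim eventually_mono)
    fix x assume *: "\<forall>N. w x * indicator (B N) x = 0"
    obtain N where "x \<in> B N" using ex by blast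
    with *[rule_format, of N] show "w x = 0" by simp
  qed
qed

section \<open>Gaussians\<close>

lemma (in pair_sigma_finite) integrable_pair_bound:
  fixes F :: "_ \<Rightarrow> _ \<Rightarrow> complex"
  assumes F: "case_prod F \<in> borel_measurable (M1 \<Otimes>\<^sub>M M2)"
    and a: "integrable M1 a" and b: "integrable M2 b"
    and le: "\<And>x y. cmod (F x y) \<le> norm (a x :: complex) * norm (b y :: complex)"
  shows "integrable (M1 \<Otimes>\<^sub>M M2) (case_prod F)"
proof (rule integrableI_bounded[OF F])
  have [measurable]: "a \<in> borel_measurable M1" "b \<in> borel_measurable M2" using a b by measurable
  have "(\<integral>\<^sup>+z. ennreal (norm (case_prod F z)) \<partial>(M1 \<Otimes>\<^sub>M M2))
      \<le> (\<integral>\<^sup>+z. (case z of (x, y) \<Rightarrow> ennreal (norm (a x)) * ennreal (norm (b y))) \<partial>(M1 \<Otimes>\<^sub>M M2))"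
    using le by (intro nn_integral_mono) (auto simp: ennreal_mult[symmetric] intro!: ennreal_leI)
  also have "\<dots> = (\<integral>\<^sup>+x. \<integral>\<^sup>+y. ennreal (norm (a x)) * ennreal (norm (b y)) \<partial>M2 \<partial>M1)"
    by (subst M2.nn_integral_fst[symmetric]) auto
  also have "\<dots> = (\<integral>\<^sup>+x. norm (a x) \<partial>M1) * (\<integral>\<^sup>+y. norm (b y) \<partial>M2)"
    by (simp add: nn_integral_cmult nn_integral_multc)
  also have "\<dots> < \<infinity>"
    using a b by (auto simp: integrable_iff_bounded ennreal_mult_less_top)
  finally show "(\<integral>\<^sup>+z. ennreal (norm (case_prod F z)) \<partial>(M1 \<Otimes>\<^sub>M M2)) < \<infinity>" .
qed

text \<open>Integrability is not assumed: for a function that is not integrable the Bochner integral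
  is 0 by convention, and the bound is trivial.\<close>

lemma norm_integral_le_nn_integral:
  fixes f :: "'a \<Rightarrow> 'b::{banach, second_countable_topology}"
  shows "ennreal (norm (integral\<^sup>L M f)) \<le> (\<integral>\<^sup>+x. ennreal (norm (f x)) \<partial>M)"
  by (cases "integrable M f") (auto intro: integral_norm_bound_ennreal simp: not_integrable_integral_eq)

lemma nn_integral_lborel_affine:
  fixes t :: "'a::euclidean_space"
  assumes [measurable]: "f \<in> borel_measurable borel" and c: "c \<noteq> 0"
  shows "(\<integral>\<^sup>+x. f x \<partial>lborel) = ennreal (\<bar>c\<bar>^DIM('a)) * (\<integral>\<^sup>+x. f (t + c *\<^sub>R x) \<partial>lborel)"
  by (subst lborel_affine[OF c, of t])
     (simp add: nn_integral_density nn_integral_distr nn_integral_cmult)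

lemma integrable_lborel_affine:
  fixes t :: "'a::euclidean_space" and f :: "'a \<Rightarrow> 'b::{banach, second_countable_topology}"
  assumes f: "integrable lborel f" and c: "c \<noteq> 0"
  shows "integrable lborel (\<lambda>x. f (t + c *\<^sub>R x))"
proof -
  have [measurable]: "f \<in> borel_measurable borel" using f by measurable
  show ?thesis
    using f nn_integral_lborel_affine[OF _ c, of "\<lambda>x. ennreal (norm (f x))" t] c
    by (auto simp: integrable_iff_bounded ennreal_mult_less_top)
qed

lemma integral_lborel_affine:
  fixes t :: "'a::euclidean_space" and f :: "'a \<Rightarrow> 'b::{banach, second_countable_topology}"
  assumes [measurable]: "f \<in> borel_measurable borel" and c: "c \<noteq> 0"
  shows "(LINT x|lborel. f x) = \<bar>c\<bar>^DIM('a) *\<^sub>R (LINT x|lborel. f (t + c *\<^sub>R x))"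
  by (subst lborel_affine[OF c, of t])
     (simp add: integral_density integral_distr)

lemma integral_lborel_reflect:
  fixes f :: "'a::euclidean_space \<Rightarrow> 'b::{banach, second_countable_topology}"
  assumes "f \<in> borel_measurable borel"
  shows "(LINT x|lborel. f (t - x)) = (LINT x|lborel. f x)"
  using integral_lborel_affine[OF assms, of "-1" t] by simp

lemma integral_lborel_uminus:
  fixes f :: "'a::euclidean_space \<Rightarrow> 'b::{banach, second_countable_topology}"
  assumes "f \<in> borel_measurable borel"
  shows "(LINT x|lborel. f (- x)) = (LINT x|lborel. f x)"
  using integral_lborel_reflect[OF assms, of 0] by simp

lemma integral_lborel_translate:
  fixes f :: "'a::euclidean_space \<Rightarrow> 'b::{banach, second_countable_topology}"
  assumes "f \<in> borel_measurable borel"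
  shows "(LINT x|lborel. f (t + x)) = (LINT x|lborel. f x)"
  using integral_lborel_affine[OF assms, of 1 t] by simp

lemma integral_lborel_prod:
  fixes f :: "'a::euclidean_space \<Rightarrow> real \<Rightarrow> complex"
  assumes f: "\<And>b. b \<in> Basis \<Longrightarrow> integrable lborel (f b)"
  shows "integrable lborel (\<lambda>x::'a. \<Prod>b\<in>Basis. f b (x \<bullet> b))"
    and "(LINT x|lborel. (\<Prod>b\<in>Basis. f b ((x::'a) \<bullet> b))) = (\<Prod>b\<in>Basis. LINT x|lborel. f b x)"
proof -
  interpret product_sigma_finite "\<lambda>_::'a. lborel :: real measure"
    by standard
  have [measurable]: "f b \<in> borel_measurable borel" if "b \<in> Basis" for b using f[OF that] by measurable
  define g where "g x = (\<Prod>b\<in>Basis. f b (x \<bullet> b))" for x :: 'a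
  have [measurable]: "g \<in> borel_measurable borel" unfolding g_def by measurable
  have T [measurable]: "(\<lambda>h. \<Sum>b\<in>Basis. h b *\<^sub>R b :: 'a) \<in> measurable (\<Pi>\<^sub>M b\<in>Basis. lborel) borel"
    by measurable
  have g: "g (\<Sum>b\<in>Basis. h b *\<^sub>R b) = (\<Prod>b\<in>Basis. f b (h b))" for h :: "'a \<Rightarrow> real"
    unfolding g_def by (intro prod.cong) (auto simp: inner_sum_left_Basis)
  have "integrable lborel g \<longleftrightarrow> integrable (\<Pi>\<^sub>M b\<in>Basis. lborel) (\<lambda>h. \<Prod>b\<in>(Basis::'a set). f b (h b))"
    unfolding g[symmetric] by (subst lborel_eq, rule integrable_distr_eq) auto
  moreover have "integrable (\<Pi>\<^sub>M b\<in>Basis. lborel) (\<lambda>h. \<Prod>b\<in>(Basis::'a set). f b (h b))"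
    by (rule product_integrable_prod) (auto intro: f)
  ultimately show "integrable lborel (\<lambda>x::'a. \<Prod>b\<in>Basis. f b (x \<bullet> b))" by (simp add: g_def[abs_def])
  have "(LINT x|lborel. g x) = (LINT h|(\<Pi>\<^sub>M b\<in>Basis. lborel). (\<Prod>b\<in>(Basis::'a set). f b (h b)))"
    unfolding g[symmetric] by (subst lborel_eq, rule integral_distr) auto
  also have "\<dots> = (\<Prod>b\<in>Basis. LINT x|lborel. f b x)"
    by (rule product_integral_prod) (auto intro: f)
  finally show "(LINT x|lborel. (\<Prod>b\<in>Basis. f b ((x::'a) \<bullet> b))) = (\<Prod>b\<in>Basis. LINT x|lborel. f b x)"
    by (simp add: g_def)
qed

section \<open>Gaussian integrals and their transforms\<close>

lemma integrable_gaussian_real: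
  assumes "0 < \<epsilon>"
  shows "integrable lborel (\<lambda>x::real. exp (- \<epsilon> * x\<^sup>2))"
proof -
  have "integrable lborel (\<lambda>x::real. exp (- (x)\<^sup>2))"
    using has_bochner_integral_even_function[OF gaussian_moment_0] by (auto simp: has_bochner_integral_iff)
  from lborel_integrable_real_affine[OF this, of "sqrt \<epsilon>" 0] assms
  show ?thesis by (simp add: power_mult_distrib)
qed

text \<open>A rescaling of the characteristic function of the standard normal distribution.\<close>

lemma fourier_gaussian_real:
  assumes e: "0 < \<epsilon>"
  shows "(LINT x|lborel. complex_of_real (exp (- \<epsilon> * x\<^sup>2)) * cis (- (x * z)))
     = complex_of_real (sqrt (pi / \<epsilon>) * exp (- z\<^sup>2 / (4 * \<epsilon>)))"
proof -
  \<comment> \<open>With x replaced by c x the normal exponent (c x)^2 / 2 becomes \<epsilon> x^2,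
    and the frequency t = - z / c is fixed by t c x = - x z.\<close>
  define c where "c = sqrt (2 * \<epsilon>)"
  have c: "0 < c" "c\<^sup>2 = 2 * \<epsilon>" using e by (simp_all add: c_def)
  define t where "t = - z / c"
  have "complex_of_real (exp (- (t\<^sup>2) / 2)) = (CLINT x|lborel. std_normal_density x *\<^sub>R iexp (t * x))"
    using fun_cong[OF char_std_normal_distribution, of t]
    by (simp add: char_def integral_density normal_density_nonneg)
  also have "\<dots> = \<bar>c\<bar> *\<^sub>R (CLINT x|lborel. std_normal_density (0 + c * x) *\<^sub>R iexp (t * (0 + c * x)))"
    using c by (intro lborel_integral_real_affine) auto
  also have "(\<lambda>x. std_normal_density (0 + c * x) *\<^sub>R iexp (t * (0 + c * x))) =
     (\<lambda>x. complex_of_real (1 / sqrt (2 * pi)) * (complex_of_real (exp (- \<epsilon> * x\<^sup>2)) * cis (- (x * z))))"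
  proof
    fix x
    have "t * (c * x) = - (x * z)" using c by (simp add: t_def)
    then have "iexp (t * (0 + c * x)) = cis (- (x * z))" by (simp add: cis_conv_exp)
    moreover have "std_normal_density (0 + c * x) = 1 / sqrt (2 * pi) * exp (- \<epsilon> * x\<^sup>2)"
      using c by (simp add: std_normal_density_def power_mult_distrib)
    ultimately show "std_normal_density (0 + c * x) *\<^sub>R iexp (t * (0 + c * x)) =
      complex_of_real (1 / sqrt (2 * pi)) * (complex_of_real (exp (- \<epsilon> * x\<^sup>2)) * cis (- (x * z)))"
      by (simp add: scaleR_conv_of_real)
  qed
  finally have "complex_of_real (exp (- (t\<^sup>2) / 2)) = complex_of_real (c / sqrt (2 * pi)) *
     (LINT x|lborel. complex_of_real (exp (- \<epsilon> * x\<^sup>2)) * cis (- (x * z)))"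
    using c by (simp add: scaleR_conv_of_real)
  moreover have "c / sqrt (2 * pi) = sqrt (\<epsilon> / pi)"
    by (simp add: c_def real_sqrt_divide[symmetric])
  moreover have "- (t\<^sup>2) / 2 = - z\<^sup>2 / (4 * \<epsilon>)" using c by (simp add: t_def power_divide)
  ultimately have "complex_of_real (sqrt (pi / \<epsilon>)) * complex_of_real (exp (- z\<^sup>2 / (4 * \<epsilon>)))
     = complex_of_real (sqrt (pi / \<epsilon>) * sqrt (\<epsilon> / pi)) *
     (LINT x|lborel. complex_of_real (exp (- \<epsilon> * x\<^sup>2)) * cis (- (x * z)))"
    by simp
  moreover have "sqrt (pi / \<epsilon>) * sqrt (\<epsilon> / pi) = 1"
    using e by (simp add: real_sqrt_mult[symmetric])
  ultimately show ?thesis by simp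
qed

lemma norm_square_eq_sum_Basis: "(norm x)\<^sup>2 = (\<Sum>b\<in>Basis. (x \<bullet> b)\<^sup>2)"
  by (subst power2_norm_eq_inner, subst euclidean_inner) (simp add: power2_eq_square)

lemma gaussian_prod:
  fixes \<xi> :: "'a::euclidean_space"
  shows "complex_of_real (exp (- \<epsilon> * (norm \<xi>)\<^sup>2)) * cis (- (\<xi> \<bullet> z))
    = (\<Prod>b\<in>Basis. complex_of_real (exp (- \<epsilon> * (\<xi> \<bullet> b)\<^sup>2)) * cis (- ((\<xi> \<bullet> b) * (z \<bullet> b))))"
proof -
  have "exp (- \<epsilon> * (norm \<xi>)\<^sup>2) = (\<Prod>b\<in>Basis. exp (- \<epsilon> * (\<xi> \<bullet> b)\<^sup>2))"
    by (simp add: norm_square_eq_sum_Basis sum_distrib_left exp_sum sum_negf[symmetric])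
  moreover have "cis (- (\<xi> \<bullet> z)) = (\<Prod>b\<in>Basis. cis (- ((\<xi> \<bullet> b) * (z \<bullet> b))))"
    by (simp add: euclidean_inner[of \<xi> z] cis_conv_exp sum_distrib_left exp_sum sum_negf[symmetric] )
  ultimately show ?thesis by (simp add: prod.distrib of_real_prod)
qed

lemma fourier_gaussian:
  fixes z :: "'a::euclidean_space"
  assumes e: "0 < \<epsilon>"
  shows "integrable lborel (\<lambda>\<xi>. complex_of_real (exp (- \<epsilon> * (norm \<xi>)\<^sup>2)) * cis (- (\<xi> \<bullet> z)))"
    and "(LINT \<xi>|lborel. complex_of_real (exp (- \<epsilon> * (norm \<xi>)\<^sup>2)) * cis (- (\<xi> \<bullet> z)))
      = complex_of_real (sqrt (pi / \<epsilon>) ^ DIM('a) * exp (- (norm z)\<^sup>2 / (4 * \<epsilon>)))"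
proof -
  have int: "integrable lborel (\<lambda>x. complex_of_real (exp (- \<epsilon> * x\<^sup>2)) * cis (- (x * y)))" for y
    by (rule Bochner_Integration.integrable_bound[OF integrable_gaussian_real[OF e]])
      (auto simp: norm_mult cis_conv_exp)
  show "integrable lborel (\<lambda>\<xi>. complex_of_real (exp (- \<epsilon> * (norm \<xi>)\<^sup>2)) * cis (- (\<xi> \<bullet> z)))"
    unfolding gaussian_prod
    by (rule integral_lborel_prod(1)[of "\<lambda>b x. complex_of_real (exp (- \<epsilon> * x\<^sup>2)) * cis (- (x * (z \<bullet> b)))"]) (rule int)
  have "(LINT \<xi>|lborel. complex_of_real (exp (- \<epsilon> * (norm \<xi>)\<^sup>2)) * cis (- (\<xi> \<bullet> z)))
    = (\<Prod>b\<in>(Basis::'a set). complex_of_real (sqrt (pi / \<epsilon>) * exp (- (z \<bullet> b)\<^sup>2 / (4 * \<epsilon>))))"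
    unfolding gaussian_prod fourier_gaussian_real[OF e, symmetric]
    by (rule integral_lborel_prod(2)[of "\<lambda>b x. complex_of_real (exp (- \<epsilon> * x\<^sup>2)) * cis (- (x * (z \<bullet> b)))"]) (rule int)
  also have "\<dots> = complex_of_real (sqrt (pi / \<epsilon>) ^ DIM('a) * (\<Prod>b\<in>(Basis::'a set). exp (- (z \<bullet> b)\<^sup>2 / (4 * \<epsilon>))))"
    by (simp only: of_real_prod[symmetric] prod.distrib prod_constant)
  also have "(\<Prod>b\<in>(Basis::'a set). exp (- (z \<bullet> b)\<^sup>2 / (4 * \<epsilon>))) = exp (- (norm z)\<^sup>2 / (4 * \<epsilon>))"
    by (simp add: norm_square_eq_sum_Basis sum_divide_distrib exp_sum[symmetric] sum_negf)
  finally show "(LINT \<xi>|lborel. complex_of_real (exp (- \<epsilon> * (norm \<xi>)\<^sup>2)) * cis (- (\<xi> \<bullet> z)))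
      = complex_of_real (sqrt (pi / \<epsilon>) ^ DIM('a) * exp (- (norm z)\<^sup>2 / (4 * \<epsilon>)))" .
qed

lemma integral_gaussian:
  assumes e: "0 < \<epsilon>"
  shows "integrable lborel (\<lambda>\<xi>::'a::euclidean_space. exp (- \<epsilon> * (norm \<xi>)\<^sup>2))"
    and "(LINT \<xi>|lborel. exp (- \<epsilon> * (norm (\<xi>::'a))\<^sup>2)) = sqrt (pi / \<epsilon>) ^ DIM('a)"
proof -
  show i: "integrable lborel (\<lambda>\<xi>::'a::euclidean_space. exp (- \<epsilon> * (norm \<xi>)\<^sup>2))"
    using fourier_gaussian(1)[OF e, of "0::'a"] by (simp add: complex_of_real_integrable_eq)
  have "complex_of_real (LINT \<xi>|lborel. exp (- \<epsilon> * (norm (\<xi>::'a))\<^sup>2)) = complex_of_real (sqrt (pi / \<epsilon>) ^ DIM('a))"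
    using fourier_gaussian(2)[OF e, of "0::'a"] by simp
  then show "(LINT \<xi>|lborel. exp (- \<epsilon> * (norm (\<xi>::'a))\<^sup>2)) = sqrt (pi / \<epsilon>) ^ DIM('a)"
    by (simp only: of_real_eq_iff)
qed

section \<open>The Fourier transform of integrable functions\<close>

text \<open>Unnormalised, as in \<open>has_fourier\<close>; hence (2 pi)^n appears in the mass of
  the heat kernel, in Parseval's identity and in inversion.\<close>

definition fou :: "(real ^ 'n \<Rightarrow> complex) \<Rightarrow> real ^ 'n \<Rightarrow> complex" where
  "fou f \<xi> = (LINT x|lborel. f x * cis (- (\<xi> \<bullet> x)))"

lemma borel_measurable_cis [measurable (raw)]:
  "f \<in> borel_measurable M \<Longrightarrow> (\<lambda>x. cis (f x)) \<in> borel_measurable M"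
  unfolding cis_conv_exp by measurable

lemma borel_measurable_cnj [measurable (raw)]:
  "f \<in> borel_measurable M \<Longrightarrow> (\<lambda>x. cnj (f x)) \<in> borel_measurable M"
  by (erule measurable_compose) (intro borel_measurable_continuous_onI continuous_intros)

lemma fou_measurable [measurable]:
  assumes [measurable]: "f \<in> borel_measurable borel"
  shows "fou f \<in> borel_measurable borel"
  unfolding fou_def[abs_def] by measurable

lemma integrable_mult_cis:
  fixes f :: "'a \<Rightarrow> complex"
  assumes f: "integrable M f" and [measurable]: "g \<in> borel_measurable M"
  shows "integrable M (\<lambda>x. f x * cis (g x))"
proof -
  have [measurable]: "f \<in> borel_measurable M" using f by measurable
  show ?thesis by (rule Bochner_Integration.integrable_bound[OF f]) (auto simp: norm_mult)
qed

lemma fou_diff: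
  assumes "integrable lborel f" "integrable lborel g"
  shows "fou (\<lambda>x. f x - g x) \<xi> = fou f \<xi> - fou g \<xi>"
  unfolding fou_def left_diff_distrib
  by (intro Bochner_Integration.integral_diff integrable_mult_cis assms) auto

lemma fou_norm_le: "cmod (fou f \<xi>) \<le> (LINT x|lborel. cmod (f x))"
proof -
  have "cmod (fou f \<xi>) \<le> (LINT x|lborel. norm (f x * cis (- (\<xi> \<bullet> x))))"
    unfolding fou_def by (rule integral_norm_bound)
  then show ?thesis by (simp add: norm_mult)
qed

lemma fou_uminus: "f \<in> borel_measurable borel \<Longrightarrow> fou (\<lambda>x. f (- x)) \<xi> = fou f (- \<xi>)"
  unfolding fou_def using integral_lborel_uminus[of "\<lambda>x. f x * cis (- (- \<xi> \<bullet> x))"] by simp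

text \<open>Fubini for a kernel symmetric in x and \<xi>. This is the source of every duality below;
  being bilinear, it matches the pairings in the definitions of the operators.\<close>

lemma integral_fou_mult:
  assumes f: "integrable lborel f" and g: "integrable lborel g"
  shows "(LINT \<xi>|lborel. fou f \<xi> * g \<xi>) = (LINT x|lborel. f x * fou g x)"
proof -
  have [measurable]: "f \<in> borel_measurable borel" "g \<in> borel_measurable borel" using f g by measurable
  have i: "integrable (lborel \<Otimes>\<^sub>M lborel) (\<lambda>(x, \<xi>). f x * g \<xi> * cis (- (\<xi> \<bullet> x)))"
    by (rule lborel_pair.integrable_pair_bound[OF _ f g]) (auto simp: norm_mult)
  have "(LINT \<xi>|lborel. fou f \<xi> * g \<xi>) = (LINT \<xi>|lborel. LINT x|lborel. f x * g \<xi> * cis (- (\<xi> \<bullet> x)))"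
    unfolding fou_def integral_mult_left_zero[symmetric] by (simp add: ac_simps)
  also have "\<dots> = (LINT x|lborel. LINT \<xi>|lborel. f x * g \<xi> * cis (- (\<xi> \<bullet> x)))"
    by (rule lborel_pair.Fubini_integral[OF i])
  also have "\<dots> = (LINT x|lborel. f x * fou g x)"
    unfolding fou_def integral_mult_right_zero[symmetric] by (simp add: ac_simps inner_commute)
  finally show ?thesis .
qed

section \<open>The heat kernel as the transform of a Gaussian\<close>

definition heat :: "real \<Rightarrow> real ^ 'n \<Rightarrow> real" where
  "heat \<epsilon> z = sqrt (pi / \<epsilon>) ^ CARD('n) * exp (- (norm z)\<^sup>2 / (4 * \<epsilon>))"

lemma heat_nonneg: "0 < \<epsilon> \<Longrightarrow> 0 \<le> heat \<epsilon> z"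
  by (simp add: heat_def)

lemma heat_measurable [measurable]: "heat \<epsilon> \<in> borel_measurable borel"
  unfolding heat_def[abs_def] by measurable

lemma heat_uminus [simp]: "heat \<epsilon> (- z) = heat \<epsilon> z"
  by (simp add: heat_def)

text \<open>The total mass is independent of \<epsilon>; it is (2 pi)^n and not 1 because
  \<open>heat\<close> is the unnormalised transform of exp(- \<epsilon> |\<xi>|^2).\<close>

lemma integral_heat:
  assumes e: "0 < \<epsilon>"
  shows "integrable lborel (heat \<epsilon> :: real ^ 'n \<Rightarrow> real)"
    and "(LINT z|lborel. heat \<epsilon> (z :: real ^ 'n)) = (2 * pi) ^ CARD('n)"
proof -
  have *: "heat \<epsilon> = (\<lambda>z::real ^ 'n. sqrt (pi / \<epsilon>) ^ CARD('n) * exp (- (1 / (4 * \<epsilon>)) * (norm z)\<^sup>2))"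
    by (simp add: heat_def fun_eq_iff)
  have e': "0 < 1 / (4 * \<epsilon>)" using e by simp
  show "integrable lborel (heat \<epsilon> :: real ^ 'n \<Rightarrow> real)"
    unfolding * by (intro integrable_mult_right integral_gaussian e')
  have "(LINT z|lborel. heat \<epsilon> (z :: real ^ 'n)) = (sqrt (pi / \<epsilon>) * sqrt (pi / (1 / (4 * \<epsilon>)))) ^ CARD('n)"
    unfolding * by (simp only: integral_mult_right_zero integral_gaussian(2)[OF e'] power_mult_distrib) simp
  also have "sqrt (pi / \<epsilon>) * sqrt (pi / (1 / (4 * \<epsilon>))) = sqrt ((2 * pi)\<^sup>2)"
    using e by (simp add: real_sqrt_mult[symmetric] power2_eq_square del: real_sqrt_abs real_sqrt_pow2)
  also have "\<dots> = \<bar>2 * pi\<bar>" by (rule real_sqrt_abs)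
  also have "\<dots> = 2 * pi" by simp
  finally show "(LINT z|lborel. heat \<epsilon> (z :: real ^ 'n)) = (2 * pi) ^ CARD('n)" .
qed

lemma fou_gaussian:
  fixes y :: "real ^ 'n"
  assumes e: "0 < \<epsilon>"
  shows "integrable lborel (\<lambda>\<xi>. complex_of_real (exp (- \<epsilon> * (norm \<xi>)\<^sup>2)) * cis (- (\<xi> \<bullet> x)))"
    and "fou (\<lambda>\<xi>. complex_of_real (exp (- \<epsilon> * (norm \<xi>)\<^sup>2)) * cis (- (\<xi> \<bullet> x))) y = heat \<epsilon> (x + y)"
proof -
  show "integrable lborel (\<lambda>\<xi>. complex_of_real (exp (- \<epsilon> * (norm \<xi>)\<^sup>2)) * cis (- (\<xi> \<bullet> x)))"
    by (rule fourier_gaussian(1)[OF e])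
  have "fou (\<lambda>\<xi>. complex_of_real (exp (- \<epsilon> * (norm \<xi>)\<^sup>2)) * cis (- (\<xi> \<bullet> x))) y
     = (LINT \<xi>|lborel. complex_of_real (exp (- \<epsilon> * (norm \<xi>)\<^sup>2)) * cis (- (\<xi> \<bullet> (x + y))))"
    unfolding fou_def by (intro Bochner_Integration.integral_cong refl)
      (simp add: inner_add_right cis_mult inner_commute add.commute)
  also have "\<dots> = heat \<epsilon> (x + y)"
    by (subst fourier_gaussian(2)[OF e]) (simp add: heat_def)
  finally show "fou (\<lambda>\<xi>. complex_of_real (exp (- \<epsilon> * (norm \<xi>)\<^sup>2)) * cis (- (\<xi> \<bullet> x))) y = heat \<epsilon> (x + y)" .
qed

text \<open>The multiplication formula applied twice. The Gaussian makes its product with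
  \<open>fou g\<close> integrable, as the formula requires; the kernel is evaluated at x + y, not at
  x - y, because nothing is conjugated.\<close>

lemma integral_fou_fou_gaussian:
  fixes f g :: "real ^ 'n \<Rightarrow> complex"
  assumes f: "integrable lborel f" and g: "integrable lborel g" and e: "0 < \<epsilon>"
  shows "(LINT \<xi>|lborel. fou f \<xi> * (fou g \<xi> * exp (- \<epsilon> * (norm \<xi>)\<^sup>2)))
     = (LINT x|lborel. f x * (LINT y|lborel. g y * heat \<epsilon> (x + y)))"
proof -
  have [measurable]: "f \<in> borel_measurable borel" "g \<in> borel_measurable borel" using f g by measurable
  define k where "k \<xi> = fou g \<xi> * exp (- \<epsilon> * (norm \<xi>)\<^sup>2)" for \<xi>
  have k: "integrable lborel k"
  proof (rule Bochner_Integration.integrable_bound)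
    show "integrable lborel (\<lambda>\<xi>. (LINT x|lborel. cmod (g x)) * exp (- \<epsilon> * (norm (\<xi>::real^'n))\<^sup>2))"
      by (intro integrable_mult_right integral_gaussian e)
    show "k \<in> borel_measurable lborel" unfolding k_def[abs_def] by measurable
    show "AE \<xi> in lborel. norm (k \<xi>) \<le> norm ((LINT x|lborel. cmod (g x)) * exp (- \<epsilon> * (norm \<xi>)\<^sup>2))"
      using fou_norm_le[of g] by (intro AE_I2) (auto simp: k_def norm_mult intro!: order_trans[OF _ abs_ge_self])
  qed
  have "fou k x = (LINT y|lborel. g y * heat \<epsilon> (x + y))" for x
  proof -
    have "fou k x = (LINT \<xi>|lborel. fou g \<xi> * (complex_of_real (exp (- \<epsilon> * (norm \<xi>)\<^sup>2)) * cis (- (\<xi> \<bullet> x))))"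
      unfolding fou_def[of k] k_def by (simp add: inner_commute mult.assoc)
    also have "\<dots> = (LINT y|lborel. g y * heat \<epsilon> (x + y))"
      by (subst integral_fou_mult[OF g fou_gaussian(1)[OF e]]) (simp only: fou_gaussian(2)[OF e])
    finally show ?thesis .
  qed
  then show ?thesis using integral_fou_mult[OF f k] by (simp add: k_def)
qed

lemma nn_integral_heat_shift:
  assumes "0 < \<epsilon>"
  shows "(\<integral>\<^sup>+y. ennreal (heat \<epsilon> (x - y :: real ^ 'n)) \<partial>lborel) = ennreal ((2 * pi) ^ CARD('n))"
proof -
  have "(\<integral>\<^sup>+y. ennreal (heat \<epsilon> (y :: real ^ 'n)) \<partial>lborel) = (\<integral>\<^sup>+y. ennreal (heat \<epsilon> (x - y)) \<partial>lborel)"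
    using nn_integral_lborel_affine[of "\<lambda>y. ennreal (heat \<epsilon> y)" "-1" x] by simp
  moreover have "(\<integral>\<^sup>+y. ennreal (heat \<epsilon> (y :: real ^ 'n)) \<partial>lborel) = ennreal ((2 * pi) ^ CARD('n))"
    unfolding integral_heat(2)[OF assms, symmetric]
    using integral_heat(1)[OF assms] heat_nonneg[OF assms] by (intro nn_integral_eq_integral) auto
  ultimately show ?thesis by simp
qed

text \<open>Multiplication of $|\hat f|^2$ by a Gaussian turns its integral into a double integral of
  $f(x) \overline{f(y)}$ against a heat kernel, to which the AM-GM inequality applies. Fatou's lemma
  then removes the Gaussian.\<close>

lemma nnL2_fou_le:
  fixes f :: "real ^ 'n \<Rightarrow> complex"
  assumes f: "integrable lborel f" and f2: "square_integrable f"
  shows "nnL2 (fou f) \<le> ennreal ((2 * pi) ^ CARD('n)) * nnL2 f"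
proof -
  have [measurable]: "f \<in> borel_measurable borel" using f by measurable
  have gauss: "(\<integral>\<^sup>+\<xi>. ennreal ((cmod (fou f \<xi>))\<^sup>2 * exp (- \<epsilon> * (norm \<xi>)\<^sup>2)) \<partial>lborel)
      \<le> ennreal ((2 * pi) ^ CARD('n)) * nnL2 f" if e: "0 < \<epsilon>" for \<epsilon>
  proof -
    have h0: "0 \<le> heat \<epsilon> z" for z :: "real ^ 'n" by (rule heat_nonneg[OF e])
    have habs: "\<bar>heat \<epsilon> z\<bar> = heat \<epsilon> z" for z :: "real ^ 'n" using h0 by simp
    have hcomm: "heat \<epsilon> (x - y) = heat \<epsilon> (y - x)" for x y :: "real ^ 'n"
      using heat_uminus[of \<epsilon> "x - y"] by simp
    \<comment> \<open>The transform of the conjugate reflection of f is the conjugate of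
      \<open>fou f\<close>, so the bilinear identity \<open>integral_fou_fou_gaussian\<close>
      produces the square of its modulus.\<close>
    define g where "g y = cnj (f (- y))" for y
    have "integrable lborel (\<lambda>y. f (0 + (-1) *\<^sub>R y))" by (rule integrable_lborel_affine[OF f]) simp
    then have g: "integrable lborel g" unfolding g_def by simp
    have fg: "fou g \<xi> = cnj (fou f \<xi>)" for \<xi>
    proof -
      have "fou g \<xi> = (LINT x|lborel. cnj (f (- x) * cis (- (\<xi> \<bullet> - x))))"
        by (simp add: fou_def g_def cis_cnj)
      also have "\<dots> = cnj (LINT x|lborel. f (- x) * cis (- (\<xi> \<bullet> - x)))" by (rule Bochner_Integration.integral_cnj)
      also have "(LINT x|lborel. f (- x) * cis (- (\<xi> \<bullet> - x))) = fou f \<xi>"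
        unfolding fou_def by (rule integral_lborel_uminus) measurable
      finally show ?thesis .
    qed
    have sq: "fou f \<xi> * (fou g \<xi> * complex_of_real (exp (- \<epsilon> * (norm \<xi>)\<^sup>2)))
       = complex_of_real ((cmod (fou f \<xi>))\<^sup>2 * exp (- \<epsilon> * (norm \<xi>)\<^sup>2))" for \<xi>
      unfolding fg by (simp add: complex_norm_square mult.assoc del: of_real_power)
    have int: "integrable lborel (\<lambda>\<xi>. (cmod (fou f \<xi>))\<^sup>2 * exp (- \<epsilon> * (norm \<xi>)\<^sup>2))"
    proof (rule Bochner_Integration.integrable_bound)
      show "integrable lborel (\<lambda>\<xi>. (LINT x|lborel. cmod (f x))\<^sup>2 * exp (- \<epsilon> * (norm (\<xi>::real^'n))\<^sup>2))"
        by (intro integrable_mult_right integral_gaussian e)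
      show "AE \<xi> in lborel. norm ((cmod (fou f \<xi>))\<^sup>2 * exp (- \<epsilon> * (norm \<xi>)\<^sup>2))
          \<le> norm ((LINT x|lborel. cmod (f x))\<^sup>2 * exp (- \<epsilon> * (norm \<xi>)\<^sup>2))"
        using fou_norm_le[of f] by (intro AE_I2) (auto simp: norm_mult intro!: power_mono)
    qed measurable
    define I where "I = (LINT \<xi>|lborel. (cmod (fou f \<xi>))\<^sup>2 * exp (- \<epsilon> * (norm \<xi>)\<^sup>2))"
    have "0 \<le> I" unfolding I_def by (intro integral_nonneg_AE) auto
    moreover have "complex_of_real I = (LINT x|lborel. f x * (LINT y|lborel. g y * heat \<epsilon> (x + y)))"
      using integral_fou_fou_gaussian[OF f g e] unfolding sq integral_complex_of_real I_def by simp
    ultimately have "I = cmod (LINT x|lborel. f x * (LINT y|lborel. g y * heat \<epsilon> (x + y)))"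
      by (metis abs_of_nonneg norm_of_real)
    moreover have "(\<integral>\<^sup>+\<xi>. ennreal ((cmod (fou f \<xi>))\<^sup>2 * exp (- \<epsilon> * (norm \<xi>)\<^sup>2)) \<partial>lborel) = ennreal I"
      unfolding I_def by (rule nn_integral_eq_integral[OF int]) auto
    ultimately have "(\<integral>\<^sup>+\<xi>. ennreal ((cmod (fou f \<xi>))\<^sup>2 * exp (- \<epsilon> * (norm \<xi>)\<^sup>2)) \<partial>lborel)
        = ennreal (cmod (LINT x|lborel. f x * (LINT y|lborel. g y * heat \<epsilon> (x + y))))"
      by simp
    also have "\<dots> \<le> (\<integral>\<^sup>+x. ennreal (cmod (f x)) * ennreal (cmod (LINT y|lborel. g y * heat \<epsilon> (x + y))) \<partial>lborel)"
      using norm_integral_le_nn_integral[of lborel "\<lambda>x. f x * (LINT y|lborel. g y * heat \<epsilon> (x + y))"]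
      by (simp add: norm_mult ennreal_mult)
    also have "\<dots> \<le> (\<integral>\<^sup>+x. ennreal (cmod (f x)) * (\<integral>\<^sup>+y. ennreal (cmod (f y) * heat \<epsilon> (x - y)) \<partial>lborel) \<partial>lborel)"
    proof (intro nn_integral_mono mult_left_mono)
      fix x
      have "(LINT y|lborel. g y * heat \<epsilon> (x + y)) = (LINT y|lborel. cnj (f y) * heat \<epsilon> (x - y))"
        using integral_lborel_uminus[of "\<lambda>y. cnj (f y) * heat \<epsilon> (x - y)"] by (simp add: g_def)
      then show "ennreal (cmod (LINT y|lborel. g y * heat \<epsilon> (x + y))) \<le> (\<integral>\<^sup>+y. ennreal (cmod (f y) * heat \<epsilon> (x - y)) \<partial>lborel)"
        using norm_integral_le_nn_integral[of lborel "\<lambda>y. cnj (f y) * heat \<epsilon> (x - y)"]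
        by (simp add: norm_mult habs)
    qed simp
    also have "\<dots> = (\<integral>\<^sup>+x. \<integral>\<^sup>+y. ennreal (cmod (f x)) * ennreal (cmod (f y) * heat \<epsilon> (x - y)) \<partial>lborel \<partial>lborel)"
      by (intro nn_integral_cong nn_integral_cmult[symmetric]) measurable
    also have "\<dots> \<le> (\<integral>\<^sup>+x. \<integral>\<^sup>+y. ennreal ((cmod (f x))\<^sup>2 / 2) * ennreal (heat \<epsilon> (x - y))
        + ennreal ((cmod (f y))\<^sup>2 / 2) * ennreal (heat \<epsilon> (x - y)) \<partial>lborel \<partial>lborel)"
    proof (intro nn_integral_mono)
      fix x y
      have "cmod (f x) * cmod (f y) \<le> (cmod (f x))\<^sup>2 / 2 + (cmod (f y))\<^sup>2 / 2"
        using sum_squares_bound[of "cmod (f x)" "cmod (f y)"] by simp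
      from mult_right_mono[OF this h0[of "x - y"]]
      show "ennreal (cmod (f x)) * ennreal (cmod (f y) * heat \<epsilon> (x - y)) \<le> ennreal ((cmod (f x))\<^sup>2 / 2) * ennreal (heat \<epsilon> (x - y))
        + ennreal ((cmod (f y))\<^sup>2 / 2) * ennreal (heat \<epsilon> (x - y))"
        using h0 by (simp add: ennreal_mult[symmetric] ennreal_plus[symmetric] distrib_right mult.assoc del: ennreal_plus)
    qed
    also have "\<dots> = (\<integral>\<^sup>+x. \<integral>\<^sup>+y. ennreal ((cmod (f x))\<^sup>2 / 2) * ennreal (heat \<epsilon> (x - y)) \<partial>lborel \<partial>lborel)
       + (\<integral>\<^sup>+x. \<integral>\<^sup>+y. ennreal ((cmod (f y))\<^sup>2 / 2) * ennreal (heat \<epsilon> (x - y)) \<partial>lborel \<partial>lborel)"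
      by (simp add: nn_integral_add)
    also have "(\<integral>\<^sup>+x. \<integral>\<^sup>+y. ennreal ((cmod (f y))\<^sup>2 / 2) * ennreal (heat \<epsilon> (x - y)) \<partial>lborel \<partial>lborel)
       = (\<integral>\<^sup>+y. \<integral>\<^sup>+x. ennreal ((cmod (f y))\<^sup>2 / 2) * ennreal (heat \<epsilon> (x - y)) \<partial>lborel \<partial>lborel)"
      by (rule lborel_pair.Fubini') measurable
    also have "\<dots> = (\<integral>\<^sup>+y. \<integral>\<^sup>+x. ennreal ((cmod (f y))\<^sup>2 / 2) * ennreal (heat \<epsilon> (y - x)) \<partial>lborel \<partial>lborel)"
      using hcomm by simp
    also have "(\<integral>\<^sup>+x. \<integral>\<^sup>+y. ennreal ((cmod (f x))\<^sup>2 / 2) * ennreal (heat \<epsilon> (x - y)) \<partial>lborel \<partial>lborel) + \<dots>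
       = (\<integral>\<^sup>+x. ennreal ((cmod (f x))\<^sup>2 / 2) * ennreal ((2 * pi) ^ CARD('n)) \<partial>lborel)
         + (\<integral>\<^sup>+x. ennreal ((cmod (f x))\<^sup>2 / 2) * ennreal ((2 * pi) ^ CARD('n)) \<partial>lborel)"
      using e by (simp add: nn_integral_cmult nn_integral_heat_shift)
    also have "\<dots> = (\<integral>\<^sup>+x. ennreal ((2 * pi) ^ CARD('n)) * ennreal ((cmod (f x))\<^sup>2) \<partial>lborel)"
      by (subst nn_integral_add[symmetric])
        (auto intro!: nn_integral_cong simp: ennreal_mult[symmetric] ennreal_plus[symmetric] mult.commute simp del: ennreal_plus)
    also have "\<dots> = ennreal ((2 * pi) ^ CARD('n)) * nnL2 f"
      unfolding nnL2_def by (intro nn_integral_cmult) measurable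
    finally show ?thesis .
  qed
  have "nnL2 (fou f) = (\<integral>\<^sup>+\<xi>. liminf (\<lambda>k. ennreal ((cmod (fou f \<xi>))\<^sup>2 * exp (- (1 / real (Suc k)) * (norm \<xi>)\<^sup>2))) \<partial>lborel)"
    unfolding nnL2_def
  proof (intro nn_integral_cong)
    fix \<xi> :: "real ^ 'n"
    have "(\<lambda>k. ennreal ((cmod (fou f \<xi>))\<^sup>2 * exp (- (1 / real (Suc k)) * (norm \<xi>)\<^sup>2))) \<longlonglongrightarrow> ennreal ((cmod (fou f \<xi>))\<^sup>2 * exp (- 0 * (norm \<xi>)\<^sup>2))"
      by (intro tendsto_intros) (simp add: LIMSEQ_Suc lim_1_over_n[THEN LIMSEQ_Suc] del: of_nat_Suc)
    from lim_imp_Liminf[OF _ this]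
    show "ennreal ((cmod (fou f \<xi>))\<^sup>2) = liminf (\<lambda>k. ennreal ((cmod (fou f \<xi>))\<^sup>2 * exp (- (1 / real (Suc k)) * (norm \<xi>)\<^sup>2)))"
      by simp
  qed
  also have "\<dots> \<le> liminf (\<lambda>k. \<integral>\<^sup>+\<xi>. ennreal ((cmod (fou f \<xi>))\<^sup>2 * exp (- (1 / real (Suc k)) * (norm \<xi>)\<^sup>2)) \<partial>lborel)"
    by (intro nn_integral_liminf) measurable
  also have "\<dots> \<le> liminf (\<lambda>k. ennreal ((2 * pi) ^ CARD('n)) * nnL2 f)"
    by (intro Liminf_mono always_eventually allI gauss) simp
  also have "\<dots> = ennreal ((2 * pi) ^ CARD('n)) * nnL2 f" by (simp add: Liminf_const)
  finally show ?thesis .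
qed

lemma fou_square_integrable:
  assumes "integrable lborel f" "square_integrable f"
  shows "square_integrable (fou f)"
proof -
  have [measurable]: "f \<in> borel_measurable borel" using assms(1) by measurable
  have "nnL2 (fou f) < \<infinity>"
    using nnL2_fou_le[OF assms] assms(2)
    by (auto simp: square_integrable_iff ennreal_mult_less_top intro: le_less_trans)
  then show ?thesis by (simp add: square_integrable_iff)
qed

text \<open>As a function of y, the shifted heat kernel is an approximate identity of mass (2 pi)^n
  concentrating at y = - x. The parameter is a square so that the substitution used to show this
  contains no square root.\<close>

lemma heat_approximation:
  fixes \<psi> :: "real ^ 'n \<Rightarrow> complex"
  assumes cont: "continuous_on UNIV \<psi>" and bd: "\<And>x. cmod (\<psi> x) \<le> M"
  shows "(\<lambda>k. LINT y|lborel. \<psi> y * heat ((1 / real (Suc k))\<^sup>2) (x + y)) \<longlonglongrightarrow> (2 * pi) ^ CARD('n) * \<psi> (- x)"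
    and "0 < \<epsilon> \<Longrightarrow> cmod (LINT y|lborel. \<psi> y * heat \<epsilon> (x + y)) \<le> M * (2 * pi) ^ CARD('n)"
proof -
  have [measurable]: "\<psi> \<in> borel_measurable borel" using cont by (rule borel_measurable_continuous_onI)
  define d where "d k = 1 / real (Suc k)" for k
  have d: "0 < d k" for k by (simp add: d_def)
  \<comment> \<open>The scaling y = - x + 2 d_k z turns the moving kernel into the fixed Gaussian
    exp(- |z|^2). The dependence on k is left only in the argument of \<psi>, where continuity and
    boundedness permit dominated convergence.\<close>
  have eq: "(LINT y|lborel. \<psi> y * heat ((d k)\<^sup>2) (x + y)) =
     (LINT z|lborel. (2 * sqrt pi) ^ CARD('n) *\<^sub>R (\<psi> (- x + (2 * d k) *\<^sub>R z) * exp (- 1 * (norm z)\<^sup>2)))" for k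
  proof -
    have "(LINT y|lborel. \<psi> y * heat ((d k)\<^sup>2) (x + y)) =
      \<bar>2 * d k\<bar> ^ DIM(real ^ 'n) *\<^sub>R (LINT z|lborel. \<psi> (- x + (2 * d k) *\<^sub>R z) * heat ((d k)\<^sup>2) (x + (- x + (2 * d k) *\<^sub>R z)))"
      using d[of k] by (intro integral_lborel_affine) auto
    also have "\<dots> = (LINT z|lborel. (2 * sqrt pi) ^ CARD('n) *\<^sub>R (\<psi> (- x + (2 * d k) *\<^sub>R z) * exp (- 1 * (norm z)\<^sup>2)))"
      unfolding integral_scaleR_right[symmetric]
    proof (intro Bochner_Integration.integral_cong refl)
      fix z :: "real ^ 'n"
      have s: "sqrt (pi / (d k)\<^sup>2) = sqrt pi / d k" using d[of k] by (simp add: real_sqrt_divide)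
      have n: "(norm ((2 * d k) *\<^sub>R z))\<^sup>2 / (4 * (d k)\<^sup>2) = (norm z)\<^sup>2"
        using d[of k] by (simp add: power_mult_distrib)
      have "(2 * d k) ^ CARD('n) * heat ((d k)\<^sup>2) ((2 * d k) *\<^sub>R z) = ((2 * d k) * (sqrt pi / d k)) ^ CARD('n) * exp (- (norm z)\<^sup>2)"
        unfolding heat_def s power_mult_distrib n minus_divide_left[symmetric] by (simp add: n)
      also have "(2 * d k) * (sqrt pi / d k) = 2 * sqrt pi" using d[of k] by simp
      finally have *: "(2 * d k) ^ CARD('n) * heat ((d k)\<^sup>2) ((2 * d k) *\<^sub>R z) = (2 * sqrt pi) ^ CARD('n) * exp (- (norm z)\<^sup>2)" .
      show "\<bar>2 * d k\<bar> ^ DIM(real ^ 'n) *\<^sub>R (\<psi> (- x + (2 * d k) *\<^sub>R z) * heat ((d k)\<^sup>2) (x + (- x + (2 * d k) *\<^sub>R z)))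
        = (2 * sqrt pi) ^ CARD('n) *\<^sub>R (\<psi> (- x + (2 * d k) *\<^sub>R z) * exp (- 1 * (norm z)\<^sup>2))"
        using arg_cong[OF *, of "\<lambda>t. \<psi> (- x + (2 * d k) *\<^sub>R z) * complex_of_real t"] d[of k]
        by (simp add: scaleR_conv_of_real abs_mult ac_simps)
    qed
    finally show ?thesis .
  qed
  have "(\<lambda>k. LINT z|lborel. (2 * sqrt pi) ^ CARD('n) *\<^sub>R (\<psi> (- x + (2 * d k) *\<^sub>R z) * exp (- 1 * (norm z)\<^sup>2)))
    \<longlonglongrightarrow> (LINT z|lborel. (2 * sqrt pi) ^ CARD('n) *\<^sub>R (\<psi> (- x) * exp (- 1 * (norm (z::real^'n))\<^sup>2)))"
  proof (rule integral_dominated_convergence[where w="\<lambda>z. (2 * sqrt pi) ^ CARD('n) * (M * exp (- 1 * (norm z)\<^sup>2))"])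
    show "integrable lborel (\<lambda>z::real^'n. (2 * sqrt pi) ^ CARD('n) * (M * exp (- 1 * (norm z)\<^sup>2)))"
      by (intro integrable_mult_right integral_gaussian) simp
    show "AE z in lborel. norm ((2 * sqrt pi) ^ CARD('n) *\<^sub>R (\<psi> (- x + (2 * d k) *\<^sub>R z) * exp (- 1 * (norm z)\<^sup>2))) \<le>
       (2 * sqrt pi) ^ CARD('n) * (M * exp (- 1 * (norm z)\<^sup>2))" for k
      using bd by (intro AE_I2) (auto simp: norm_mult intro!: mult_left_mono mult_right_mono)
    show "AE z in lborel. (\<lambda>k. (2 * sqrt pi) ^ CARD('n) *\<^sub>R (\<psi> (- x + (2 * d k) *\<^sub>R z) * exp (- 1 * (norm z)\<^sup>2)))
      \<longlonglongrightarrow> (2 * sqrt pi) ^ CARD('n) *\<^sub>R (\<psi> (- x) * exp (- 1 * (norm z)\<^sup>2))"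
    proof (intro AE_I2 tendsto_intros)
      fix z
      have "d \<longlonglongrightarrow> 0" unfolding d_def by (rule lim_1_over_n[THEN LIMSEQ_Suc])
      then have "(\<lambda>k. - x + (2 * d k) *\<^sub>R z) \<longlonglongrightarrow> - x + (2 * 0) *\<^sub>R z" by (intro tendsto_intros)
      moreover have "isCont \<psi> (- x)" using cont by (simp add: continuous_on_eq_continuous_at)
      ultimately show "(\<lambda>k. \<psi> (- x + (2 * d k) *\<^sub>R z)) \<longlonglongrightarrow> \<psi> (- x)" by (auto intro: isCont_tendsto_compose)
    qed
  qed measurable
  also have "(LINT z|lborel. (2 * sqrt pi) ^ CARD('n) *\<^sub>R (\<psi> (- x) * exp (- 1 * (norm (z::real^'n))\<^sup>2)))
     = complex_of_real ((2 * sqrt pi) ^ CARD('n) * sqrt (pi / 1) ^ CARD('n)) * \<psi> (- x)"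
  proof -
    have "(LINT z|lborel. complex_of_real (exp (- 1 * (norm (z::real^'n))\<^sup>2))) = complex_of_real (sqrt (pi / 1) ^ CARD('n))"
      unfolding integral_complex_of_real using integral_gaussian(2)[of 1, where 'a="real^'n"] by simp
    then show ?thesis by (simp add: scaleR_conv_of_real)
  qed
  also have "(2 * sqrt pi) ^ CARD('n) * sqrt (pi / 1) ^ CARD('n) = ((2 * sqrt pi) * sqrt (pi / 1)) ^ CARD('n)"
    by (rule power_mult_distrib[symmetric])
  also have "(2 * sqrt pi) * sqrt (pi / 1) = 2 * pi" by simp
  finally show "(\<lambda>k. LINT y|lborel. \<psi> y * heat ((1 / real (Suc k))\<^sup>2) (x + y)) \<longlonglongrightarrow> (2 * pi) ^ CARD('n) * \<psi> (- x)"
    unfolding eq[unfolded d_def, symmetric] d_def by simp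
  assume e: "0 < \<epsilon>"
  have M: "0 \<le> M" using bd norm_ge_zero order_trans by blast
  have "integrable lborel (\<lambda>y. heat \<epsilon> (x + 1 *\<^sub>R y))"
    using integrable_lborel_affine[OF integral_heat(1)[OF e], of 1 x] by simp
  then have i: "integrable lborel (\<lambda>y. M * heat \<epsilon> (x + y))" by simp
  have "cmod (LINT y|lborel. \<psi> y * heat \<epsilon> (x + y)) \<le> (LINT y|lborel. M * heat \<epsilon> (x + y))"
  proof (rule Bochner_Integration.integral_norm_bound_integral[OF _ i])
    show le: "norm (\<psi> y * complex_of_real (heat \<epsilon> (x + y))) \<le> M * heat \<epsilon> (x + y)" for y
      using mult_right_mono[OF bd heat_nonneg[OF e], of y "x + y"] by (simp add: norm_mult abs_of_nonneg[OF heat_nonneg[OF e]])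
    show "integrable lborel (\<lambda>y. \<psi> y * complex_of_real (heat \<epsilon> (x + y)))"
      using le by (intro Bochner_Integration.integrable_bound[OF i]) (auto intro!: AE_I2 order_trans[OF _ abs_ge_self])
  qed
  also have "\<dots> = M * (2 * pi) ^ CARD('n)"
    using integral_lborel_translate[of "heat \<epsilon>" x] integral_heat(2)[OF e, where 'n='n] by simp
  finally show "cmod (LINT y|lborel. \<psi> y * heat \<epsilon> (x + y)) \<le> M * (2 * pi) ^ CARD('n)" .
qed

text \<open>The Gaussian regulariser is removed from both sides by dominated convergence: in
  frequency the product is integrable since both transforms are square integrable, and in space the
  approximate identity applies. In the use below f is a truncation and \<psi> a test
  function.\<close>

lemma integral_fou_fou:
  fixes f \<psi> :: "real ^ 'n \<Rightarrow> complex"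
  assumes f: "integrable lborel f" "square_integrable f"
    and psi: "integrable lborel \<psi>" "continuous_on UNIV \<psi>" "\<And>x. cmod (\<psi> x) \<le> M"
  shows "(LINT \<xi>|lborel. fou f \<xi> * fou \<psi> \<xi>) = (2 * pi) ^ CARD('n) * (LINT x|lborel. f x * \<psi> (- x))"
proof -
  have [measurable]: "f \<in> borel_measurable borel" "\<psi> \<in> borel_measurable borel" using f psi by measurable
  have psi2: "square_integrable \<psi>" by (rule integrable_square_integrable_bounded[OF psi(1,3)])
  define e where "e k = (1 / real (Suc k))\<^sup>2" for k
  have e: "0 < e k" for k by (simp add: e_def)
  have i: "integrable lborel (\<lambda>\<xi>. fou f \<xi> * fou \<psi> \<xi>)"
    by (intro square_integrable_mult_integrable fou_square_integrable f psi psi2)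
  have "(\<lambda>k. LINT \<xi>|lborel. fou f \<xi> * (fou \<psi> \<xi> * exp (- e k * (norm \<xi>)\<^sup>2))) \<longlonglongrightarrow> (LINT \<xi>|lborel. fou f \<xi> * fou \<psi> \<xi>)"
  proof (rule integral_dominated_convergence[OF _ _ integrable_norm[OF i]])
    show "AE \<xi> in lborel. (\<lambda>k. fou f \<xi> * (fou \<psi> \<xi> * exp (- e k * (norm \<xi>)\<^sup>2))) \<longlonglongrightarrow> fou f \<xi> * fou \<psi> \<xi>"
    proof (intro AE_I2)
      fix \<xi> :: "real ^ 'n"
      have "(\<lambda>k. fou f \<xi> * (fou \<psi> \<xi> * exp (- e k * (norm \<xi>)\<^sup>2))) \<longlonglongrightarrow> fou f \<xi> * (fou \<psi> \<xi> * exp (- (0^2) * (norm \<xi>)\<^sup>2))"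
        unfolding e_def by (intro tendsto_intros lim_1_over_n[THEN LIMSEQ_Suc])
      then show "(\<lambda>k. fou f \<xi> * (fou \<psi> \<xi> * exp (- e k * (norm \<xi>)\<^sup>2))) \<longlonglongrightarrow> fou f \<xi> * fou \<psi> \<xi>" by simp
    qed
    show "AE \<xi> in lborel. norm (fou f \<xi> * (fou \<psi> \<xi> * exp (- e k * (norm \<xi>)\<^sup>2))) \<le> norm (fou f \<xi> * fou \<psi> \<xi>)" for k
      using e[of k] by (intro AE_I2) (auto simp: norm_mult intro!: mult_left_mono mult_left_le)
  qed measurable
  moreover have "(\<lambda>k. LINT x|lborel. f x * (LINT y|lborel. \<psi> y * heat (e k) (x + y))) \<longlonglongrightarrow> (LINT x|lborel. f x * ((2 * pi) ^ CARD('n) * \<psi> (- x)))"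
  proof (rule integral_dominated_convergence[where w="\<lambda>x. cmod (f x) * (M * (2 * pi) ^ CARD('n))"])
    show "integrable lborel (\<lambda>x. cmod (f x) * (M * (2 * pi) ^ CARD('n)))" using f by simp
    show "AE x in lborel. (\<lambda>k. f x * (LINT y|lborel. \<psi> y * heat (e k) (x + y))) \<longlonglongrightarrow> f x * ((2 * pi) ^ CARD('n) * \<psi> (- x))"
      unfolding e_def by (intro AE_I2 tendsto_mult tendsto_const heat_approximation(1)[OF psi(2,3)])
    show "AE x in lborel. norm (f x * (LINT y|lborel. \<psi> y * heat (e k) (x + y))) \<le> cmod (f x) * (M * (2 * pi) ^ CARD('n))" for k
      unfolding norm_mult by (intro AE_I2 mult_left_mono heat_approximation(2)[OF psi(2,3) e]) auto
  qed measurable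
  ultimately have "(LINT \<xi>|lborel. fou f \<xi> * fou \<psi> \<xi>) = (LINT x|lborel. f x * ((2 * pi) ^ CARD('n) * \<psi> (- x)))"
    unfolding integral_fou_fou_gaussian[OF f(1) psi(1) e] by (rule LIMSEQ_unique)
  also have "\<dots> = (LINT x|lborel. complex_of_real ((2 * pi) ^ CARD('n)) * (f x * \<psi> (- x)))"
    by (simp add: mult.left_commute)
  finally show ?thesis by (simp only: integral_mult_right_zero)
qed

section \<open>The Fourier transform on square integrable functions\<close>

definition trunc :: "real \<Rightarrow> (real ^ 'n \<Rightarrow> complex) \<Rightarrow> real ^ 'n \<Rightarrow> complex" where
  "trunc R u x = indicator (cball 0 R) x * u x"

lemma has_fourier_iff:
  "has_fourier u U \<longleftrightarrow> square_integrable U \<and> L2_tendsto (\<lambda>R. fou (trunc R u)) U at_top"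
proof -
  have "(LINT x:cball 0 R|lborel. u x * cis (- (\<xi> \<bullet> x))) = fou (trunc R u) \<xi>" for R \<xi>
    unfolding fou_def set_lebesgue_integral_def
    by (intro Bochner_Integration.integral_cong) (auto simp: trunc_def indicator_def)
  then show ?thesis by (simp add: has_fourier_def)
qed

lemma has_fourier_square_integrable: "has_fourier u U \<Longrightarrow> square_integrable U"
  by (simp add: has_fourier_iff)

lemma trunc_measurable [measurable]:
  "u \<in> borel_measurable borel \<Longrightarrow> trunc R u \<in> borel_measurable borel"
  unfolding trunc_def[abs_def] by (intro borel_measurable_times borel_measurable_indicator) auto

lemma trunc_square_integrable: "square_integrable u \<Longrightarrow> square_integrable (trunc R u)"
  by (rule square_integrable_bound[of u]) (auto simp: trunc_def indicator_def)

lemma trunc_integrable: "square_integrable u \<Longrightarrow> integrable lborel (trunc R u)"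
  unfolding trunc_def[abs_def]
  by (rule square_integrable_mult_integrable[OF square_integrable_indicator])
    (use emeasure_lborel_cball_finite[of 0 R] in auto)

lemma L2_tendsto_trunc:
  fixes u :: "real ^ 'n \<Rightarrow> complex"
  assumes u: "square_integrable u"
  shows "L2_tendsto (\<lambda>R. trunc R u) u at_top"
proof -
  have [measurable]: "u \<in> borel_measurable borel" using u by measurable
  have "(\<lambda>k. \<integral>\<^sup>+x. ennreal ((cmod (trunc (real k) u x - u x))\<^sup>2) \<partial>lborel) \<longlonglongrightarrow> (\<integral>\<^sup>+x. 0 \<partial>(lborel :: (real ^ 'n) measure))"
  proof (rule nn_integral_dominated_convergence[where w="\<lambda>x. ennreal ((cmod (u x))\<^sup>2)"])
    show "(\<integral>\<^sup>+ x. ennreal ((cmod (u x))\<^sup>2) \<partial>lborel) < \<infinity>"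
      using u by (simp add: square_integrable_iff nnL2_def)
    show "AE x in lborel. ennreal ((cmod (trunc (real k) u x - u x))\<^sup>2) \<le> ennreal ((cmod (u x))\<^sup>2)" for k
      by (intro AE_I2) (auto simp: trunc_def indicator_def)
    show "AE x in lborel. (\<lambda>k. ennreal ((cmod (trunc (real k) u x - u x))\<^sup>2)) \<longlonglongrightarrow> 0"
    proof (intro AE_I2 tendsto_eventually)
      fix x :: "real ^ 'n"
      show "\<forall>\<^sub>F k in sequentially. ennreal ((cmod (trunc (real k) u x - u x))\<^sup>2) = 0"
        using eventually_ge_at_top[of "nat \<lceil>norm x\<rceil>"]
        by eventually_elim (auto simp: trunc_def indicator_def)
    qed
  qed measurable
  then have lim: "(\<lambda>k. nnL2 (\<lambda>x. trunc (real k) u x - u x)) \<longlonglongrightarrow> 0" by (simp add: nnL2_def)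
  \<comment> \<open>The error decreases as R grows, so the limit along the integers controls all
    real R.\<close>
  show ?thesis unfolding L2_tendsto_nnL2
  proof (rule order_tendstoI)
    fix e :: ennreal assume "0 < e"
    then obtain k :: nat where k: "nnL2 (\<lambda>x. trunc (real k) u x - u x) < e"
      using order_tendstoD(2)[OF lim] by (auto simp: eventually_sequentially)
    show "\<forall>\<^sub>F R in at_top. nnL2 (\<lambda>x. trunc R u x - u x) < e"
      using eventually_ge_at_top[of "real k"]
    proof eventually_elim
      case (elim R)
      have "nnL2 (\<lambda>x. trunc R u x - u x) \<le> nnL2 (\<lambda>x. trunc (real k) u x - u x)"
        using elim by (intro nnL2_mono AE_I2) (auto simp: trunc_def indicator_def)
      with k show ?case by simp
    qed
  qed simp
qed

lemma nnL2_fou_diff_le: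
  fixes f g :: "real ^ 'n \<Rightarrow> complex"
  assumes "integrable lborel f" "square_integrable f" "integrable lborel g" "square_integrable g"
  shows "nnL2 (\<lambda>\<xi>. fou f \<xi> - fou g \<xi>) \<le> ennreal ((2 * pi) ^ CARD('n)) * nnL2 (\<lambda>x. f x - g x)"
proof -
  have "fou (\<lambda>x. f x - g x) = (\<lambda>\<xi>. fou f \<xi> - fou g \<xi>)"
    using fou_diff[OF assms(1,3)] by blast
  then show ?thesis
    using nnL2_fou_le[OF Bochner_Integration.integrable_diff[OF assms(1,3)] square_integrable_diff[OF assms(2,4)]] by simp
qed

text \<open>The definition demands convergence along all real radii. Hence a sequence of radii is
  built for \<open>L2_complete\<close>, and the tail estimate is proved for every S beyond the k-th
  radius, not only for later members of the sequence.\<close>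

lemma has_fourier_exists:
  fixes u :: "real ^ 'n \<Rightarrow> complex"
  assumes u: "square_integrable u"
  shows "\<exists>U. has_fourier u U"
proof -
  have [measurable]: "u \<in> borel_measurable borel" using u by measurable
  define C where "C = ennreal ((2 * pi) ^ CARD('n))"
  have C: "C < top" by (simp add: C_def)
  note ti = trunc_integrable[OF u] trunc_square_integrable[OF u]
  \<comment> \<open>For R \<le> S the two truncations differ by the restriction of u to a shell,
    which is dominated by the part of u outside the smaller ball.\<close>
  have mono: "nnL2 (\<lambda>x. trunc S u x - trunc R u x) \<le> nnL2 (\<lambda>x. trunc R u x - u x)" if "R \<le> S" for R S
    using that by (intro nnL2_mono AE_I2) (auto simp: trunc_def indicator_def)
  have mono2: "nnL2 (\<lambda>x. trunc S u x - u x) \<le> nnL2 (\<lambda>x. trunc R u x - u x)" if "R \<le> S" for R S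
    using that by (intro nnL2_mono AE_I2) (auto simp: trunc_def indicator_def)
  have "\<exists>R. nnL2 (\<lambda>x. trunc R u x - u x) < ennreal ((1/4)^k)" for k
    using order_tendstoD(2)[OF L2_tendsto_trunc[OF u, unfolded L2_tendsto_nnL2], of "ennreal ((1/4)^k)"]
    by (auto simp: eventually_at_top_linorder)
  then obtain r where r: "nnL2 (\<lambda>x. trunc (r k) u x - u x) < ennreal ((1/4)^k)" for k :: nat
    by metis
  \<comment> \<open>Summing absolute values makes the radii increasing while keeping each at least
    \<open>r k\<close>, so the error bound attached to \<open>r k\<close> persists.\<close>
  define \<rho> where "\<rho> k = (\<Sum>j\<le>k. \<bar>r j\<bar>)" for k :: nat
  have \<rho>_mono: "\<rho> k \<le> \<rho> m" if "k \<le> m" for k m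
    unfolding \<rho>_def using that by (intro sum_mono2) auto
  have "r k \<le> \<rho> k" for k
    unfolding \<rho>_def using member_le_sum[of k "{..k}" "\<lambda>j. \<bar>r j\<bar>"] by (auto intro: order_trans[OF abs_ge_self])
  then have \<rho>: "nnL2 (\<lambda>x. trunc (\<rho> k) u x - u x) \<le> ennreal ((1/4)^k)" for k
    using mono2[of "r k" "\<rho> k"] r[of k] by (simp add: order_less_imp_le order_le_less_trans)
  have tail: "nnL2 (\<lambda>\<xi>. fou (trunc S u) \<xi> - fou (trunc (\<rho> k) u) \<xi>) \<le> C * ennreal ((1/4)^k)" if "\<rho> k \<le> S" for k S
    using order_trans[OF nnL2_fou_diff_le[OF ti(1,2) ti(1,2)] mult_left_mono[OF order_trans[OF mono[OF that] \<rho>]]]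
    by (simp add: C_def)
  have "\<exists>g. square_integrable g \<and> (\<forall>k. nnL2 (\<lambda>x. fou (trunc (\<rho> k) u) x - g x) \<le> C * ennreal ((1/4)^k))"
    by (rule L2_complete) (auto intro!: fou_square_integrable ti tail \<rho>_mono C)
  then obtain U where U: "square_integrable U"
    and lim: "\<And>k. nnL2 (\<lambda>x. fou (trunc (\<rho> k) u) x - U x) \<le> C * ennreal ((1/4)^k)" by auto
  have [measurable]: "U \<in> borel_measurable borel" using U by measurable
  have bnd: "nnL2 (\<lambda>x. fou (trunc S u) x - U x) \<le> 4 * C * ennreal ((1/4)^k)" if "\<rho> k \<le> S" for k S
  proof -
    have "nnL2 (\<lambda>x. fou (trunc S u) x - U x) \<le> 2 * nnL2 (\<lambda>\<xi>. fou (trunc S u) \<xi> - fou (trunc (\<rho> k) u) \<xi>)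
       + 2 * nnL2 (\<lambda>x. fou (trunc (\<rho> k) u) x - U x)"
      by (rule nnL2_diff_triangle) measurable
    also have "\<dots> \<le> 2 * (C * ennreal ((1/4)^k)) + 2 * (C * ennreal ((1/4)^k))"
      by (intro add_mono mult_left_mono tail[OF that] lim) auto
    also have "\<dots> = 4 * C * ennreal ((1/4)^k)"
      unfolding distrib_right[symmetric] mult.assoc by simp
    finally show ?thesis .
  qed
  have "(\<lambda>k. 4 * C * ennreal ((1/4)^k)) \<longlonglongrightarrow> 4 * C * ennreal 0"
    using C by (intro ennreal_tendsto_cmult tendsto_ennrealI LIMSEQ_power_zero) (auto simp: ennreal_mult_less_top)
  then have lim4: "(\<lambda>k. 4 * C * ennreal ((1/4)^k)) \<longlonglongrightarrow> 0" by simp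
  have "L2_tendsto (\<lambda>R. fou (trunc R u)) U at_top" unfolding L2_tendsto_nnL2
  proof (rule order_tendstoI)
    fix e :: ennreal assume "0 < e"
    then obtain k :: nat where k: "4 * C * ennreal ((1/4)^k) < e"
      using order_tendstoD(2)[OF lim4] by (auto simp: eventually_sequentially)
    show "\<forall>\<^sub>F R in at_top. nnL2 (\<lambda>x. fou (trunc R u) x - U x) < e"
      using eventually_ge_at_top[of "\<rho> k"]
    proof eventually_elim
      case (elim R)
      show ?case by (rule le_less_trans[OF bnd[OF elim] k])
    qed
  qed simp
  with U show ?thesis by (auto simp: has_fourier_iff)
qed

lemma has_fourier_fou:
  fixes f :: "real ^ 'n \<Rightarrow> complex"
  assumes f: "integrable lborel f" "square_integrable f"
  shows "has_fourier f (fou f)"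
proof -
  have "((\<lambda>R. ennreal ((2 * pi) ^ CARD('n)) * nnL2 (\<lambda>x. trunc R f x - f x)) \<longlongrightarrow> 0) at_top"
    using L2_tendsto_trunc[OF f(2)] by (intro ennreal_tendsto_cmult_0) (auto simp: L2_tendsto_nnL2)
  then have "((\<lambda>R. nnL2 (\<lambda>\<xi>. fou (trunc R f) \<xi> - fou f \<xi>)) \<longlongrightarrow> 0) at_top"
    by (rule ennreal_tendsto_0_le[rotated])
      (intro nnL2_fou_diff_le trunc_integrable trunc_square_integrable f)
  then show ?thesis using fou_square_integrable[OF f] by (simp add: has_fourier_iff L2_tendsto_nnL2)
qed

lemma has_fourier_cong_AE:
  assumes "has_fourier u U" "V \<in> borel_measurable borel" "AE \<xi> in lborel. U \<xi> = V \<xi>"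
  shows "has_fourier u V"
proof -
  have "nnL2 (\<lambda>x. f x - U x) = nnL2 (\<lambda>x. f x - V x)" for f
    using assms(3) by (intro nnL2_cong) (auto elim: eventually_mono)
  note nn = this
  have "square_integrable V"
    by (rule square_integrable_cong_AE[OF has_fourier_square_integrable[OF assms(1)] assms(2,3)])
  moreover have "L2_tendsto (\<lambda>R. fou (trunc R u)) V at_top"
    using assms(1) unfolding has_fourier_iff L2_tendsto_nnL2 nn by blast
  ultimately show ?thesis unfolding has_fourier_iff by blast
qed

text \<open>The multiplication formula extended to L^2: both factors are truncated and one
  truncation is released at a time, so that continuity of the pairing in a single argument is
  enough.\<close>

lemma has_fourier_integral_mult:
  assumes u: "square_integrable u" "has_fourier u U" and v: "square_integrable v" "has_fourier v V"
  shows "(LINT x|lborel. U x * v x) = (LINT x|lborel. u x * V x)"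
proof -
  note tu = trunc_integrable[OF u(1)] trunc_square_integrable[OF u(1)]
  note tv = trunc_integrable[OF v(1)] trunc_square_integrable[OF v(1)]
  have U: "square_integrable U" "L2_tendsto (\<lambda>R. fou (trunc R u)) U at_top"
    and V: "square_integrable V" "L2_tendsto (\<lambda>R. fou (trunc R v)) V at_top"
    using u v by (auto simp: has_fourier_iff)
  have 1: "(LINT x|lborel. U x * trunc S v x) = (LINT x|lborel. u x * fou (trunc S v) x)" for S
  proof (rule tendsto_unique)
    show "((\<lambda>R. LINT x|lborel. fou (trunc R u) x * trunc S v x) \<longlongrightarrow> (LINT x|lborel. U x * trunc S v x)) at_top"
      by (intro L2_tendsto_integral_mult U fou_square_integrable tu tv)
    have "((\<lambda>R. LINT x|lborel. trunc R u x * fou (trunc S v) x) \<longlongrightarrow> (LINT x|lborel. u x * fou (trunc S v) x)) at_top"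
      by (intro L2_tendsto_integral_mult u fou_square_integrable tu tv L2_tendsto_trunc)
    then show "((\<lambda>R. LINT x|lborel. fou (trunc R u) x * trunc S v x) \<longlongrightarrow> (LINT x|lborel. u x * fou (trunc S v) x)) at_top"
      by (simp add: integral_fou_mult[OF tu(1) tv(1)])
  qed simp
  have "((\<lambda>R. LINT x|lborel. trunc R v x * U x) \<longlongrightarrow> (LINT x|lborel. v x * U x)) at_top"
    by (intro L2_tendsto_integral_mult U tv v L2_tendsto_trunc)
  then have 2: "((\<lambda>R. LINT x|lborel. fou (trunc R v) x * u x) \<longlongrightarrow> (LINT x|lborel. v x * U x)) at_top"
    using 1 by (simp add: mult.commute)
  moreover have "((\<lambda>R. LINT x|lborel. fou (trunc R v) x * u x) \<longlongrightarrow> (LINT x|lborel. V x * u x)) at_top"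
    by (intro L2_tendsto_integral_mult u V tv fou_square_integrable)
  ultimately have "(LINT x|lborel. v x * U x) = (LINT x|lborel. V x * u x)"
    by (rule tendsto_unique[rotated]) simp
  then show ?thesis by (simp add: mult.commute)
qed

section \<open>Weak characterisation of the transform by test functions\<close>

lemma test_function_bounded:
  assumes "continuous_on UNIV f" "compact (closure {x. f x \<noteq> (0::complex)})"
  shows "\<exists>M. \<forall>x. cmod (f x) \<le> M"
proof -
  have "compact (f ` closure {x. f x \<noteq> 0})"
    using assms by (intro compact_continuous_image) (auto intro: continuous_on_subset)
  then have "bounded (f ` closure {x. f x \<noteq> 0})" by (rule compact_imp_bounded)
  then obtain M where M: "\<And>x. x \<in> closure {x. f x \<noteq> 0} \<Longrightarrow> cmod (f x) \<le> M"
    by (auto simp: bounded_iff)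
  have "cmod (f x) \<le> max M 0" for x
    using M[of x] closure_subset[of "{x. f x \<noteq> 0}"] by (cases "f x = 0") (auto simp: le_max_iff_disj)
  then show ?thesis by blast
qed

lemma compact_support_integrable:
  fixes f :: "real ^ 'n \<Rightarrow> complex"
  assumes "continuous_on UNIV f" "compact (closure {x. f x \<noteq> 0})"
  shows "integrable lborel f"
proof -
  have "set_integrable lborel (closure {x. f x \<noteq> 0}) f"
    unfolding set_integrable_def by (rule borel_integrable_compact) (use assms in \<open>auto intro: continuous_on_subset\<close>)
  moreover have "indicat_real (closure {x. f x \<noteq> 0}) x *\<^sub>R f x = f x" for x
    using closure_subset[of "{x. f x \<noteq> 0}"] by (cases "f x = 0") (auto simp: indicator_def)
  ultimately show ?thesis by (simp add: set_integrable_def)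
qed

lemma test_functionD:
  assumes "test_function \<phi>"
  shows "C1_function \<phi>" "continuous_on UNIV \<phi>" "compact (closure {x. \<phi> x \<noteq> 0})"
    "integrable lborel \<phi>" "square_integrable \<phi>" "\<exists>M. \<forall>x. cmod (\<phi> x) \<le> M"
proof -
  show C1: "C1_function \<phi>" and c: "compact (closure {x. \<phi> x \<noteq> 0})"
    using assms by (auto simp: test_function_def C1_function_def)
  from C1 show cont: "continuous_on UNIV \<phi>" by (rule C1_function_continuous)
  show i: "integrable lborel \<phi>" by (rule compact_support_integrable[OF cont c])
  show M: "\<exists>M. \<forall>x. cmod (\<phi> x) \<le> M" by (rule test_function_bounded[OF cont c])
  then show "square_integrable \<phi>" using integrable_square_integrable_bounded[OF i] by blast
qed

lemma test_function_uminus: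
  assumes "test_function \<phi>"
  shows "test_function (\<lambda>x. \<phi> (- x))"
proof -
  have "((\<lambda>x. \<phi> (- x)) has_derivative (\<lambda>v. frechet_derivative \<phi> (at (- x)) (- v))) (at x)" for x :: "real ^ 'a"
  proof -
    have "(uminus has_derivative uminus) (at x)"
      using has_derivative_minus[OF has_derivative_ident] by simp
    from has_derivative_compose[OF this C1_function_has_derivative[OF test_functionD(1)[OF assms]]]
    show ?thesis .
  qed
  moreover have "continuous_on UNIV (\<lambda>x. frechet_derivative \<phi> (at (- x)) (- v))" for v
    using test_functionD(1)[OF assms]
    by (intro continuous_on_compose2[of UNIV "\<lambda>x. frechet_derivative \<phi> (at x) (- v)" UNIV uminus] continuous_intros)
       (auto simp: C1_function_def)
  ultimately have "C1_function (\<lambda>x. \<phi> (- x))" by (rule C1_functionI)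
  moreover have "{x. \<phi> (- x) \<noteq> 0} = uminus ` {x. \<phi> x \<noteq> 0}"
    by (auto simp: image_iff) (metis minus_minus)
  then have "compact (closure {x. \<phi> (- x) \<noteq> 0})"
    using test_functionD(3)[OF assms] by (simp add: bounded_uminus)
  ultimately show ?thesis by (simp add: test_function_def C1_function_def)
qed

text \<open>The working criterion for the transforms below. Some transform V exists and satisfies
  the same identity by the multiplication formula, so V and U agree almost everywhere by the
  fundamental lemma.\<close>

lemma has_fourierI_weak:
  assumes u: "square_integrable u" and U: "square_integrable U"
    and eq: "\<And>\<phi>. test_function \<phi> \<Longrightarrow> (LINT x|lborel. U x * \<phi> x) = (LINT x|lborel. u x * fou \<phi> x)"
  shows "has_fourier u U"
proof -
  obtain V where V: "has_fourier u V" using has_fourier_exists[OF u] by blast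
  have V2: "square_integrable V" by (rule has_fourier_square_integrable[OF V])
  have "AE x in lborel. V x - U x = 0"
  proof (rule AE_zero_of_test_functions)
    show "square_integrable (\<lambda>x. V x - U x)" by (intro square_integrable_diff U V2)
    fix \<phi> :: "real ^ 'a \<Rightarrow> complex" assume "test_function \<phi>"
    note t = test_functionD(4,5)[OF this]
    have "(LINT x|lborel. V x * \<phi> x) = (LINT x|lborel. U x * \<phi> x)"
      using has_fourier_integral_mult[OF u V t(2) has_fourier_fou[OF t]] eq[OF \<open>test_function \<phi>\<close>] by simp
    then show "(LINT x|lborel. (V x - U x) * \<phi> x) = 0"
      using square_integrable_mult_integrable[OF U t(2)] square_integrable_mult_integrable[OF V2 t(2)]
      by (simp add: left_diff_distrib)
  qed
  then show ?thesis
    using U by (intro has_fourier_cong_AE[OF V]) (auto simp: square_integrable_measurable)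
qed

lemma has_fourier_test_function:
  assumes "square_integrable u" "has_fourier u U" "test_function \<phi>"
  shows "(LINT x|lborel. U x * \<phi> x) = (LINT x|lborel. u x * fou \<phi> x)"
  using assms test_functionD(4,5)[OF assms(3)] by (intro has_fourier_integral_mult has_fourier_fou)

lemma integral_lborel_mult_uminus:
  fixes f g :: "real ^ 'n \<Rightarrow> complex"
  assumes [measurable]: "f \<in> borel_measurable borel" "g \<in> borel_measurable borel"
  shows "(LINT x|lborel. f (- x) * g x) = (LINT x|lborel. f x * g (- x))"
  using integral_lborel_uminus[of "\<lambda>x. f x * g (- x)"] by simp

lemma square_integrable_uminus_arg:
  fixes u :: "real ^ 'n \<Rightarrow> complex"
  assumes u: "square_integrable u"
  shows "square_integrable (\<lambda>x. u (- x))"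
proof -
  have [measurable]: "u \<in> borel_measurable borel" using u by measurable
  show ?thesis
    using u integrable_lborel_affine[OF square_integrableD[OF u], of "-1" 0]
    by (simp add: square_integrable_def)
qed

text \<open>Tested against \<phi>, inversion is \<open>integral_fou_fou\<close> for the truncations
  of u, passed to the L^2 limit on both sides.\<close>

lemma has_fourier_inversion:
  fixes u :: "real ^ 'n \<Rightarrow> complex"
  assumes u: "square_integrable u" "has_fourier u U"
  shows "has_fourier U (\<lambda>x. (2 * pi) ^ CARD('n) * u (- x))"
proof (rule has_fourierI_weak)
  have U: "square_integrable U" "L2_tendsto (\<lambda>R. fou (trunc R u)) U at_top"
    using u by (auto simp: has_fourier_iff)
  have [measurable]: "u \<in> borel_measurable borel" using u by measurable
  show "square_integrable U" by fact
  show "square_integrable (\<lambda>x. (2 * pi) ^ CARD('n) * u (- x))"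
    by (intro square_integrable_cmult square_integrable_uminus_arg u)
  fix \<phi> :: "real ^ 'n \<Rightarrow> complex" assume "test_function \<phi>"
  note t = test_functionD[OF this]
  obtain M where M: "\<And>x. cmod (\<phi> x) \<le> M" using t(6) by blast
  have [measurable]: "\<phi> \<in> borel_measurable borel" using t(5) by measurable
  have "((\<lambda>R. LINT x|lborel. fou (trunc R u) x * fou \<phi> x) \<longlongrightarrow> (LINT x|lborel. U x * fou \<phi> x)) at_top"
    by (intro L2_tendsto_integral_mult U fou_square_integrable t trunc_integrable trunc_square_integrable u)
  moreover have "((\<lambda>R. (2 * pi) ^ CARD('n) * (LINT x|lborel. trunc R u x * \<phi> (- x))) \<longlongrightarrow> (2 * pi) ^ CARD('n) * (LINT x|lborel. u x * \<phi> (- x))) at_top"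
    by (intro tendsto_mult tendsto_const L2_tendsto_integral_mult trunc_square_integrable u L2_tendsto_trunc square_integrable_uminus_arg t)
  ultimately have "(LINT x|lborel. U x * fou \<phi> x) = (2 * pi) ^ CARD('n) * (LINT x|lborel. u x * \<phi> (- x))"
    using integral_fou_fou[OF trunc_integrable[OF u(1)] trunc_square_integrable[OF u(1)] t(4,2) M]
    by (simp add: tendsto_unique[OF trivial_limit_at_top_linorder])
  also have "\<dots> = (LINT x|lborel. (2 * pi) ^ CARD('n) * u (- x) * \<phi> x)"
    using integral_lborel_mult_uminus[of u \<phi>] by (simp add: mult.assoc)
  finally show "(LINT x|lborel. (2 * pi) ^ CARD('n) * u (- x) * \<phi> x) = (LINT x|lborel. U x * fou \<phi> x)" ..
qed

text \<open>Surjectivity is what lets multipliers act: a function with a prescribed square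
  integrable transform exists. The preimage is the reflected transform of V divided by (2 pi)^n, as
  inversion suggests.\<close>

lemma has_fourier_surj:
  fixes V :: "real ^ 'n \<Rightarrow> complex"
  assumes V: "square_integrable V"
  shows "\<exists>v. square_integrable v \<and> has_fourier v V"
proof -
  obtain W where W: "has_fourier V W" using has_fourier_exists[OF V] by blast
  have W2: "square_integrable W" by (rule has_fourier_square_integrable[OF W])
  define c :: complex where "c = (2 * pi) ^ CARD('n)"
  have c: "c \<noteq> 0" by (simp add: c_def)
  note WW = has_fourier_inversion[OF V W, folded c_def]
  define v where "v x = 1 / c * W (- x)" for x
  have v: "square_integrable v"
    unfolding v_def by (intro square_integrable_cmult square_integrable_uminus_arg W2)
  have [measurable]: "V \<in> borel_measurable borel" "W \<in> borel_measurable borel" using V W2 by measurable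
  have "has_fourier v V"
  proof (rule has_fourierI_weak[OF v V])
    fix \<phi> :: "real ^ 'n \<Rightarrow> complex" assume t: "test_function \<phi>"
    have [measurable]: "\<phi> \<in> borel_measurable borel" using test_functionD(5)[OF t] by measurable
    have "(LINT x|lborel. v x * fou \<phi> x) = 1 / c * (LINT x|lborel. W (- x) * fou \<phi> x)"
      unfolding v_def by (simp add: mult.assoc)
    also have "(LINT x|lborel. W (- x) * fou \<phi> x) = (LINT x|lborel. W x * fou (\<lambda>x. \<phi> (- x)) x)"
      by (subst integral_lborel_mult_uminus) (auto simp: fou_uminus)
    also have "\<dots> = (LINT x|lborel. c * V (- x) * \<phi> (- x))"
      using has_fourier_test_function[OF W2 WW test_function_uminus[OF t]] by simp
    also have "\<dots> = c * (LINT x|lborel. V x * \<phi> x)"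
      using integral_lborel_uminus[of "\<lambda>x. V x * \<phi> x"] by (simp add: mult.assoc)
    finally show "(LINT x|lborel. V x * \<phi> x) = (LINT x|lborel. v x * fou \<phi> x)" using c by simp
  qed
  with v show ?thesis by blast
qed

section \<open>Linearity, two-sided L^2 bounds and Parseval's identity\<close>

lemma has_fourier_cmult:
  assumes u: "square_integrable u" "has_fourier u U"
  shows "has_fourier (\<lambda>x. c * u x) (\<lambda>x. c * U x)"
  using has_fourier_test_function[OF u]
  by (intro has_fourierI_weak square_integrable_cmult u has_fourier_square_integrable[OF u(2)])
    (simp add: mult.assoc)

lemma has_fourier_add:
  assumes u: "square_integrable u" "has_fourier u U" and v: "square_integrable v" "has_fourier v V"
  shows "has_fourier (\<lambda>x. u x + v x) (\<lambda>x. U x + V x)"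
proof (intro has_fourierI_weak square_integrable_add u v has_fourier_square_integrable[OF u(2)] has_fourier_square_integrable[OF v(2)])
  fix \<phi> :: "real ^ 'a \<Rightarrow> complex" assume t: "test_function \<phi>"
  note t' = test_functionD(4,5)[OF t]
  note i = square_integrable_mult_integrable[OF _ t'(2)] square_integrable_mult_integrable[OF _ fou_square_integrable[OF t']]
  show "(LINT x|lborel. (U x + V x) * \<phi> x) = (LINT x|lborel. (u x + v x) * fou \<phi> x)"
    using has_fourier_test_function[OF u t] has_fourier_test_function[OF v t]
      u v has_fourier_square_integrable[OF u(2)] has_fourier_square_integrable[OF v(2)]
    by (simp add: distrib_right i)
qed

lemma has_fourier_diff:
  assumes u: "square_integrable u" "has_fourier u U" and v: "square_integrable v" "has_fourier v V"
  shows "has_fourier (\<lambda>x. u x - v x) (\<lambda>x. U x - V x)"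
  using has_fourier_add[OF u square_integrable_cmult[OF v(1)] has_fourier_cmult[OF v], of "-1"] by simp

lemma has_fourier_sum:
  fixes u :: "'i \<Rightarrow> real ^ 'n \<Rightarrow> complex"
  assumes "\<And>i. i \<in> I \<Longrightarrow> square_integrable (u i)" "\<And>i. i \<in> I \<Longrightarrow> has_fourier (u i) (U i)"
  shows "has_fourier (\<lambda>x. \<Sum>i\<in>I. u i x) (\<lambda>x. \<Sum>i\<in>I. U i x)"
proof -
  obtain Z where "has_fourier (\<lambda>x::real^'n. 0) Z" using has_fourier_exists[OF square_integrable_zero] by blast
  from has_fourier_cmult[OF square_integrable_zero this, of 0]
  have z: "has_fourier (\<lambda>x::real^'n. 0) (\<lambda>x. 0)" by simp
  show ?thesis
    using assms by (induction I rule: infinite_finite_induct) (auto intro!: z has_fourier_add square_integrable_sum)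
qed

text \<open>The constant is crude because of \<open>nnL2_add\<close>; it serves only continuity and
  injectivity statements.\<close>

lemma nnL2_has_fourier_le:
  fixes u :: "real ^ 'n \<Rightarrow> complex"
  assumes u: "square_integrable u" "has_fourier u U"
  shows "nnL2 U \<le> 4 * ennreal ((2 * pi) ^ CARD('n)) * nnL2 u"
proof -
  define C where "C = ennreal ((2 * pi) ^ CARD('n))"
  have [measurable]: "u \<in> borel_measurable borel" "U \<in> borel_measurable borel"
    using u has_fourier_square_integrable[OF u(2)] by (auto simp: square_integrable_measurable)
  have le: "nnL2 U \<le> 2 * nnL2 (\<lambda>x. fou (trunc R u) x - U x) + 2 * (C * nnL2 u)" for R
  proof -
    have "nnL2 U \<le> 2 * nnL2 (\<lambda>x. U x - fou (trunc R u) x) + 2 * nnL2 (fou (trunc R u))"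
      using nnL2_add[of "\<lambda>x. U x - fou (trunc R u) x" "fou (trunc R u)"] by simp
    also have "nnL2 (fou (trunc R u)) \<le> C * nnL2 (trunc R u)"
      unfolding C_def by (intro nnL2_fou_le trunc_integrable trunc_square_integrable u)
    also have "nnL2 (trunc R u) \<le> nnL2 u"
      by (intro nnL2_mono) (auto simp: trunc_def indicator_def)
    finally show ?thesis by (simp add: nnL2_minus_commute mult_left_mono add_left_mono)
  qed
  have "((\<lambda>R. 2 * nnL2 (\<lambda>x. fou (trunc R u) x - U x) + 2 * (C * nnL2 u)) \<longlongrightarrow> 0 + 2 * (C * nnL2 u)) at_top"
    using u(2) by (intro tendsto_add tendsto_const ennreal_tendsto_cmult_0) (auto simp: has_fourier_iff L2_tendsto_nnL2)
  then have "nnL2 U \<le> 2 * (C * nnL2 u)"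
    using tendsto_lowerbound[OF _ always_eventually[of "\<lambda>R. nnL2 U \<le> 2 * nnL2 (\<lambda>x. fou (trunc R u) x - U x) + 2 * (C * nnL2 u)"]] le
    by auto
  also have "\<dots> \<le> 4 * C * nnL2 u"
    unfolding mult.assoc by (intro mult_right_mono) auto
  finally show ?thesis by (simp add: C_def)
qed

lemma nnL2_uminus_arg:
  fixes u :: "real ^ 'n \<Rightarrow> complex"
  assumes [measurable]: "u \<in> borel_measurable borel"
  shows "nnL2 (\<lambda>x. u (- x)) = nnL2 u"
  using nn_integral_lborel_affine[of "\<lambda>x. ennreal ((cmod (u x))\<^sup>2)" "-1" 0] by (simp add: nnL2_def)

text \<open>The forward bound applied to U, whose transform is (2 pi)^n times the reflection of u.
  The factor (2 pi)^n, being at least 1, only enlarges the left-hand side.\<close>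

lemma nnL2_le_has_fourier:
  fixes u :: "real ^ 'n \<Rightarrow> complex"
  assumes u: "square_integrable u" "has_fourier u U"
  shows "nnL2 u \<le> 4 * ennreal ((2 * pi) ^ CARD('n)) * nnL2 U"
proof -
  have [measurable]: "u \<in> borel_measurable borel" using u by measurable
  have "1 \<le> (2 * pi) ^ CARD('n)" using pi_ge_two by (intro one_le_power) auto
  then have "nnL2 u \<le> nnL2 (\<lambda>x. (2 * pi) ^ CARD('n) * u x)"
    using mult_right_mono[of 1 "(2 * pi) ^ CARD('n)" "cmod (u _)"]
    by (intro nnL2_mono AE_I2) (simp add: norm_mult norm_power)
  also have "\<dots> = nnL2 (\<lambda>x. (2 * pi) ^ CARD('n) * u (- x))"
    using nnL2_uminus_arg[of "\<lambda>x. (2 * pi) ^ CARD('n) * u x"] by simp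
  also have "\<dots> \<le> 4 * ennreal ((2 * pi) ^ CARD('n)) * nnL2 U"
    by (rule nnL2_has_fourier_le[OF has_fourier_square_integrable[OF u(2)] has_fourier_inversion[OF u]])
  finally show ?thesis .
qed

lemma has_fourier_inj:
  fixes u v :: "real ^ 'n \<Rightarrow> complex"
  assumes u: "square_integrable u" "has_fourier u U" and v: "square_integrable v" "has_fourier v U"
  shows "AE x in lborel. u x = v x"
proof -
  have [measurable]: "u \<in> borel_measurable borel" "v \<in> borel_measurable borel" using u v by measurable
  have "nnL2 (\<lambda>x. u x - v x) \<le> 4 * ennreal ((2 * pi) ^ CARD('n)) * nnL2 (\<lambda>x::real^'n. 0)"
    using nnL2_le_has_fourier[OF square_integrable_diff[OF u(1) v(1)] has_fourier_diff[OF u v]] by simp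
  then have "nnL2 (\<lambda>x. u x - v x) = 0" by (simp add: nnL2_def)
  from nnL2_eq_0[OF _ this] show ?thesis by simp
qed

lemma has_fourier_uminus_arg:
  assumes u: "square_integrable u" "has_fourier u U"
  shows "has_fourier (\<lambda>x. u (- x)) (\<lambda>x. U (- x))"
proof (intro has_fourierI_weak square_integrable_uminus_arg u has_fourier_square_integrable[OF u(2)])
  fix \<phi> :: "real ^ 'a \<Rightarrow> complex" assume t: "test_function \<phi>"
  have [measurable]: "u \<in> borel_measurable borel" "U \<in> borel_measurable borel" "\<phi> \<in> borel_measurable borel"
    using u has_fourier_square_integrable[OF u(2)] test_functionD(5)[OF t] by (auto simp: square_integrable_measurable)
  show "(LINT x|lborel. U (- x) * \<phi> x) = (LINT x|lborel. u (- x) * fou \<phi> x)"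
    using has_fourier_test_function[OF u test_function_uminus[OF t]]
    by (simp add: integral_lborel_mult_uminus fou_uminus)
qed

text \<open>The reflection of V stands where the usual identity has a complex conjugate. This is the
  multiplication formula for u and the reflected V, whose transform is (2 pi)^n v by
  inversion.\<close>

lemma has_fourier_parseval:
  fixes u v :: "real ^ 'n \<Rightarrow> complex"
  assumes u: "square_integrable u" "has_fourier u U" and v: "square_integrable v" "has_fourier v V"
  shows "(LINT x|lborel. U x * V (- x)) = (2 * pi) ^ CARD('n) * (LINT x|lborel. u x * v x)"
proof -
  have V: "square_integrable V" by (rule has_fourier_square_integrable[OF v(2)])
  have "has_fourier (\<lambda>x. V (- x)) (\<lambda>x. (2 * pi) ^ CARD('n) * v x)"
    using has_fourier_uminus_arg[OF V has_fourier_inversion[OF v]] by simp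
  from has_fourier_integral_mult[OF u square_integrable_uminus_arg[OF V] this]
  show ?thesis by (simp add: mult.left_commute[of "u _"])
qed

section \<open>The Marchaud integral\<close>

text \<open>The common majorant of the Marchaud integrals: s < 1 makes t^(-s) integrable at 0, and s
  > 0 makes t^(-s-1) integrable at infinity. Increments obey a bound by a multiple of
  \<open>min t 1\<close>, from a Lipschitz estimate for small t and from boundedness for large
  t.\<close>

lemma set_integrable_powr_min:
  assumes s: "0 < s" "s < 1"
  shows "set_integrable lborel {0<..} (\<lambda>t::real. t powr (- s - 1) * min t 1)"
proof -
  have 1: "set_integrable lborel {0<..1} (\<lambda>t::real. t powr (- s))"
  proof -
    have "((\<lambda>t::real. t powr (- s)) has_integral (1 powr (- s + 1) / (- s + 1))) {0..1}"
      using has_integral_powr_from_0[of "- s" 1] s by simp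
    then have "(\<integral>\<^sup>+t. ennreal (indicator {0..1} t * t powr (- s)) \<partial>lborel) = ennreal (1 powr (- s + 1) / (- s + 1))"
      by (intro nn_integral_has_integral_lebesgue) auto
    then have "integrable lborel (\<lambda>t::real. indicator {0..1} t * t powr (- s))"
      by (intro integrableI_nonneg) auto
    then have "set_integrable lborel {0..1} (\<lambda>t::real. t powr (- s))"
      by (simp add: set_integrable_def)
    then show ?thesis by (rule set_integrable_subset) auto
  qed
  have 2: "set_integrable lborel {1<..} (\<lambda>t::real. t powr (- s - 1))"
  proof -
    have "((\<lambda>t::real. t powr (- s - 1)) has_integral (- (1 powr (- s - 1 + 1)) / (- s - 1 + 1))) {1..}"
      using has_integral_powr_to_inf[of "- s - 1" 1] s by simp
    then have "(\<integral>\<^sup>+t. ennreal (indicator {1..} t * t powr (- s - 1)) \<partial>lborel) = ennreal (- (1 powr (- s - 1 + 1)) / (- s - 1 + 1))"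
      by (intro nn_integral_has_integral_lebesgue) auto
    then have "integrable lborel (\<lambda>t::real. indicator {1..} t * t powr (- s - 1))"
      by (intro integrableI_nonneg) auto
    then have "set_integrable lborel {1..} (\<lambda>t::real. t powr (- s - 1))"
      by (simp add: set_integrable_def)
    then show ?thesis by (rule set_integrable_subset) auto
  qed
  have "set_integrable lborel {0<..1} (\<lambda>t::real. t powr (- s - 1) * min t 1)"
    by (rule set_integrable_cong[THEN iffD1, OF refl refl _ 1]) (auto simp: powr_diff)
  moreover have "set_integrable lborel {1<..} (\<lambda>t::real. t powr (- s - 1) * min t 1)"
    by (rule set_integrable_cong[THEN iffD1, OF refl refl _ 2]) auto
  ultimately have "set_integrable lborel ({0<..1} \<union> {1<..}) (\<lambda>t::real. t powr (- s - 1) * min t 1)"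
    by (rule set_integrable_Un) auto
  moreover have "{0<..1} \<union> {1<..} = {0::real<..}" by auto
  ultimately show ?thesis by simp
qed

lemma set_integrable_powr_bound:
  fixes f :: "real \<Rightarrow> complex"
  assumes s: "0 < s" "s < 1" and [measurable]: "f \<in> borel_measurable borel"
    and le: "\<And>t. 0 < t \<Longrightarrow> cmod (f t) \<le> C * min t 1"
  shows "set_integrable lborel {0<..} (\<lambda>t. (t powr (- s - 1)) *\<^sub>R f t)"
proof (rule set_integrable_bound)
  show "set_integrable lborel {0<..} (\<lambda>t. C * (t powr (- s - 1) * min t 1))"
    using set_integrable_powr_min[OF s] by simp
  show "set_borel_measurable lborel {0<..} (\<lambda>t. (t powr (- s - 1)) *\<^sub>R f t)"
    unfolding set_borel_measurable_def by measurable
  show "AE t in lborel. t \<in> {0<..} \<longrightarrow> norm ((t powr (- s - 1)) *\<^sub>R f t) \<le> norm (C * (t powr (- s - 1) * min t 1))"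
  proof (intro AE_I2 impI)
    fix t :: real assume "t \<in> {0<..}"
    then have "norm ((t powr (- s - 1)) *\<^sub>R f t) \<le> t powr (- s - 1) * (C * min t 1)"
      using le[of t] by (simp add: mult_left_mono)
    also have "\<dots> \<le> norm (C * (t powr (- s - 1) * min t 1))" by (simp add: mult.left_commute)
    finally show "norm ((t powr (- s - 1)) *\<^sub>R f t) \<le> norm (C * (t powr (- s - 1) * min t 1))" .
  qed
qed

section \<open>The Marchaud integral of the exponential\<close>

lemma norm_exp_diff_le:
  fixes w w' :: complex
  assumes "Re w \<le> r" "Re w' \<le> r"
  shows "cmod (exp w - exp w') \<le> exp r * cmod (w - w')"
proof (rule field_differentiable_bound[where S="{z. Re z \<le> r}" and f'=exp])
  show "convex {z. Re z \<le> r}" by (rule convex_halfspace_Re_le)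
qed (use assms in \<open>auto intro: DERIV_exp[THEN has_field_derivative_at_within]\<close>)

text \<open>The Gamma integral at exponent - s, made convergent at 0 by subtracting 1. On the right
  half-plane it has the value Gamma(- s) z^s that continuation of the Gamma integral
  suggests.\<close>

definition marchaud :: "real \<Rightarrow> complex \<Rightarrow> complex" where
  "marchaud s z = (LINT t:{0<..}|lborel. (t powr (- s - 1)) *\<^sub>R (exp (- (of_real t * z)) - 1))"

text \<open>An upper bound C of |z| replaces |z| itself, so that the majorant is uniform along a
  sequence approaching the imaginary axis.\<close>

lemma marchaud_bound:
  assumes "0 \<le> Re z" "0 < t" "cmod z \<le> C"
  shows "cmod (exp (- (of_real t * z)) - 1) \<le> (C + 2) * min t 1"
proof -
  have C: "0 \<le> C" using assms(3) norm_ge_zero order_trans by blast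
  have "cmod (exp (- (of_real t * z)) - exp 0) \<le> exp 0 * cmod (- (of_real t * z) - 0)"
    using assms by (intro norm_exp_diff_le) auto
  then have 1: "cmod (exp (- (of_real t * z)) - 1) \<le> t * cmod z" using assms by (simp add: norm_mult)
  have "cmod (exp (- (of_real t * z)) - 1) \<le> cmod (exp (- (of_real t * z))) + cmod 1" by (rule norm_triangle_ineq4)
  also have "cmod (exp (- (of_real t * z))) \<le> 1" using assms by simp
  finally have 2: "cmod (exp (- (of_real t * z)) - 1) \<le> 2" by simp
  show ?thesis
  proof (cases "t \<le> 1")
    case True
    have "t * cmod z \<le> t * (C + 2)" using assms by (intro mult_left_mono) auto
    with 1 True show ?thesis by (simp add: mult.commute)
  next
    case False
    with 2 C show ?thesis by simp
  qed
qed

lemma marchaud_integrable: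
  assumes s: "0 < s" "s < 1" and z: "0 \<le> Re z"
  shows "set_integrable lborel {0<..} (\<lambda>t. (t powr (- s - 1)) *\<^sub>R (exp (- (of_real t * z)) - 1))"
  by (rule set_integrable_powr_bound[OF s, where C="cmod z + 2"])
    (auto intro!: marchaud_bound z)

lemma marchaud_scale:
  assumes "0 < r"
  shows "marchaud s (of_real r * z) = of_real (r powr s) * marchaud s z"
proof -
  define f where "f t = indicat_real {0<..} t *\<^sub>R (t powr (- s - 1)) *\<^sub>R (exp (- (complex_of_real t * z)) - 1)" for t
  have "marchaud s z = (LINT t|lborel. f t)" by (simp add: marchaud_def set_lebesgue_integral_def f_def)
  also have "\<dots> = \<bar>r\<bar> *\<^sub>R (LINT t|lborel. f (0 + r * t))"
    using assms by (intro lborel_integral_real_affine) auto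
  also have "(\<lambda>t. f (0 + r * t)) = (\<lambda>t. r powr (- s - 1) *\<^sub>R (indicat_real {0<..} t *\<^sub>R (t powr (- s - 1)) *\<^sub>R (exp (- (complex_of_real t * (of_real r * z))) - 1)))"
    using assms by (auto simp: f_def fun_eq_iff indicator_def powr_mult zero_less_mult_iff mult_ac)
  also have "\<bar>r\<bar> *\<^sub>R (LINT t|lborel. r powr (- s - 1) *\<^sub>R (indicat_real {0<..} t *\<^sub>R (t powr (- s - 1)) *\<^sub>R (exp (- (complex_of_real t * (of_real r * z))) - 1)))
    = (r * r powr (- s - 1)) *\<^sub>R marchaud s (of_real r * z)"
    unfolding integral_scaleR_right marchaud_def set_lebesgue_integral_def using assms by simp
  also have "r * r powr (- s - 1) = r powr (- s)" using assms by (simp add: powr_diff)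
  finally show ?thesis using assms by (simp add: scaleR_conv_of_real powr_minus field_simps)
qed

lemma marchaud_has_derivative:
  assumes s: "0 < s" "s < 1" and z: "0 < Re z"
  shows "(marchaud s has_field_derivative - (LINT t:{0<..}|lborel. (t powr (- s)) *\<^sub>R exp (- (of_real t * z)))) (at z)"
proof -
  \<comment> \<open>Half the distance to the imaginary axis: increments smaller than \<delta> stay
    in the region Re \<ge> \<delta>, where the difference quotients are at most t exp(- t
    \<delta>).\<close>
  define \<delta> where "\<delta> = Re z / 2"
  have \<delta>: "0 < \<delta>" using z by (simp add: \<delta>_def)
  have "((\<lambda>h. (marchaud s (z + h) - marchaud s z) / h) \<longlongrightarrow>
     (LINT t:{0<..}|lborel. (t powr (- s)) *\<^sub>R - exp (- (of_real t * z)))) (at 0)"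
    unfolding tendsto_at_iff_sequentially
  proof (intro allI impI)
    fix X :: "nat \<Rightarrow> complex" assume X0: "\<forall>i. X i \<in> UNIV - {0}" and X: "X \<longlonglongrightarrow> 0"
    have "\<forall>\<^sub>F k in sequentially. cmod (X k) < \<delta>"
      using tendsto_norm[OF X] \<delta> by (intro order_tendstoD(2)[where y="cmod 0"]) auto
    then obtain N where N: "\<And>k. N \<le> k \<Longrightarrow> cmod (X k) < \<delta>" by (auto simp: eventually_sequentially)
    \<comment> \<open>The domination holds only for small increments, so an initial segment of X is
      dropped and restored at the end by \<open>LIMSEQ_offset\<close>.\<close>
    define Y where "Y k = X (k + N)" for k
    have Y: "cmod (Y k) < \<delta>" "Y k \<noteq> 0" for k using N X0 by (auto simp: Y_def)
    have Ylim: "Y \<longlonglongrightarrow> 0" unfolding Y_def by (rule LIMSEQ_ignore_initial_segment[OF X])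
    have Yre: "\<delta> \<le> Re (z + Y k)" for k
      using abs_Re_le_cmod[of "Y k"] Y(1)[of k] by (auto simp: \<delta>_def)
    define q where "q k t = (exp (- (complex_of_real t * (z + Y k))) - exp (- (complex_of_real t * z))) / Y k" for k t
    have eq: "(marchaud s (z + Y k) - marchaud s z) / Y k = (LINT t:{0<..}|lborel. (t powr (- s - 1)) *\<^sub>R q k t)" for k
    proof -
      have "marchaud s (z + Y k) - marchaud s z = (LINT t:{0<..}|lborel. (t powr (- s - 1)) *\<^sub>R (exp (- (of_real t * (z + Y k))) - 1)
         - (t powr (- s - 1)) *\<^sub>R (exp (- (of_real t * z)) - 1))"
        unfolding marchaud_def using Yre[of k] z \<delta>
        by (intro set_integral_diff(2)[symmetric] marchaud_integrable s) auto
      then have "(marchaud s (z + Y k) - marchaud s z) / Y k = (LINT t:{0<..}|lborel. ((t powr (- s - 1)) *\<^sub>R (exp (- (of_real t * (z + Y k))) - 1)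
         - (t powr (- s - 1)) *\<^sub>R (exp (- (of_real t * z)) - 1)) / Y k)"
        by (simp only: set_integral_divide_zero)
      also have "\<dots> = (LINT t:{0<..}|lborel. (t powr (- s - 1)) *\<^sub>R q k t)"
        by (intro set_lebesgue_integral_cong) (auto simp: q_def scaleR_conv_of_real diff_divide_distrib algebra_simps)
      finally show ?thesis .
    qed
    have "(\<lambda>k. LINT t|lborel. indicat_real {0<..} t *\<^sub>R (t powr (- s - 1)) *\<^sub>R q k t) \<longlonglongrightarrow>
      (LINT t|lborel. indicat_real {0<..} t *\<^sub>R (t powr (- s)) *\<^sub>R - exp (- (of_real t * z)))"
    proof (rule integral_dominated_convergence)
      show "integrable lborel (\<lambda>t::real. indicator {0<..} t *\<^sub>R ((1 + 1 / \<delta>) * (t powr (- s - 1) * min t 1)))"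
        using set_integrable_mult_right[OF set_integrable_powr_min[OF s], of "1 + 1 / \<delta>"]
        by (auto simp: set_integrable_def)
      show "(\<lambda>t. indicat_real {0<..} t *\<^sub>R (t powr (- s - 1)) *\<^sub>R q k t) \<in> borel_measurable lborel" for k
        unfolding q_def by measurable
      show "AE t in lborel. (\<lambda>k. indicat_real {0<..} t *\<^sub>R (t powr (- s - 1)) *\<^sub>R q k t) \<longlonglongrightarrow>
         indicat_real {0<..} t *\<^sub>R (t powr (- s)) *\<^sub>R - exp (- (of_real t * z))"
      proof (intro AE_I2)
        fix t :: real
        have "((\<lambda>w. exp (- (complex_of_real t * w))) has_field_derivative - of_real t * exp (- (complex_of_real t * z))) (at z)"
          by (auto intro!: derivative_eq_intros)
        then have "((\<lambda>h. (exp (- (complex_of_real t * (z + h))) - exp (- (complex_of_real t * z))) / h) \<longlongrightarrow> - of_real t * exp (- (complex_of_real t * z))) (at 0)"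
          by (simp add: DERIV_def)
        then have "(\<lambda>k. q k t) \<longlonglongrightarrow> - of_real t * exp (- (complex_of_real t * z))"
          unfolding q_def using Ylim Y(2) by (auto simp: tendsto_at_iff_sequentially o_def)
        then have "(\<lambda>k. indicat_real {0<..} t *\<^sub>R (t powr (- s - 1)) *\<^sub>R q k t) \<longlonglongrightarrow> indicat_real {0<..} t *\<^sub>R (t powr (- s - 1)) *\<^sub>R (- of_real t * exp (- (complex_of_real t * z)))"
          by (intro tendsto_intros)
        also have "indicat_real {0<..} t *\<^sub>R (t powr (- s - 1)) *\<^sub>R (- of_real t * exp (- (complex_of_real t * z)))
           = indicat_real {0<..} t *\<^sub>R (t powr (- s)) *\<^sub>R - exp (- (of_real t * z))"
          by (auto simp: indicator_def scaleR_conv_of_real powr_diff)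
        finally show "(\<lambda>k. indicat_real {0<..} t *\<^sub>R (t powr (- s - 1)) *\<^sub>R q k t) \<longlonglongrightarrow> indicat_real {0<..} t *\<^sub>R (t powr (- s)) *\<^sub>R - exp (- (of_real t * z))" .
      qed
      show "AE t in lborel. norm (indicat_real {0<..} t *\<^sub>R (t powr (- s - 1)) *\<^sub>R q k t) \<le> indicator {0<..} t *\<^sub>R ((1 + 1 / \<delta>) * (t powr (- s - 1) * min t 1))" for k
      proof (intro AE_I2)
        fix t :: real
        show "norm (indicat_real {0<..} t *\<^sub>R (t powr (- s - 1)) *\<^sub>R q k t) \<le> indicator {0<..} t *\<^sub>R ((1 + 1 / \<delta>) * (t powr (- s - 1) * min t 1))"
        proof (cases "0 < t")
          case True
          have "cmod (exp (- (complex_of_real t * (z + Y k))) - exp (- (complex_of_real t * z)))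
             \<le> exp (- t * \<delta>) * cmod (- (complex_of_real t * (z + Y k)) - - (complex_of_real t * z))"
            using Yre[of k] True \<delta> by (intro norm_exp_diff_le) (auto simp: \<delta>_def)
          also have "- (complex_of_real t * (z + Y k)) - - (complex_of_real t * z) = - (of_real t * Y k)"
            by (simp add: algebra_simps)
          also have "cmod \<dots> = t * cmod (Y k)" using True by (simp add: norm_mult)
          finally have "cmod (q k t) \<le> exp (- t * \<delta>) * t"
            using Y(2)[of k] by (simp add: q_def norm_divide divide_le_eq mult.assoc)
          also have "\<dots> \<le> (1 + 1 / \<delta>) * min t 1"
          proof (cases "t \<le> 1")
            case True1: True
            have "exp (- t * \<delta>) * t \<le> 1 * t" using True \<delta> by (intro mult_right_mono) auto
            also have "\<dots> \<le> (1 + 1 / \<delta>) * t" using True \<delta> by (intro mult_right_mono) auto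
            finally show ?thesis using True1 by simp
          next
            case False
            \<comment> \<open>From x \<le> exp x at x = t \<delta>; the summand 1 / \<delta> of the
              majorant comes from here.\<close>
            have "t * \<delta> \<le> exp (t * \<delta>)" using exp_ge_add_one_self[of "t * \<delta>"] by linarith
            then have "exp (- t * \<delta>) * t \<le> 1 / \<delta>" using \<delta> by (simp add: exp_minus field_simps)
            then show ?thesis using False by simp
          qed
          finally have "t powr (- s - 1) * cmod (q k t) \<le> t powr (- s - 1) * ((1 + 1 / \<delta>) * min t 1)"
            by (intro mult_left_mono) auto
          then show ?thesis using True by (simp add: mult.left_commute)
        qed simp
      qed
    qed measurable
    then have "(\<lambda>k. (marchaud s (z + Y k) - marchaud s z) / Y k) \<longlonglongrightarrow> (LINT t:{0<..}|lborel. (t powr (- s)) *\<^sub>R - exp (- (of_real t * z)))"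
      unfolding eq by (simp add: set_lebesgue_integral_def)
    then have "(\<lambda>k. (marchaud s (z + X (k + N)) - marchaud s z) / X (k + N)) \<longlonglongrightarrow> (LINT t:{0<..}|lborel. (t powr (- s)) *\<^sub>R - exp (- (of_real t * z)))"
      by (simp add: Y_def)
    from LIMSEQ_offset[OF this]
    show "((\<lambda>h. (marchaud s (z + h) - marchaud s z) / h) \<circ> X) \<longlonglongrightarrow> (LINT t:{0<..}|lborel. (t powr (- s)) *\<^sub>R - exp (- (of_real t * z)))"
      by (simp add: o_def)
  qed
  moreover have "(LINT t:{0<..}|lborel. (t powr (- s)) *\<^sub>R - exp (- (of_real t * z))) = - (LINT t:{0<..}|lborel. (t powr (- s)) *\<^sub>R exp (- (of_real t * z)))"
    by (simp add: set_lebesgue_integral_def)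
  ultimately show ?thesis by (simp add: DERIV_def)
qed

lemma integral_powr_exp:
  assumes "0 < s" "s < 1"
  shows "(LINT t:{0<..}|lborel. (t powr (- s)) *\<^sub>R exp (- (of_real t * 1))) = complex_of_real (Gamma (1 - s))"
proof -
  have "ennreal (Gamma (1 - s)) = (\<integral>\<^sup>+t. ennreal (indicator {0..} t * t powr (1 - s - 1) / exp t) \<partial>lborel)"
    using assms by (intro Gamma_conv_nn_integral_real) auto
  also have "\<dots> = (\<integral>\<^sup>+t. ennreal (indicator {0<..} t * (t powr (- s) * exp (- t))) \<partial>lborel)"
    using AE_lborel_singleton[of "0::real"]
    by (intro nn_integral_cong_AE) (auto elim!: eventually_mono simp: indicator_def exp_minus divide_inverse)
  finally have *: "(\<integral>\<^sup>+t. ennreal (indicator {0<..} t * (t powr (- s) * exp (- t))) \<partial>lborel) = ennreal (Gamma (1 - s))" by simp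
  have "(LINT t|lborel. indicator {0<..} t * (t powr (- s) * exp (- t))) = Gamma (1 - s)"
    using assms Gamma_real_pos[of "1 - s"] by (subst integral_eq_nn_integral) (auto simp: *)
  moreover have "indicat_real {0<..} t *\<^sub>R (t powr (- s)) *\<^sub>R exp (- (complex_of_real t * 1)) = complex_of_real (indicator {0<..} t * (t powr (- s) * exp (- t)))" for t
    by (simp add: scaleR_conv_of_real flip: exp_of_real)
  ultimately show ?thesis unfolding set_lebesgue_integral_def by (simp only: integral_complex_of_real)
qed

text \<open>Euler's identity $z H'(z) = s H(z)$ for the homogeneous function $H$ shows that $H(z) z^{-s}$ has
  derivative $0$.\<close>

lemma marchaud_right_halfplane:
  assumes s: "0 < s" "s < 1" and z: "0 < Re z"
  shows "marchaud s z = - of_real (Gamma (1 - s) / s) * exp (of_real s * Ln z)"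
proof -
  define H' where "H' z = - (LINT t:{0<..}|lborel. (t powr (- s)) *\<^sub>R exp (- (of_real t * z)))" for z :: complex
  have H': "(marchaud s has_field_derivative H' z) (at z)" if "0 < Re z" for z
    unfolding H'_def by (rule marchaud_has_derivative[OF s that])
  \<comment> \<open>Both sides are the derivative of H(r z) in r at r = 1, computed once by the
    chain rule and once from the homogeneity \<open>marchaud_scale\<close>.\<close>
  have euler: "z * H' z = of_real s * marchaud s z" if z: "0 < Re z" for z
  proof -
    have "((\<lambda>r. marchaud s (of_real r * z)) has_vector_derivative z * H' z) (at 1)"
    proof -
      have "((\<lambda>w. marchaud s (w * z)) has_field_derivative H' (of_real 1 * z) * z) (at (of_real 1))"
      proof (rule DERIV_chain2[where f="marchaud s" and g="\<lambda>w. w * z"])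
        show "(marchaud s has_field_derivative H' (of_real 1 * z)) (at (of_real 1 * z))" using z by (intro H') simp
        show "((\<lambda>w. w * z) has_field_derivative z) (at (of_real 1))" by (auto intro!: derivative_eq_intros)
      qed
      from has_vector_derivative_real_field[OF this] show ?thesis by (simp add: mult.commute)
    qed
    moreover have "((\<lambda>r. of_real (r powr s) * marchaud s z) has_vector_derivative of_real s * marchaud s z) (at 1)"
    proof -
      have "((\<lambda>r. r powr s) has_real_derivative s) (at 1)"
        by (auto intro!: derivative_eq_intros)
      then show ?thesis
        by (intro has_vector_derivative_mult_left has_vector_derivative_of_real)
    qed
    then have "((\<lambda>r. marchaud s (of_real r * z)) has_vector_derivative of_real s * marchaud s z) (at 1)"
      by (rule has_vector_derivative_transform_within_open[of _ _ _ "{0<..}"]) (auto simp: marchaud_scale)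
    ultimately show ?thesis by (rule vector_derivative_unique_at)
  qed
  define K where "K z = marchaud s z * exp (- (of_real s * Ln z))" for z
  have K': "(K has_field_derivative 0) (at z)" if z: "0 < Re z" for z
  proof -
    have nz: "z \<noteq> 0" "z \<notin> \<real>\<^sub>\<le>\<^sub>0" using z by (auto simp: complex_nonpos_Reals_iff)
    have "(K has_field_derivative (marchaud s z * (exp (- (of_real s * Ln z)) * (- (of_real s * inverse z))) + H' z * exp (- (of_real s * Ln z)))) (at z)"
      unfolding K_def[abs_def] using nz
      by (intro DERIV_mult' H' z) (auto intro!: derivative_eq_intros simp: field_simps)
    also have "(marchaud s z * (exp (- (of_real s * Ln z)) * (- (of_real s * inverse z))) + H' z * exp (- (of_real s * Ln z)))
      = exp (- (of_real s * Ln z)) * inverse z * (z * H' z - of_real s * marchaud s z)"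
      using nz by (simp add: field_simps)
    finally show ?thesis by (simp add: euler[OF z])
  qed
  have "K z = K 1"
  proof -
    have "\<exists>c. \<forall>x\<in>{z. Re z > 0}. K x = c"
      by (rule has_field_derivative_zero_constant[OF convex_halfspace_Re_gt])
        (auto intro: K' has_field_derivative_at_within)
    then show ?thesis using z by auto
  qed
  also have "K 1 = - of_real (Gamma (1 - s) / s)"
  proof -
    \<comment> \<open>Euler's identity at 1 evaluates H(1) through H'(1), which is a convergent
      Gamma integral up to sign.\<close>
    have "of_real s * marchaud s 1 = - of_real (Gamma (1 - s))"
      using euler[of 1] integral_powr_exp[OF s] by (simp add: H'_def)
    then have "marchaud s 1 = - of_real (Gamma (1 - s)) / of_real s" using s by (simp add: field_simps)
    then show ?thesis by (simp add: K_def)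
  qed
  finally have "K z * exp (of_real s * Ln z) = - of_real (Gamma (1 - s) / s) * exp (of_real s * Ln z)" by simp
  then show ?thesis by (simp add: K_def mult.assoc exp_add[symmetric])
qed

text \<open>On the imaginary axis the principal logarithm has imaginary part pi/2 or - pi/2, which
  is the branch fixed by \<open>ipow\<close>; here i y = - i \<eta>.\<close>

lemma exp_Ln_imaginary:
  assumes "\<eta> \<noteq> 0"
  shows "exp (of_real s * Ln (- (\<i> * of_real \<eta>))) = ipow s (- \<eta>)"
proof (cases "0 < \<eta>")
  case True
  have "Ln (of_real \<eta> * - \<i>) = ln \<eta> + Ln (- \<i>)" using True by (subst Ln_times_of_real) (auto simp: Ln_of_real)
  then have "Ln (- (\<i> * of_real \<eta>)) = of_real (ln \<eta>) - \<i> * of_real (pi / 2)" by (simp add: mult.commute)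
  note L = this
  have "exp (of_real s * Ln (- (\<i> * of_real \<eta>))) = exp (of_real (s * ln \<eta>)) * exp (\<i> * of_real (- pi * s / 2))"
    unfolding L by (simp add: exp_add[symmetric] algebra_simps)
  then show ?thesis using True
    by (simp add: ipow_def powr_def cis_conv_exp exp_of_real del: of_real_mult of_real_minus)
next
  case False
  then have neg: "\<eta> < 0" using assms by simp
  have "Ln (of_real (- \<eta>) * \<i>) = ln (- \<eta>) + Ln \<i>" using neg Ln_of_real[of "- \<eta>"] by (subst Ln_times_of_real) auto
  then have "Ln (- (\<i> * of_real \<eta>)) = of_real (ln (- \<eta>)) + \<i> * of_real (pi / 2)" by (simp add: mult.commute)
  note L = this
  have "exp (of_real s * Ln (- (\<i> * of_real \<eta>))) = exp (of_real (s * ln (- \<eta>))) * exp (\<i> * of_real (pi * s / 2))"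
    unfolding L by (simp add: exp_add[symmetric] algebra_simps)
  then show ?thesis using neg
    by (simp add: ipow_def powr_def cis_conv_exp exp_of_real del: of_real_mult of_real_minus)
qed

lemma ipow_0 [simp]: "ipow s 0 = 0"
  by (simp add: ipow_def)

lemma integral_powr_cis:
  assumes s: "0 < s" "s < 1"
  shows "(LINT t:{0<..}|lborel. (t powr (- s - 1)) *\<^sub>R (cis (t * \<eta>) - 1)) = - of_real (Gamma (1 - s) / s) * ipow s (- \<eta>)"
proof (cases "\<eta> = 0")
  case False
  define z where "z k = complex_of_real (1 / real (Suc k)) - \<i> * of_real \<eta>" for k
  have Re: "0 < Re (z k)" "Re (z k) \<le> 1" for k by (auto simp: z_def)
  have norm: "cmod (z k) \<le> 1 + \<bar>\<eta>\<bar>" for k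
  proof -
    have "cmod (z k) \<le> cmod (complex_of_real (1 / real (Suc k))) + cmod (\<i> * of_real \<eta>)"
      unfolding z_def by (rule norm_triangle_ineq4)
    also have "\<dots> \<le> 1 + \<bar>\<eta>\<bar>" by (simp add: norm_mult norm_divide del: of_nat_Suc)
    finally show ?thesis .
  qed
  have zlim: "z \<longlonglongrightarrow> - (\<i> * of_real \<eta>)"
  proof -
    have "z \<longlonglongrightarrow> complex_of_real 0 - \<i> * of_real \<eta>"
      unfolding z_def by (intro tendsto_intros lim_1_over_n[THEN LIMSEQ_Suc])
    then show ?thesis by simp
  qed
  have "(\<lambda>k. LINT t|lborel. indicat_real {0<..} t *\<^sub>R (t powr (- s - 1)) *\<^sub>R (exp (- (of_real t * z k)) - 1)) \<longlonglongrightarrow>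
    (LINT t|lborel. indicat_real {0<..} t *\<^sub>R (t powr (- s - 1)) *\<^sub>R (exp (- (of_real t * - (\<i> * of_real \<eta>))) - 1))"
  proof (rule integral_dominated_convergence)
    show "integrable lborel (\<lambda>t::real. indicator {0<..} t *\<^sub>R ((1 + \<bar>\<eta>\<bar> + 2) * (t powr (- s - 1) * min t 1)))"
      using set_integrable_mult_right[OF set_integrable_powr_min[OF s], of "1 + \<bar>\<eta>\<bar> + 2"]
      by (auto simp: set_integrable_def)
    show "AE t in lborel. (\<lambda>k. indicat_real {0<..} t *\<^sub>R (t powr (- s - 1)) *\<^sub>R (exp (- (of_real t * z k)) - 1)) \<longlonglongrightarrow>
      indicat_real {0<..} t *\<^sub>R (t powr (- s - 1)) *\<^sub>R (exp (- (of_real t * - (\<i> * of_real \<eta>))) - 1)"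
      by (intro AE_I2 tendsto_intros zlim)
    show "AE t in lborel. norm (indicat_real {0<..} t *\<^sub>R (t powr (- s - 1)) *\<^sub>R (exp (- (of_real t * z k)) - 1))
      \<le> indicator {0<..} t *\<^sub>R ((1 + \<bar>\<eta>\<bar> + 2) * (t powr (- s - 1) * min t 1))" for k
    proof (intro AE_I2)
      fix t :: real
      show "norm (indicat_real {0<..} t *\<^sub>R (t powr (- s - 1)) *\<^sub>R (exp (- (of_real t * z k)) - 1))
        \<le> indicator {0<..} t *\<^sub>R ((1 + \<bar>\<eta>\<bar> + 2) * (t powr (- s - 1) * min t 1))"
      proof (cases "0 < t")
        case True
        have "t powr (- s - 1) * cmod (exp (- (of_real t * z k)) - 1) \<le> t powr (- s - 1) * ((1 + \<bar>\<eta>\<bar> + 2) * min t 1)"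
          using Re(1)[of k] True by (intro mult_left_mono marchaud_bound norm) auto
        then show ?thesis using True by (simp add: mult.left_commute)
      qed simp
    qed
  qed measurable
  then have "(\<lambda>k. marchaud s (z k)) \<longlonglongrightarrow> marchaud s (- (\<i> * of_real \<eta>))"
    by (simp add: marchaud_def set_lebesgue_integral_def)
  moreover have "(\<lambda>k. marchaud s (z k)) \<longlonglongrightarrow> - of_real (Gamma (1 - s) / s) * exp (of_real s * Ln (- (\<i> * of_real \<eta>)))"
    unfolding marchaud_right_halfplane[OF s Re(1)] using False
    by (intro tendsto_intros zlim) (auto simp: complex_nonpos_Reals_iff)
  ultimately have "marchaud s (- (\<i> * of_real \<eta>)) = - of_real (Gamma (1 - s) / s) * ipow s (- \<eta>)"
    unfolding exp_Ln_imaginary[OF False] by (rule LIMSEQ_unique)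
  moreover have "exp (- (of_real t * - (\<i> * of_real \<eta>))) = cis (t * \<eta>)" for t
    by (simp add: cis_conv_exp mult_ac)
  ultimately show ?thesis by (simp add: marchaud_def)
qed (simp add: set_lebesgue_integral_def)

section \<open>The directional fractional derivative as a multiplier\<close>

lemma directional_derivative_facts:
  fixes \<phi> :: "real ^ 'n \<Rightarrow> complex" and \<theta> :: "real ^ 'n"
  assumes t: "test_function \<phi>"
  defines "d \<equiv> \<lambda>y. frechet_derivative \<phi> (at y) \<theta>"
  shows "continuous_on UNIV d" "\<exists>L\<ge>0. \<forall>y. cmod (d y) \<le> L"
    and "d y \<noteq> 0 \<Longrightarrow> y \<in> closure {x. \<phi> x \<noteq> 0}"
    and "((\<lambda>t. \<phi> (x + t *\<^sub>R \<theta>)) has_vector_derivative d (x + r *\<^sub>R \<theta>)) (at r)"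
proof -
  note C1 = test_functionD(1)[OF t]
  show cont: "continuous_on UNIV d" using C1 by (simp add: C1_function_def d_def)
  have out: "d y = 0" if "y \<notin> closure {x. \<phi> x \<noteq> 0}" for y
  proof -
    have "((\<lambda>x. 0) has_derivative (\<lambda>h. 0)) (at y)" by simp
    then have "(\<phi> has_derivative (\<lambda>h. 0)) (at y)"
      by (rule has_derivative_transform_within_open[of _ _ _ _ "- closure {x. \<phi> x \<noteq> 0}"])
        (use that closure_subset[of "{x. \<phi> x \<noteq> 0}"] in auto)
    from frechet_derivative_at[OF this] show ?thesis by (simp add: d_def) (metis)
  qed
  then show "d y \<noteq> 0 \<Longrightarrow> y \<in> closure {x. \<phi> x \<noteq> 0}" by blast
  have "bounded (d ` closure {x. \<phi> x \<noteq> 0})"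
    using test_functionD(3)[OF t] cont
    by (intro compact_imp_bounded compact_continuous_image) (auto intro: continuous_on_subset)
  then obtain L where L: "\<And>y. y \<in> closure {x. \<phi> x \<noteq> 0} \<Longrightarrow> cmod (d y) \<le> L"
    by (auto simp: bounded_iff)
  have "cmod (d y) \<le> max L 0" for y
    using L[of y] out[of y] by (cases "y \<in> closure {x. \<phi> x \<noteq> 0}") auto
  then show "\<exists>L\<ge>0. \<forall>y. cmod (d y) \<le> L" by (intro exI[of _ "max L 0"]) auto
  have "((\<lambda>t. x + t *\<^sub>R \<theta>) has_derivative (\<lambda>h. h *\<^sub>R \<theta>)) (at r)"
    by (auto intro!: derivative_eq_intros)
  from has_derivative_compose[OF this C1_function_has_derivative[OF C1]]
  have "((\<lambda>t. \<phi> (x + t *\<^sub>R \<theta>)) has_derivative (\<lambda>h. frechet_derivative \<phi> (at (x + r *\<^sub>R \<theta>)) (h *\<^sub>R \<theta>))) (at r)" .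
  moreover have "frechet_derivative \<phi> (at (x + r *\<^sub>R \<theta>)) (h *\<^sub>R \<theta>) = h *\<^sub>R d (x + r *\<^sub>R \<theta>)" for h
    using C1 by (simp add: C1_function_def d_def linear_frechet_derivative linear_cmul)
  ultimately show "((\<lambda>t. \<phi> (x + t *\<^sub>R \<theta>)) has_vector_derivative d (x + r *\<^sub>R \<theta>)) (at r)"
    by (simp add: has_vector_derivative_def)
qed

lemma norm_increment_le:
  fixes g :: "real \<Rightarrow> complex"
  assumes "\<And>t. (g has_vector_derivative g' t) (at t)" "\<And>t. cmod (g' t) \<le> L" "0 \<le> t"
  shows "cmod (g t - g 0) \<le> L * t"
proof -
  have "norm (g t - g 0) \<le> L * norm (t - 0)"
  proof (rule differentiable_bound[of UNIV g "\<lambda>r h. h *\<^sub>R g' r"])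
    show "(g has_derivative (\<lambda>h. h *\<^sub>R g' r)) (at r within UNIV)" for r
      using assms(1)[of r] by (simp add: has_vector_derivative_def)
    show "onorm (\<lambda>h. h *\<^sub>R g' r) \<le> L" for r
      by (rule onorm_le) (simp, metis abs_ge_zero assms(2) mult.commute mult_right_mono)
  qed auto
  then show ?thesis using assms(3) by simp
qed

text \<open>Integration by parts: t^(-s) times the derivative of the increment becomes s t^(-s-1)
  times the increment. The boundary terms vanish because the increment is O(t) at 0, with s < 1, and
  bounded at infinity, with s > 0.\<close>

lemma RL_integral_adj_marchaud:
  fixes \<phi> :: "real ^ 'n \<Rightarrow> complex"
  assumes s: "0 < s" "s < 1" and t: "test_function \<phi>" and \<theta>: "norm \<theta> = 1"
  shows "RL_integral_adj (1 - s) \<theta> (\<lambda>y. frechet_derivative \<phi> (at y) \<theta>) x =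
    of_real (s / Gamma (1 - s)) * (LINT t:{0<..}|lborel. (t powr (- s - 1)) *\<^sub>R (\<phi> (x + t *\<^sub>R \<theta>) - \<phi> x))"
proof -
  define d where "d y = frechet_derivative \<phi> (at y) \<theta>" for y
  note facts = directional_derivative_facts[OF t, where \<theta>=\<theta>, folded d_def]
  obtain L where L: "0 \<le> L" "\<And>y. cmod (d y) \<le> L" using facts(2) by blast
  obtain M where M: "\<And>y. cmod (\<phi> y) \<le> M" using test_functionD(6)[OF t] by blast
  have [measurable]: "\<phi> \<in> borel_measurable borel" "d \<in> borel_measurable borel"
    using test_functionD(5)[OF t] facts(1) by (auto simp: square_integrable_measurable borel_measurable_continuous_onI)
  define g where "g r = \<phi> (x + r *\<^sub>R \<theta>) - \<phi> x" for r
  have gd: "(g has_vector_derivative d (x + r *\<^sub>R \<theta>)) (at r)" for r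
    unfolding g_def using facts(4)[of x r] by (auto intro!: derivative_eq_intros)
  have gL: "cmod (g r) \<le> L * r" if "0 \<le> r" for r
    using norm_increment_le[OF gd L(2) that] by (simp add: g_def)
  have gM: "cmod (g r) \<le> 2 * M" for r
    using norm_triangle_ineq4[of "\<phi> (x + r *\<^sub>R \<theta>)" "\<phi> x"] M[of "x + r *\<^sub>R \<theta>"] M[of x] by (simp add: g_def)
  have M0: "0 \<le> M" using M norm_ge_zero order_trans by blast
  have gmin: "cmod (g r) \<le> (L + 2 * M) * min r 1" if "0 < r" for r
  proof (cases "r \<le> 1")
    case True
    have "L * r \<le> (L + 2 * M) * r" using that M0 by (intro mult_right_mono) auto
    then have "cmod (g r) \<le> (L + 2 * M) * r" using gL[of r] that by linarith
    with True show ?thesis by (simp add: min_def)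
  qed (use gM[of r] L(1) in auto)
  have [measurable]: "g \<in> borel_measurable borel" unfolding g_def by measurable
  have i1: "set_integrable lborel {0<..} (\<lambda>r. (r powr (- s - 1)) *\<^sub>R g r)"
    by (rule set_integrable_powr_bound[OF s _ gmin]) auto
  have "bounded (closure {x. \<phi> x \<noteq> 0})" using test_functionD(3)[OF t] by (rule compact_imp_bounded)
  then obtain R where R: "0 < R" "\<And>y. y \<in> closure {x. \<phi> x \<noteq> 0} \<Longrightarrow> norm y \<le> R"
    unfolding bounded_pos by blast
  \<comment> \<open>Beyond T the ray has left the support of \<phi>, as \<theta> is a unit vector.
    This secures integrability of the derivative against t^(-s), a weight that is not integrable at
    infinity by itself.\<close>
  define T where "T = max 1 (R + norm x)"
  have T: "1 \<le> T" by (simp add: T_def)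
  have dT: "d (x + r *\<^sub>R \<theta>) = 0" if "T < r" for r
  proof (rule ccontr)
    assume "d (x + r *\<^sub>R \<theta>) \<noteq> 0"
    then have "norm (x + r *\<^sub>R \<theta>) \<le> R" using facts(3) R(2) by blast
    moreover have "norm (r *\<^sub>R \<theta>) \<le> norm (x + r *\<^sub>R \<theta>) + norm x"
      using norm_triangle_ineq4[of "x + r *\<^sub>R \<theta>" x] by simp
    ultimately show False using that \<theta> T by (auto simp: T_def)
  qed
  have i2: "set_integrable lborel {0<..} (\<lambda>r. (r powr (- s)) *\<^sub>R d (x + r *\<^sub>R \<theta>))"
  proof (rule set_integrable_cong[THEN iffD1, OF refl refl])
    show "set_integrable lborel {0<..} (\<lambda>r. (r powr (- s - 1)) *\<^sub>R (r *\<^sub>R d (x + r *\<^sub>R \<theta>)))"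
    proof (rule set_integrable_powr_bound[OF s, where C="L * T"])
      fix r :: real assume r: "0 < r"
      show "cmod (r *\<^sub>R d (x + r *\<^sub>R \<theta>)) \<le> L * T * min r 1"
      proof (cases "T < r")
        case True
        then show ?thesis using dT[OF True] L(1) T r by simp
      next
        case False
        have "r \<le> T * min r 1" using False T r by (cases "r \<le> 1") auto
        then have "r * cmod (d (x + r *\<^sub>R \<theta>)) \<le> (T * min r 1) * L"
          using L r by (intro mult_mono) auto
        then show ?thesis using r by (simp add: mult_ac)
      qed
    qed measurable
  qed (simp add: powr_diff)
  have F0: "((\<lambda>r. (r powr (- s)) *\<^sub>R g r) \<longlongrightarrow> 0) (at_right 0)"
  proof (rule Lim_null_comparison)
    show "\<forall>\<^sub>F r in at_right 0. norm ((r powr (- s)) *\<^sub>R g r) \<le> L * r powr (1 - s)"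
      using eventually_at_right_less[of 0]
    proof eventually_elim
      case (elim r)
      have "r powr (- s) * cmod (g r) \<le> r powr (- s) * (L * r)"
        using gL[of r] elim by (intro mult_left_mono) auto
      also have "\<dots> = L * r powr (1 - s)" using elim by (simp add: powr_diff powr_minus divide_inverse)
      finally show ?case by simp
    qed
    have "((\<lambda>r. r powr (1 - s)) \<longlongrightarrow> 0) (at_right 0)" using s by real_asymp
    from tendsto_mult_left[OF this, of L] show "((\<lambda>r. L * r powr (1 - s)) \<longlongrightarrow> 0) (at_right 0)" by simp
  qed
  have Finf: "((\<lambda>r. (r powr (- s)) *\<^sub>R g r) \<longlongrightarrow> 0) at_top"
  proof (rule Lim_null_comparison)
    show "\<forall>\<^sub>F r in at_top. norm ((r powr (- s)) *\<^sub>R g r) \<le> 2 * M * r powr (- s)"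
      using mult_left_mono[OF gM powr_ge_zero] by (intro always_eventually allI) (simp add: mult.commute)
    have "((\<lambda>r. r powr (- s)) \<longlongrightarrow> 0) at_top" using s by real_asymp
    from tendsto_mult_left[OF this, of "2 * M"] show "((\<lambda>r. 2 * M * r powr (- s)) \<longlongrightarrow> 0) at_top" by simp
  qed
  \<comment> \<open>The derivative of r^(-s) g(r); its integral over the half-line is the difference
    of two vanishing boundary values.\<close>
  define f where "f r = (r powr (- s)) *\<^sub>R d (x + r *\<^sub>R \<theta>) - s *\<^sub>R (r powr (- s - 1)) *\<^sub>R g r" for r
  have fi: "set_integrable lborel {0<..} f"
    unfolding f_def using i1 i2 by (intro set_integral_diff(1) set_integrable_scaleR_right)
  have ein: "einterval 0 \<infinity> = {0::real<..}" by (auto simp: einterval_def)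
  have "(LBINT r=0..\<infinity>. f r) = 0 - 0"
  proof (rule interval_integral_FTC_integrable[where F="\<lambda>r. (r powr (- s)) *\<^sub>R g r"])
    fix r assume "(0::ereal) < ereal r"
    then have r: "0 < r" by simp
    have "((\<lambda>r. r powr (- s)) has_vector_derivative (- s * r powr (- s - 1))) (at r)"
      unfolding has_real_derivative_iff_has_vector_derivative[symmetric]
      using r by (auto intro!: derivative_eq_intros)
    from has_vector_derivative_scaleR[OF this[folded has_real_derivative_iff_has_vector_derivative] gd[of r]]
    show "((\<lambda>r. (r powr (- s)) *\<^sub>R g r) has_vector_derivative f r) (at r)"
      by (simp add: f_def algebra_simps)
    have "((\<lambda>r. r powr p) has_real_derivative p * r powr (p - 1)) (at r)" for p
      using r by (auto intro!: derivative_eq_intros)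
    then have pc: "isCont (\<lambda>r. r powr p) r" for p by (rule DERIV_isCont)
    have xc: "isCont (\<lambda>r. x + r *\<^sub>R \<theta>) r" by (intro continuous_intros)
    have "isCont d (x + r *\<^sub>R \<theta>)" using facts(1) by (simp add: continuous_on_eq_continuous_at)
    from isCont_o2[OF xc this] have dc: "isCont (\<lambda>r. d (x + r *\<^sub>R \<theta>)) r" .
    have gc: "isCont g r" by (rule has_vector_derivative_continuous[OF gd[of r]])
    show "isCont f r"
      unfolding f_def
      by (rule continuous_diff[OF continuous_scaleR[OF pc dc] continuous_scaleR[OF continuous_const continuous_scaleR[OF pc gc]]])
  next
    show "set_integrable lborel (einterval 0 \<infinity>) f" unfolding ein by (rule fi)
    show "(((\<lambda>r. (r powr (- s)) *\<^sub>R g r) \<circ> real_of_ereal) \<longlongrightarrow> 0) (at_right 0)"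
      using F0 unfolding zero_ereal_def ereal_tendsto_simps1 .
    show "(((\<lambda>r. (r powr (- s)) *\<^sub>R g r) \<circ> real_of_ereal) \<longlongrightarrow> 0) (at_left \<infinity>)"
      using Finf unfolding ereal_tendsto_simps1 .
  qed simp
  then have "(LINT r:{0<..}|lborel. f r) = 0"
    by (simp add: interval_lebesgue_integral_0_infty)
  then have "(LINT r:{0<..}|lborel. (r powr (- s)) *\<^sub>R d (x + r *\<^sub>R \<theta>)) = s *\<^sub>R (LINT r:{0<..}|lborel. (r powr (- s - 1)) *\<^sub>R g r)"
    unfolding f_def set_integral_diff(2)[OF i2 set_integrable_scaleR_right[OF i1]] set_integral_scaleR_right
    by (simp only: right_minus_eq)
  then show ?thesis
    by (simp add: RL_integral_adj_def d_def g_def scaleR_conv_of_real divide_inverse mult_ac)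
qed

text \<open>The increment is controlled in two norms at once: the L^1 bound feeds Fubini, and the
  uniform bound makes the resulting function bounded, hence square integrable.\<close>

lemma translate_difference_L1:
  fixes \<phi> :: "real ^ 'n \<Rightarrow> complex"
  assumes t: "test_function \<phi>" and \<theta>: "norm \<theta> = 1"
  shows "\<exists>C. \<forall>r>0. (LINT x|lborel. cmod (\<phi> (x + r *\<^sub>R \<theta>) - \<phi> x)) \<le> C * min r 1
      \<and> (\<forall>x. cmod (\<phi> (x + r *\<^sub>R \<theta>) - \<phi> x) \<le> C * min r 1)"
proof -
  define d where "d y = frechet_derivative \<phi> (at y) \<theta>" for y
  note facts = directional_derivative_facts[OF t, where \<theta>=\<theta>, folded d_def]
  obtain L where L: "0 \<le> L" "\<And>y. cmod (d y) \<le> L" using facts(2) by blast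
  obtain M where M: "\<And>y. cmod (\<phi> y) \<le> M" using test_functionD(6)[OF t] by blast
  have M0: "0 \<le> M" using M norm_ge_zero order_trans by blast
  have i: "integrable lborel \<phi>" by (rule test_functionD(4)[OF t])
  have i': "integrable lborel (\<lambda>x. \<phi> (x + r *\<^sub>R \<theta>))" for r
    using integrable_lborel_affine[OF i, of 1 "r *\<^sub>R \<theta>"] by (simp add: add.commute)
  have [measurable]: "\<phi> \<in> borel_measurable borel" using i by measurable
  have gL: "cmod (\<phi> (x + r *\<^sub>R \<theta>) - \<phi> x) \<le> L * r" if "0 \<le> r" for r x
    using norm_increment_le[OF facts(4)[of x] L(2) that] by simp
  have gM: "cmod (\<phi> (x + r *\<^sub>R \<theta>) - \<phi> x) \<le> 2 * M" for r x
    using norm_triangle_ineq4[of "\<phi> (x + r *\<^sub>R \<theta>)" "\<phi> x"] M[of "x + r *\<^sub>R \<theta>"] M[of x] by simp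
  have "bounded (closure {x. \<phi> x \<noteq> 0})" using test_functionD(3)[OF t] by (rule compact_imp_bounded)
  then obtain R where R: "0 < R" "\<And>y. y \<in> closure {x. \<phi> x \<noteq> 0} \<Longrightarrow> norm y \<le> R"
    unfolding bounded_pos by blast
  have out: "\<phi> y = 0" if "R < norm y" for y
    using R(2)[of y] that closure_subset[of "{x. \<phi> x \<noteq> 0}"] by fastforce
  \<comment> \<open>For r \<le> 1 all increments are supported in the ball of radius R + 1, so the
    Lipschitz bound L r times its volume V bounds the L^1 norm; for larger r twice the L^1 norm of
    \<phi> suffices.\<close>
  define V where "V = measure lborel (cball (0::real^'n) (R + 1))"
  define I where "I = (LINT x|lborel. cmod (\<phi> x))"
  have I0: "0 \<le> I" unfolding I_def by (intro integral_nonneg_AE) auto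
  have V0: "0 \<le> V" by (simp add: V_def)
  have one: "(LINT x|lborel. cmod (\<phi> (x + r *\<^sub>R \<theta>) - \<phi> x)) \<le> (L * V) * r" if r: "0 < r" "r \<le> 1" for r
  proof -
    have "(LINT x|lborel. cmod (\<phi> (x + r *\<^sub>R \<theta>) - \<phi> x)) \<le> (LINT x|lborel. (L * r) * indicator (cball (0 :: real ^ 'n) (R + 1)) x)"
    proof (rule Bochner_Integration.integral_mono)
      show "integrable lborel (\<lambda>x. cmod (\<phi> (x + r *\<^sub>R \<theta>) - \<phi> x))" using i i' by auto
      show "integrable lborel (\<lambda>x. (L * r) * indicator (cball (0::real^'n) (R + 1)) x)"
        by (intro integrable_mult_right integrable_real_indicator) (auto intro: emeasure_lborel_cball_finite[simplified])
      fix x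
      show "cmod (\<phi> (x + r *\<^sub>R \<theta>) - \<phi> x) \<le> (L * r) * indicator (cball 0 (R + 1)) x"
      proof (cases "x \<in> cball 0 (R + 1)")
        case True
        then show ?thesis using gL[of r x] r by simp
      next
        case False
        then have n: "R + 1 < norm x" by simp
        moreover have "norm x \<le> norm (x + r *\<^sub>R \<theta>) + norm (r *\<^sub>R \<theta>)"
          using norm_triangle_ineq4[of "x + r *\<^sub>R \<theta>" "r *\<^sub>R \<theta>"] by simp
        ultimately have "R < norm (x + r *\<^sub>R \<theta>)" using r \<theta> by simp
        then have "\<phi> (x + r *\<^sub>R \<theta>) = 0" "\<phi> x = 0"
          using n by (auto intro: out)
        then show ?thesis using False by simp
      qed
    qed
    also have "\<dots> = (L * V) * r"
      by (simp add: V_def)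
    finally show ?thesis .
  qed
  have two: "(LINT x|lborel. cmod (\<phi> (x + r *\<^sub>R \<theta>) - \<phi> x)) \<le> 2 * I" for r
  proof -
    have "(LINT x|lborel. cmod (\<phi> (x + r *\<^sub>R \<theta>) - \<phi> x)) \<le> (LINT x|lborel. cmod (\<phi> (x + r *\<^sub>R \<theta>)) + cmod (\<phi> x))"
      using i i' by (intro Bochner_Integration.integral_mono norm_triangle_ineq4) auto
    also have "\<dots> = (LINT x|lborel. cmod (\<phi> (x + r *\<^sub>R \<theta>))) + I"
      using i i' by (simp add: I_def)
    also have "(LINT x|lborel. cmod (\<phi> (x + r *\<^sub>R \<theta>))) = I"
      using integral_lborel_translate[of "\<lambda>x. cmod (\<phi> x)" "r *\<^sub>R \<theta>"] by (simp add: I_def add.commute)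
    finally show ?thesis by simp
  qed
  define C where "C = L * V + 2 * I + L + 2 * M"
  show ?thesis
  proof (intro exI[of _ C] allI impI conjI)
    fix r :: real assume r: "0 < r"
    show "(LINT x|lborel. cmod (\<phi> (x + r *\<^sub>R \<theta>) - \<phi> x)) \<le> C * min r 1"
    proof (cases "r \<le> 1")
      case True
      have "(L * V) * r \<le> C * r" using r L I0 M0 by (intro mult_right_mono) (auto simp: C_def)
      with one[OF r True] True show ?thesis by simp
    next
      case False
      have "2 * I \<le> C" using L V0 M0 by (auto simp: C_def)
      with two[of r] False show ?thesis by simp
    qed
    fix x
    show "cmod (\<phi> (x + r *\<^sub>R \<theta>) - \<phi> x) \<le> C * min r 1"
    proof (cases "r \<le> 1")
      case True
      have "L * r \<le> C * r" using r L I0 M0 V0 by (intro mult_right_mono) (auto simp: C_def)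
      then have "cmod (\<phi> (x + r *\<^sub>R \<theta>) - \<phi> x) \<le> C * r" using gL[of r x] r by linarith
      with True show ?thesis by simp
    next
      case False
      have "2 * M \<le> C" using L V0 I0 by (auto simp: C_def)
      with gM[of x r] False show ?thesis by simp
    qed
  qed
qed

text \<open>The function paired with u need not have compact support, but it is integrable and
  bounded, which is enough for Parseval's identity. The argument of \<open>ipow\<close> is negative
  since the adjoint translates forward along \<theta> instead of backward.\<close>

lemma RL_integral_adj_fourier:
  fixes \<phi> :: "real ^ 'n \<Rightarrow> complex"
  assumes s: "0 < s" "s < 1" and t: "test_function \<phi>" and \<theta>: "norm \<theta> = 1"
  defines "\<psi> \<equiv> RL_integral_adj (1 - s) \<theta> (\<lambda>y. frechet_derivative \<phi> (at y) \<theta>)"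
  shows "integrable lborel \<psi>" "square_integrable \<psi>"
    and "fou \<psi> \<xi> = - ipow s (- (\<theta> \<bullet> \<xi>)) * fou \<phi> \<xi>"
proof -
  obtain C where C: "\<And>r. 0 < r \<Longrightarrow> (LINT x|lborel. cmod (\<phi> (x + r *\<^sub>R \<theta>) - \<phi> x)) \<le> C * min r 1"
    "\<And>r x. 0 < r \<Longrightarrow> cmod (\<phi> (x + r *\<^sub>R \<theta>) - \<phi> x) \<le> C * min r 1"
    using translate_difference_L1[OF t \<theta>] by blast
  have i: "integrable lborel \<phi>" by (rule test_functionD(4)[OF t])
  have i': "integrable lborel (\<lambda>x. \<phi> (x + r *\<^sub>R \<theta>))" for r
    using integrable_lborel_affine[OF i, of 1 "r *\<^sub>R \<theta>"] by (simp add: add.commute)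
  have [measurable]: "\<phi> \<in> borel_measurable borel" using i by measurable
  define \<kappa> where "\<kappa> = s / Gamma (1 - s)"
  define k where "k r x = indicat_real {0<..} r *\<^sub>R (r powr (- s - 1)) *\<^sub>R (\<phi> (x + r *\<^sub>R \<theta>) - \<phi> x)" for r x
  have psi: "\<psi> x = of_real \<kappa> * (LINT r|lborel. k r x)" for x
    unfolding \<psi>_def \<kappa>_def k_def using RL_integral_adj_marchaud[OF s t \<theta>, of x] by (simp add: set_lebesgue_integral_def)
  have [measurable]: "case_prod k \<in> borel_measurable (lborel \<Otimes>\<^sub>M lborel)" unfolding k_def by measurable
  have G: "0 < Gamma (1 - s)" using s by (intro Gamma_real_pos) simp
  have kx: "integrable lborel (k r)" for r
    unfolding k_def using i i' by auto
  have min_int: "integrable lborel (\<lambda>r. indicat_real {0<..} r *\<^sub>R (C * (r powr (- s - 1) * min r 1)))"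
    using set_integrable_mult_right[OF set_integrable_powr_min[OF s], of C] by (auto simp: set_integrable_def)
  have kint: "integrable (lborel \<Otimes>\<^sub>M lborel) (case_prod k)"
  proof (rule lborel_pair.Fubini_integrable)
    show "integrable lborel (\<lambda>r. LINT x|lborel. norm (case_prod k (r, x)))"
    proof (rule Bochner_Integration.integrable_bound[OF min_int])
      show "(\<lambda>r. LINT x|lborel. norm (case_prod k (r, x))) \<in> borel_measurable lborel" by measurable
      show "AE r in lborel. norm (LINT x|lborel. norm (case_prod k (r, x))) \<le> norm (indicat_real {0<..} r *\<^sub>R (C * (r powr (- s - 1) * min r 1)))"
      proof (intro AE_I2)
        fix r :: real
        show "norm (LINT x|lborel. norm (case_prod k (r, x))) \<le> norm (indicat_real {0<..} r *\<^sub>R (C * (r powr (- s - 1) * min r 1)))"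
        proof (cases "0 < r")
          case True
          have "(LINT x|lborel. norm (case_prod k (r, x))) = r powr (- s - 1) * (LINT x|lborel. cmod (\<phi> (x + r *\<^sub>R \<theta>) - \<phi> x))"
            using True by (simp add: k_def)
          also have "\<dots> \<le> r powr (- s - 1) * (C * min r 1)" using C(1)[OF True] by (intro mult_left_mono) auto
          also have "\<dots> \<le> norm (indicat_real {0<..} r *\<^sub>R (C * (r powr (- s - 1) * min r 1)))"
            using True by (simp add: mult.left_commute)
          finally show ?thesis by (simp add: integral_nonneg_AE)
        qed (simp add: k_def)
      qed
    qed
    show "AE r in lborel. integrable lborel (\<lambda>x. case_prod k (r, x))" using kx by simp
  qed measurable
  have "integrable lborel (\<lambda>x. of_real \<kappa> * (LINT r|lborel. k r x))"
    by (intro integrable_mult_right lborel_pair.integrable_snd kint)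
  then show psi_int: "integrable lborel \<psi>" unfolding psi[abs_def] by simp
  show "square_integrable \<psi>"
  proof (rule integrable_square_integrable_bounded[OF psi_int])
    fix x
    have "cmod (LINT r|lborel. k r x) \<le> (LINT r|lborel. indicat_real {0<..} r *\<^sub>R (C * (r powr (- s - 1) * min r 1)))"
    proof (rule Bochner_Integration.integral_norm_bound_integral[OF _ min_int])
      show le: "norm (k r x) \<le> indicat_real {0<..} r *\<^sub>R (C * (r powr (- s - 1) * min r 1))" for r
        using mult_left_mono[OF C(2)[of r x], of "r powr (- s - 1)"] by (cases "0 < r") (auto simp: k_def mult.left_commute)
      show "integrable lborel (\<lambda>r. k r x)"
        using le by (intro Bochner_Integration.integrable_bound[OF min_int]) (auto intro!: AE_I2 order_trans[OF _ abs_ge_self])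
    qed
    then show "cmod (\<psi> x) \<le> \<bar>\<kappa>\<bar> * (LINT r|lborel. indicat_real {0<..} r *\<^sub>R (C * (r powr (- s - 1) * min r 1)))"
      unfolding psi norm_mult by (simp add: mult_left_mono)
  qed
  have kint2: "integrable (lborel \<Otimes>\<^sub>M lborel) (\<lambda>(r, x). k r x * cis (- (\<xi> \<bullet> x)))"
    using integrable_mult_cis[OF kint, of "\<lambda>z. - (\<xi> \<bullet> snd z)"] by (simp add: case_prod_beta')
  have inner: "(LINT x|lborel. k r x * cis (- (\<xi> \<bullet> x))) = indicat_real {0<..} r *\<^sub>R (r powr (- s - 1)) *\<^sub>R (cis (r * (\<theta> \<bullet> \<xi>)) - 1) * fou \<phi> \<xi>" for r
  proof -
    have "(LINT x|lborel. k r x * cis (- (\<xi> \<bullet> x))) = indicat_real {0<..} r *\<^sub>R (r powr (- s - 1)) *\<^sub>R fou (\<lambda>x. \<phi> (x + r *\<^sub>R \<theta>) - \<phi> x) \<xi>"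
      unfolding fou_def k_def by simp
    also have "fou (\<lambda>x. \<phi> (x + r *\<^sub>R \<theta>) - \<phi> x) \<xi> = fou (\<lambda>x. \<phi> (x + r *\<^sub>R \<theta>)) \<xi> - fou \<phi> \<xi>"
      by (rule fou_diff[OF i' i])
    also have "fou (\<lambda>x. \<phi> (x + r *\<^sub>R \<theta>)) \<xi> = cis (r * (\<theta> \<bullet> \<xi>)) * fou \<phi> \<xi>"
    proof -
      have "fou \<phi> \<xi> = (LINT x|lborel. \<phi> (r *\<^sub>R \<theta> + x) * cis (- (\<xi> \<bullet> (r *\<^sub>R \<theta> + x))))"
        unfolding fou_def by (rule integral_lborel_translate[symmetric]) measurable
      also have "\<dots> = (LINT x|lborel. cis (- (r * (\<theta> \<bullet> \<xi>))) * (\<phi> (x + r *\<^sub>R \<theta>) * cis (- (\<xi> \<bullet> x))))"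
      proof (intro Bochner_Integration.integral_cong refl)
        fix x
        have "cis (- (\<xi> \<bullet> (r *\<^sub>R \<theta> + x))) = cis (- (r * (\<theta> \<bullet> \<xi>))) * cis (- (\<xi> \<bullet> x))"
          by (simp add: cis_mult inner_add_right inner_commute[of \<theta>])
        then show "\<phi> (r *\<^sub>R \<theta> + x) * cis (- (\<xi> \<bullet> (r *\<^sub>R \<theta> + x))) = cis (- (r * (\<theta> \<bullet> \<xi>))) * (\<phi> (x + r *\<^sub>R \<theta>) * cis (- (\<xi> \<bullet> x)))"
          by (simp add: add.commute)
      qed
      also have "\<dots> = cis (- (r * (\<theta> \<bullet> \<xi>))) * fou (\<lambda>x. \<phi> (x + r *\<^sub>R \<theta>)) \<xi>"
        unfolding fou_def by simp
      finally have "cis (r * (\<theta> \<bullet> \<xi>)) * fou \<phi> \<xi> = (cis (r * (\<theta> \<bullet> \<xi>)) * cis (- (r * (\<theta> \<bullet> \<xi>)))) * fou (\<lambda>x. \<phi> (x + r *\<^sub>R \<theta>)) \<xi>"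
        by (simp add: mult.assoc)
      then show ?thesis by (simp add: cis_mult)
    qed
    finally show ?thesis by (simp add: algebra_simps)
  qed
  have "fou \<psi> \<xi> = of_real \<kappa> * (LINT x|lborel. LINT r|lborel. k r x * cis (- (\<xi> \<bullet> x)))"
    unfolding fou_def psi by (simp add: mult.assoc)
  also have "(LINT x|lborel. LINT r|lborel. k r x * cis (- (\<xi> \<bullet> x))) = (LINT r|lborel. LINT x|lborel. k r x * cis (- (\<xi> \<bullet> x)))"
    by (rule lborel_pair.Fubini_integral[OF kint2])
  also have "\<dots> = (LINT r:{0<..}|lborel. (r powr (- s - 1)) *\<^sub>R (cis (r * (\<theta> \<bullet> \<xi>)) - 1)) * fou \<phi> \<xi>"
    unfolding inner set_lebesgue_integral_def by (subst integral_mult_left_zero[symmetric]) simp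
  also have "\<dots> = - of_real (Gamma (1 - s) / s) * ipow s (- (\<theta> \<bullet> \<xi>)) * fou \<phi> \<xi>"
    by (subst integral_powr_cis[OF s]) simp
  \<comment> \<open>The normalisation s / Gamma(1 - s) cancels the constant of
    \<open>integral_powr_cis\<close>, leaving its sign.\<close>
  finally show "fou \<psi> \<xi> = - ipow s (- (\<theta> \<bullet> \<xi>)) * fou \<phi> \<xi>"
    using s G by (simp add: \<kappa>_def)
qed

lemma has_fourier_cong_AE_arg:
  assumes u: "square_integrable u" "has_fourier u U" and v: "square_integrable v" and eq: "AE x in lborel. u x = v x"
  shows "has_fourier v U"
proof (rule has_fourierI_weak[OF v has_fourier_square_integrable[OF u(2)]])
  fix \<phi> :: "real ^ 'a \<Rightarrow> complex" assume t: "test_function \<phi>"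
  have [measurable]: "u \<in> borel_measurable borel" "v \<in> borel_measurable borel" "\<phi> \<in> borel_measurable borel"
    using u v test_functionD(5)[OF t] by (auto simp: square_integrable_measurable)
  have "(LINT x|lborel. u x * fou \<phi> x) = (LINT x|lborel. v x * fou \<phi> x)"
    using eq by (intro integral_cong_AE) (auto elim: eventually_mono)
  then show "(LINT x|lborel. U x * \<phi> x) = (LINT x|lborel. v x * fou \<phi> x)"
    using has_fourier_test_function[OF u t] by simp
qed

text \<open>The distributional definition becomes a multiplier by duality. Parseval evaluates the
  adjoint symbol at - \<xi>, which changes the power of - i \<theta> \<bullet> \<xi> into that of i
  \<theta> \<bullet> \<xi>; the minus sign in the definition absorbs the remaining one.\<close>

lemma has_frac_deriv_iff:
  fixes u :: "real ^ 'n \<Rightarrow> complex"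
  assumes s: "0 < s" "s < 1" and \<theta>: "norm \<theta> = 1"
    and u: "square_integrable u" "has_fourier u U"
    and V: "square_integrable (\<lambda>\<xi>. ipow s (\<theta> \<bullet> \<xi>) * U \<xi>)"
  shows "has_frac_deriv s \<theta> u v \<longleftrightarrow> square_integrable v \<and> has_fourier v (\<lambda>\<xi>. ipow s (\<theta> \<bullet> \<xi>) * U \<xi>)"
proof -
  define \<psi> where "\<psi> \<phi> = RL_integral_adj (1 - s) \<theta> (\<lambda>y. frechet_derivative \<phi> (at y) \<theta>)" for \<phi>
  define V' where "V' \<xi> = ipow s (\<theta> \<bullet> \<xi>) * U \<xi>" for \<xi>
  define c :: complex where "c = (2 * pi) ^ CARD('n)"
  have c: "c \<noteq> 0" by (simp add: c_def)
  have key: "(LINT x|lborel. v x * \<phi> x) = - (LINT x|lborel. u x * \<psi> \<phi> x)"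
    if v: "square_integrable v" "has_fourier v V'" and t: "test_function \<phi>" for v \<phi>
  proof -
    note p = RL_integral_adj_fourier[OF s t \<theta>, folded \<psi>_def]
    have "c * (LINT x|lborel. v x * \<phi> x) = (LINT \<xi>|lborel. V' \<xi> * fou \<phi> (- \<xi>))"
      unfolding c_def
      by (rule has_fourier_parseval[symmetric, OF v test_functionD(5)[OF t] has_fourier_fou[OF test_functionD(4,5)[OF t]]])
    also have "\<dots> = - (LINT \<xi>|lborel. U \<xi> * fou (\<psi> \<phi>) (- \<xi>))"
      by (simp add: p(3) V'_def mult_ac)
    also have "(LINT \<xi>|lborel. U \<xi> * fou (\<psi> \<phi>) (- \<xi>)) = c * (LINT x|lborel. u x * \<psi> \<phi> x)"
      unfolding c_def by (rule has_fourier_parseval[OF u p(2) has_fourier_fou[OF p(1,2)]])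
    finally have "c * (LINT x|lborel. v x * \<phi> x) = c * - (LINT x|lborel. u x * \<psi> \<phi> x)" by simp
    then show ?thesis using c by (simp only: mult_cancel_left) simp
  qed
  \<comment> \<open>A function with the required transform exists and satisfies the distributional
    identity; any other solution is compared with it by the fundamental lemma.\<close>
  obtain v0 where v0: "square_integrable v0" "has_fourier v0 V'"
    using has_fourier_surj[OF V[folded V'_def]] by blast
  show ?thesis unfolding has_frac_deriv_def \<psi>_def[symmetric] V'_def[symmetric]
  proof safe
    assume v: "square_integrable v"
      and test: "\<forall>\<phi>. test_function \<phi> \<longrightarrow> (LINT x|lborel. v x * \<phi> x) = - (LINT x|lborel. u x * \<psi> \<phi> x)"
    have "AE x in lborel. v0 x - v x = 0"
    proof (rule AE_zero_of_test_functions)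
      show "square_integrable (\<lambda>x. v0 x - v x)" by (intro square_integrable_diff v v0)
      fix \<phi> :: "real ^ 'n \<Rightarrow> complex" assume t: "test_function \<phi>"
      note i = square_integrable_mult_integrable[OF v0(1) test_functionD(5)[OF t]] square_integrable_mult_integrable[OF v test_functionD(5)[OF t]]
      show "(LINT x|lborel. (v0 x - v x) * \<phi> x) = 0"
        using test[rule_format, OF t] key[OF v0 t] i by (simp add: left_diff_distrib)
    qed
    then show "has_fourier v V'" using has_fourier_cong_AE_arg[OF v0 v] by simp
  qed (use key in auto)
qed

section \<open>Surface measure\<close>

lemma borel_measurable_sgn_vec [measurable]: "sgn \<in> borel_measurable (borel :: (real ^ 'n) measure)"
  unfolding sgn_div_norm[abs_def] by measurable

lemma cone_density_measurable [measurable, simp]: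
  "(\<lambda>x. of_nat m * indicator (ball 0 1) x :: ennreal) \<in> borel_measurable (borel :: (real ^ 'n) measure)"
  by (intro borel_measurable_times_ennreal borel_measurable_indicator borel_measurable_const) auto

text \<open>Replacing the restricted space by a density on the whole space makes the invariance of
  Lebesgue measure and the neglect of the origin directly applicable.\<close>

lemma sphere_measure_eq:
  "(sphere_measure :: (real ^ 'n) measure) =
     distr (density lborel (\<lambda>x. of_nat CARD('n) * indicator (ball 0 1) x)) borel sgn"
proof (rule measure_eqI)
  show "sets (sphere_measure :: (real ^ 'n) measure) = sets (distr (density lborel (\<lambda>x. of_nat CARD('n) * indicator (ball 0 1) x)) borel sgn)"
    by (simp add: sphere_measure_def)
  fix A :: "(real ^ 'n) set" assume "A \<in> sets sphere_measure"
  then have A [measurable]: "A \<in> sets borel" by (simp add: sphere_measure_def)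
  have m: "sgn \<in> measurable (restrict_space lborel (ball 0 1)) (borel :: (real ^ 'n) measure)"
    by (rule measurable_restrict_space1) measurable
  have vA: "sgn -` A \<in> sets (borel :: (real ^ 'n) measure)"
    using measurable_sets[OF borel_measurable_sgn_vec A] by simp
  have "emeasure sphere_measure A = of_nat CARD('n) * emeasure (restrict_space lborel (ball 0 1)) (sgn -` A \<inter> ball 0 1)"
    by (simp add: sphere_measure_def emeasure_distr[OF m A] space_restrict_space)
  also have "emeasure (restrict_space lborel (ball 0 1)) (sgn -` A \<inter> ball 0 1) = emeasure lborel (sgn -` A \<inter> ball 0 1)"
    by (rule emeasure_restrict_space) auto
  also have "of_nat CARD('n) * \<dots> = (\<integral>\<^sup>+x. of_nat CARD('n) * indicator (sgn -` A \<inter> ball 0 1) x \<partial>lborel)"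
    using vA by (subst nn_integral_cmult_indicator) auto
  also have "\<dots> = (\<integral>\<^sup>+x. of_nat CARD('n) * indicator (ball 0 1) x * indicator (sgn -` A) x \<partial>lborel)"
    by (intro nn_integral_cong) (auto simp: indicator_def)
  also have "\<dots> = emeasure (distr (density lborel (\<lambda>x. of_nat CARD('n) * indicator (ball 0 1) x)) borel sgn) A"
    using vA by (simp add: emeasure_distr emeasure_density)
  finally show "emeasure sphere_measure A = emeasure (distr (density lborel (\<lambda>x. of_nat CARD('n) * indicator (ball 0 1) x)) borel sgn) A" .
qed

lemma sets_sphere_measure [measurable_cong, simp]: "sets sphere_measure = sets borel"
  by (simp add: sphere_measure_def)

lemma space_sphere_measure [simp]: "space sphere_measure = UNIV"
  by (simp add: sphere_measure_def space_scale_measure)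

lemma emeasure_sphere_measure_UNIV:
  "emeasure (sphere_measure :: (real ^ 'n) measure) UNIV = of_nat CARD('n) * emeasure lborel (ball (0 :: real ^ 'n) 1)"
  by (simp add: sphere_measure_eq emeasure_distr emeasure_density nn_integral_cmult_indicator)

lemma finite_measure_sphere: "finite_measure (sphere_measure :: (real ^ 'n) measure)"
proof (rule finite_measureI)
  show "emeasure (sphere_measure :: (real ^ 'n) measure) (space sphere_measure) \<noteq> \<infinity>"
    using emeasure_lborel_ball_finite[of "0 :: real ^ 'n" 1]
    by (simp add: emeasure_sphere_measure_UNIV ennreal_mult_eq_top_iff)
qed

interpretation sphere: finite_measure "sphere_measure :: (real ^ 'n) measure"
  by (rule finite_measure_sphere)

lemma AE_sphere_measure: "AE \<theta> in sphere_measure. norm \<theta> = 1"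
proof -
  have "AE x in density lborel (\<lambda>x::real ^ 'n. of_nat CARD('n) * indicator (ball 0 1) x). norm (sgn x) = 1"
    using AE_lborel_singleton[of "0 :: real ^ 'n"]
    by (subst AE_density) (auto elim!: eventually_mono simp: norm_sgn)
  then show ?thesis unfolding sphere_measure_eq by (subst AE_distr_iff) auto
qed

lemma sphere_measure_not_null: "\<not> (AE \<theta> in (sphere_measure :: (real ^ 'n) measure). False)"
proof
  assume "AE \<theta> in (sphere_measure :: (real ^ 'n) measure). False"
  then have "emeasure (sphere_measure :: (real ^ 'n) measure) UNIV = 0"
    by (subst (asm) AE_iff_measurable[of UNIV]) auto
  then have "emeasure lborel (ball (0 :: real ^ 'n) 1) = 0" by (simp add: emeasure_sphere_measure_UNIV)
  then have "ball (0 :: real ^ 'n) 1 \<in> null_sets lborel" by (intro null_setsI) auto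
  then have "negligible (ball (0 :: real ^ 'n) 1)"
    by (simp add: negligible_iff_null_sets null_sets_completionI)
  then show False using open_not_negligible[of "ball (0 :: real ^ 'n) 1"] by simp
qed

text \<open>Uniqueness of the translation invariant measure: both integrals below are compared with that of a
  Gaussian, which is invariant under \<open>T\<close>.\<close>

lemma nn_integral_lborel_orthogonal:
  fixes T :: "'a::euclidean_space \<Rightarrow> 'a"
  assumes T: "orthogonal_transformation T" and f [measurable]: "f \<in> borel_measurable borel"
  shows "(\<integral>\<^sup>+x. f (T x) \<partial>lborel) = (\<integral>\<^sup>+x. f x \<partial>lborel)"
proof -
  have lin: "linear T" using T by (rule orthogonal_transformation_linear)
  have [measurable]: "T \<in> borel_measurable borel"
    using lin by (intro borel_measurable_continuous_onI linear_continuous_on linear_conv_bounded_linear[THEN iffD1])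
  have nT: "norm (T x) = norm x" for x by (rule orthogonal_transformation_norm[OF T])
  define g where "g x = ennreal (exp (- 1 * (norm x)\<^sup>2))" for x :: 'a
  have [measurable]: "g \<in> borel_measurable borel" unfolding g_def by measurable
  have gT: "g (T x) = g x" for x by (simp add: g_def nT)
  have G: "(\<integral>\<^sup>+x. g x \<partial>lborel) = ennreal (sqrt (pi / 1) ^ DIM('a))"
    unfolding g_def using integral_gaussian[of 1, where 'a='a]
    by (subst nn_integral_eq_integral) auto
  have shift: "(\<integral>\<^sup>+x. h (t + x) \<partial>lborel) = (\<integral>\<^sup>+x. h x \<partial>lborel)" if "h \<in> borel_measurable borel" for h and t :: 'a
    using nn_integral_lborel_affine[OF that, of 1 t] by simp
  have refl: "(\<integral>\<^sup>+x. h (t - x) \<partial>lborel) = (\<integral>\<^sup>+x. h x \<partial>lborel)" if "h \<in> borel_measurable borel" for h and t :: 'a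
    using nn_integral_lborel_affine[OF that, of "-1" t] by simp
  have "(\<integral>\<^sup>+x. f (T x) \<partial>lborel) * (\<integral>\<^sup>+y. g y \<partial>lborel) = (\<integral>\<^sup>+x. \<integral>\<^sup>+y. f (T x) * g (T x + y) \<partial>lborel \<partial>lborel)"
    by (simp add: nn_integral_cmult nn_integral_multc shift)
  also have "\<dots> = (\<integral>\<^sup>+y. \<integral>\<^sup>+x. f (T x) * g (T x + y) \<partial>lborel \<partial>lborel)"
    by (rule lborel_pair.Fubini') measurable
  also have "\<dots> = (\<integral>\<^sup>+y. \<integral>\<^sup>+x. f (T x - y) * g (T x) \<partial>lborel \<partial>lborel)"
  proof (rule nn_integral_cong)
    fix y
    \<comment> \<open>Surjectivity writes y as T z, so translating x by z moves the shift y from g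
      to f. With g no longer shifted, its invariance under T can be used.\<close>
    obtain z where z: "y = T z" using orthogonal_transformation_surj[OF T] by (metis surjD)
    have "(\<integral>\<^sup>+x. f (T x - y) * g (T x) \<partial>lborel) = (\<integral>\<^sup>+x. f (T (z + x) - y) * g (T (z + x)) \<partial>lborel)"
      by (rule shift[symmetric]) measurable
    then show "(\<integral>\<^sup>+x. f (T x) * g (T x + y) \<partial>lborel) = (\<integral>\<^sup>+x. f (T x - y) * g (T x) \<partial>lborel)"
      by (simp add: linear_add[OF lin] z add.commute)
  qed
  also have "\<dots> = (\<integral>\<^sup>+x. \<integral>\<^sup>+y. f (T x - y) * g (T x) \<partial>lborel \<partial>lborel)"
    by (rule lborel_pair.Fubini') measurable
  also have "\<dots> = (\<integral>\<^sup>+x. f x \<partial>lborel) * (\<integral>\<^sup>+y. g y \<partial>lborel)"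
    by (simp add: nn_integral_cmult nn_integral_multc refl gT)
  finally show ?thesis
    unfolding G mult.commute[of _ "ennreal _"] by (subst (asm) ennreal_mult_cancel_left) auto
qed

text \<open>T commutes with \<open>sgn\<close> and preserves the unit ball, so the invariance of
  Lebesgue measure passes to the cone construction.\<close>

lemma distr_sphere_orthogonal:
  fixes T :: "real ^ 'n \<Rightarrow> real ^ 'n"
  assumes T: "orthogonal_transformation T"
  shows "distr sphere_measure borel T = sphere_measure"
proof -
  have lin: "linear T" using T by (rule orthogonal_transformation_linear)
  have Tm [measurable]: "T \<in> borel_measurable borel"
    using lin by (intro borel_measurable_continuous_onI linear_continuous_on linear_conv_bounded_linear[THEN iffD1])
  have nT: "norm (T x) = norm x" for x by (rule orthogonal_transformation_norm[OF T])
  have sT: "T (sgn x) = sgn (T x)" for x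
    using lin by (simp add: sgn_div_norm nT linear_cmul)
  show ?thesis
  proof (rule measure_eqI)
    fix A :: "(real ^ 'n) set" assume "A \<in> sets (distr sphere_measure borel T)"
    then have A [measurable]: "A \<in> sets borel" by simp
    have vA [measurable]: "sgn -` A \<in> sets (borel :: (real ^ 'n) measure)"
      using measurable_sets[OF borel_measurable_sgn_vec A] by simp
    have vTA: "T -` A \<in> sets borel" using measurable_sets[OF Tm A] by simp
    have vT: "sgn -` (T -` A) \<in> sets (borel :: (real ^ 'n) measure)"
      using measurable_sets[OF borel_measurable_sgn_vec vTA] by simp
    have em: "emeasure sphere_measure B = (\<integral>\<^sup>+x. of_nat CARD('n) * indicator (ball 0 1) x * indicator (sgn -` B) x \<partial>lborel)"
      if [measurable]: "B \<in> sets borel" for B :: "(real ^ 'n) set"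
      using measurable_sets[OF borel_measurable_sgn_vec that]
      by (simp add: sphere_measure_eq emeasure_distr emeasure_density)
    have "emeasure (distr sphere_measure borel T) A = emeasure sphere_measure (T -` A)"
      by (simp add: emeasure_distr)
    also have "\<dots> = (\<integral>\<^sup>+x. of_nat CARD('n) * indicator (ball 0 1) x * indicator (sgn -` (T -` A)) x \<partial>lborel)"
      by (rule em[OF vTA])
    also have "\<dots> = (\<integral>\<^sup>+x. of_nat CARD('n) * indicator (ball 0 1) (T x) * indicator (sgn -` A) (T x) \<partial>lborel)"
      by (intro nn_integral_cong) (auto simp: indicator_def sT nT)
    also have "\<dots> = (\<integral>\<^sup>+x. of_nat CARD('n) * indicator (ball 0 1) x * indicator (sgn -` A) x \<partial>lborel)"
      by (rule nn_integral_lborel_orthogonal[OF T, of "\<lambda>x. of_nat CARD('n) * indicator (ball 0 1) x * indicator (sgn -` A) x"])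
        (intro borel_measurable_times_ennreal cone_density_measurable borel_measurable_indicator vA)
    also have "\<dots> = emeasure sphere_measure A" by (simp only: em[OF A])
    finally show "emeasure (distr sphere_measure borel T) A = emeasure sphere_measure A" .
  qed simp
qed

lemma integral_sphere_orthogonal:
  fixes T :: "real ^ 'n \<Rightarrow> real ^ 'n" and f :: "real ^ 'n \<Rightarrow> 'b::{banach, second_countable_topology}"
  assumes T: "orthogonal_transformation T" and [measurable]: "f \<in> borel_measurable borel"
  shows "(LINT \<theta>|sphere_measure. f (T \<theta>)) = (LINT \<theta>|sphere_measure. f \<theta>)"
proof -
  have "linear T" using T by (rule orthogonal_transformation_linear)
  then have [measurable]: "T \<in> borel_measurable borel"
    by (intro borel_measurable_continuous_onI linear_continuous_on linear_conv_bounded_linear[THEN iffD1])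
  have "(LINT \<theta>|distr sphere_measure borel T. f \<theta>) = (LINT \<theta>|sphere_measure. f (T \<theta>))"
    by (rule integral_distr) measurable
  then show ?thesis by (simp add: distr_sphere_orthogonal[OF T])
qed

lemma integrable_sphere_bounded:
  fixes f :: "real ^ 'n \<Rightarrow> 'b::{banach, second_countable_topology}"
  assumes "f \<in> borel_measurable borel" "\<And>\<theta>. norm \<theta> = 1 \<Longrightarrow> norm (f \<theta>) \<le> B"
  shows "integrable sphere_measure f"
  using AE_sphere_measure assms
  by (intro sphere.integrable_const_bound[of _ B]) (auto elim!: eventually_mono)

text \<open>For v = 0 this is the identity, so reflecting in a vector that may turn out to vanish
  requires no separate case.\<close>

definition reflection :: "'a::real_inner \<Rightarrow> 'a \<Rightarrow> 'a" where
  "reflection v x = x - (2 * (x \<bullet> v) / (v \<bullet> v)) *\<^sub>R v"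

lemma orthogonal_transformation_reflection:
  fixes v :: "'a::euclidean_space"
  shows "orthogonal_transformation (reflection v)"
proof -
  have "linear (reflection v)"
    by (rule linearI) (auto simp: reflection_def algebra_simps inner_add_left add_divide_distrib)
  moreover have "reflection v x \<bullet> reflection v y = x \<bullet> y" for x y
  proof (cases "v = 0")
    case False
    define k where "k z = (z \<bullet> v) / (v \<bullet> v)" for z
    have k: "z \<bullet> v = k z * (v \<bullet> v)" "v \<bullet> z = k z * (v \<bullet> v)" for z
      using False by (simp_all add: k_def inner_commute)
    have "reflection v z = z - (2 * k z) *\<^sub>R v" for z by (simp add: reflection_def k_def)
    note refl = this
    show ?thesis unfolding refl
      by (simp add: inner_diff_left inner_diff_right k(1)[of x] k(2)[of y] algebra_simps)
  qed (simp add: reflection_def)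
  ultimately show ?thesis by (simp add: orthogonal_transformation_def)
qed

lemma powr_abs_inner_le:
  assumes "0 < s" "norm \<theta> = 1"
  shows "\<bar>\<theta> \<bullet> \<xi>\<bar> powr s \<le> norm \<xi> powr s"
  using Cauchy_Schwarz_ineq2[of \<theta> \<xi>] assms by (intro powr_mono2) auto

section \<open>Symbols of the gradient and the divergence\<close>

text \<open>What is left of the symbol of the gradient: the odd part of (i y)^s is i sin(pi s / 2)
  |y|^s sgn y, and the even part integrates to 0 against \<theta>. Being a real vector, the moment
  admits a Euclidean symmetry argument.\<close>

definition sphere_moment :: "real \<Rightarrow> real ^ 'n \<Rightarrow> real ^ 'n" where
  "sphere_moment s \<xi> = (LINT \<theta>|sphere_measure. (\<bar>\<theta> \<bullet> \<xi>\<bar> powr s * sgn (\<theta> \<bullet> \<xi>)) *\<^sub>R \<theta>)"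

lemma integrable_sphere_moment:
  assumes "0 < s"
  shows "integrable sphere_measure (\<lambda>\<theta>. (\<bar>\<theta> \<bullet> \<xi>\<bar> powr s * sgn (\<theta> \<bullet> \<xi>)) *\<^sub>R \<theta>)"
proof (rule integrable_sphere_bounded[where B="norm \<xi> powr s"])
  fix \<theta> :: "real ^ 'a" assume \<theta>: "norm \<theta> = 1"
  have "\<bar>sgn (\<theta> \<bullet> \<xi>)\<bar> \<le> 1" by (simp add: abs_sgn_eq)
  from mult_mono[OF powr_abs_inner_le[OF assms \<theta>, of \<xi>] this]
  show "norm ((\<bar>\<theta> \<bullet> \<xi>\<bar> powr s * sgn (\<theta> \<bullet> \<xi>)) *\<^sub>R \<theta>) \<le> norm \<xi> powr s"
    by (simp add: abs_mult \<theta>)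
qed measurable

lemma sphere_moment_orthogonal:
  fixes T :: "real ^ 'n \<Rightarrow> real ^ 'n"
  assumes s: "0 < s" and T: "orthogonal_transformation T"
  shows "sphere_moment s (T \<xi>) = T (sphere_moment s \<xi>)"
proof -
  have bl: "bounded_linear T"
    using orthogonal_transformation_linear[OF T] by (simp add: linear_conv_bounded_linear)
  have "sphere_moment s (T \<xi>) = (LINT \<theta>|sphere_measure. (\<bar>T \<theta> \<bullet> T \<xi>\<bar> powr s * sgn (T \<theta> \<bullet> T \<xi>)) *\<^sub>R T \<theta>)"
    unfolding sphere_moment_def by (rule integral_sphere_orthogonal[OF T, symmetric]) measurable
  also have "\<dots> = (LINT \<theta>|sphere_measure. T ((\<bar>\<theta> \<bullet> \<xi>\<bar> powr s * sgn (\<theta> \<bullet> \<xi>)) *\<^sub>R \<theta>))"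
    using T by (simp add: orthogonal_transformation_def linear_cmul)
  also have "\<dots> = T (sphere_moment s \<xi>)"
    unfolding sphere_moment_def by (rule integral_bounded_linear[OF bl integrable_sphere_moment[OF s]])
  finally show ?thesis .
qed

text \<open>The reflection in the component orthogonal to \<open>\<xi>\<close> fixes \<open>\<xi>\<close>, hence also the moment.\<close>

lemma sphere_moment_parallel:
  fixes \<xi> :: "real ^ 'n"
  assumes s: "0 < s"
  shows "sphere_moment s \<xi> = ((sphere_moment s \<xi> \<bullet> \<xi>) / (\<xi> \<bullet> \<xi>)) *\<^sub>R \<xi>"
proof (cases "\<xi> = 0")
  case True
  then show ?thesis by (simp add: sphere_moment_def)
next
  case False
  define b where "b = sphere_moment s \<xi>"
  define v where "v = b - ((b \<bullet> \<xi>) / (\<xi> \<bullet> \<xi>)) *\<^sub>R \<xi>"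
  have v\<xi>: "\<xi> \<bullet> v = 0" using False by (simp add: v_def inner_diff_right inner_commute)
  then have "reflection v \<xi> = \<xi>" by (simp add: reflection_def)
  then have "b = reflection v b"
    using sphere_moment_orthogonal[OF s orthogonal_transformation_reflection, of v \<xi>] by (simp add: b_def)
  \<comment> \<open>A vector fixed by the reflection in v has no component along v, whereas by
    construction the component of b orthogonal to \<xi> is v itself.\<close>
  then have "v = 0 \<or> b \<bullet> v = 0" by (auto simp: reflection_def)
  moreover have "b = v + ((b \<bullet> \<xi>) / (\<xi> \<bullet> \<xi>)) *\<^sub>R \<xi>" by (simp add: v_def)
  then have "b \<bullet> v = v \<bullet> v" using v\<xi> by (metis add_0_right inner_add_left inner_scaleR_left mult_zero_right)
  ultimately have "v = 0" by auto
  then show ?thesis by (simp add: v_def b_def)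
qed

text \<open>This is \<kappa>. The coordinate is arbitrary, since by rotation invariance every unit
  vector gives the same value.\<close>

definition sphere_const :: "'n::finite itself \<Rightarrow> real \<Rightarrow> real" where
  "sphere_const _ s = (LINT \<theta>|sphere_measure. \<bar>\<theta> \<bullet> (axis undefined 1 :: real ^ 'n)\<bar> powr (1 + s))"

lemma sphere_const_eq:
  fixes e :: "real ^ 'n"
  assumes "norm e = 1"
  shows "(LINT \<theta>|sphere_measure. \<bar>\<theta> \<bullet> e\<bar> powr (1 + s)) = sphere_const TYPE('n) s"
proof -
  obtain T :: "real ^ 'n \<Rightarrow> real ^ 'n" where T: "orthogonal_transformation T" "T (axis undefined 1) = e"
    using orthogonal_transformation_exists[of "axis undefined 1" e] assms by auto
  have "(LINT \<theta>|sphere_measure. \<bar>\<theta> \<bullet> e\<bar> powr (1 + s)) = (LINT \<theta>|sphere_measure. \<bar>T \<theta> \<bullet> e\<bar> powr (1 + s))"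
    by (rule integral_sphere_orthogonal[OF T(1), symmetric]) measurable
  moreover have "T \<theta> \<bullet> e = \<theta> \<bullet> axis undefined 1" for \<theta>
    using T by (metis orthogonal_transformation_def)
  ultimately show ?thesis by (simp add: sphere_const_def)
qed

text \<open>If \<kappa> were 0, every coordinate of \<theta> would vanish almost everywhere,
  although |\<theta>| = 1 almost everywhere and the measure is not zero.\<close>

lemma sphere_const_pos:
  assumes s: "0 < s"
  shows "0 < sphere_const TYPE('n::finite) s"
proof -
  have nn: "0 \<le> sphere_const TYPE('n) s" unfolding sphere_const_def by (intro integral_nonneg_AE) auto
  moreover have "sphere_const TYPE('n) s \<noteq> 0"
  proof
    assume 0: "sphere_const TYPE('n) s = 0"
    have "AE \<theta> in sphere_measure. \<theta> \<bullet> (axis i 1 :: real ^ 'n) = 0" for i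
    proof -
      have ax: "norm (axis i 1 :: real ^ 'n) = 1" by simp
      have "integrable sphere_measure (\<lambda>\<theta>. \<bar>\<theta> \<bullet> (axis i 1 :: real ^ 'n)\<bar> powr (1 + s))"
      proof (rule integrable_sphere_bounded[where B="norm (axis i 1 :: real ^ 'n) powr (1 + s)"])
        fix \<theta> :: "real ^ 'n" assume "norm \<theta> = 1"
        from powr_abs_inner_le[OF _ this, of "1 + s" "axis i 1"] s
        show "norm (\<bar>\<theta> \<bullet> axis i 1\<bar> powr (1 + s)) \<le> norm (axis i 1 :: real ^ 'n) powr (1 + s)" by simp
      qed measurable
      then have "AE \<theta> in sphere_measure. \<bar>\<theta> \<bullet> (axis i 1 :: real ^ 'n)\<bar> powr (1 + s) = 0"
        using 0 sphere_const_eq[OF ax, of s] by (intro integral_nonneg_eq_0_iff_AE[THEN iffD1]) auto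
      then show ?thesis by (auto elim!: eventually_mono)
    qed
    then have "AE \<theta> in sphere_measure. \<forall>i\<in>UNIV. \<theta> \<bullet> (axis i 1 :: real ^ 'n) = 0"
      by (intro AE_finite_allI) auto
    with AE_sphere_measure have "AE \<theta> in (sphere_measure :: (real ^ 'n) measure). False"
    proof eventually_elim
      case (elim \<theta>)
      then have "\<theta> = 0" by (simp add: vec_eq_iff inner_axis)
      with elim show False by simp
    qed
    then show False using sphere_measure_not_null by blast
  qed
  ultimately show ?thesis by simp
qed

text \<open>The moment is parallel to \<xi>, so its inner product with \<xi> gives its length. There
  |y|^s sgn y meets another factor y, whence the exponent 1 + s in \<kappa>.\<close>

lemma norm_sphere_moment:
  fixes \<xi> :: "real ^ 'n"
  assumes s: "0 < s"
  shows "(norm (sphere_moment s \<xi>))\<^sup>2 = (sphere_const TYPE('n) s)\<^sup>2 * norm \<xi> powr (2 * s)"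
proof (cases "\<xi> = 0")
  case True
  then show ?thesis by (simp add: sphere_moment_def)
next
  case False
  define r where "r = norm \<xi>"
  have r: "0 < r" using False by (simp add: r_def)
  define e where "e = (1 / r) *\<^sub>R \<xi>"
  have e: "norm e = 1" "\<xi> = r *\<^sub>R e" using r by (auto simp: e_def r_def)
  have "sphere_moment s \<xi> \<bullet> \<xi> = (LINT \<theta>|sphere_measure. ((\<bar>\<theta> \<bullet> \<xi>\<bar> powr s * sgn (\<theta> \<bullet> \<xi>)) *\<^sub>R \<theta>) \<bullet> \<xi>)"
    unfolding sphere_moment_def
    by (rule integral_inner_left[symmetric]) (use integrable_sphere_moment[OF s] in auto)
  also have "\<dots> = (LINT \<theta>|sphere_measure. r powr (1 + s) * \<bar>\<theta> \<bullet> e\<bar> powr (1 + s))"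
  proof (intro Bochner_Integration.integral_cong refl)
    fix \<theta> :: "real ^ 'n"
    have "((\<bar>\<theta> \<bullet> \<xi>\<bar> powr s * sgn (\<theta> \<bullet> \<xi>)) *\<^sub>R \<theta>) \<bullet> \<xi> = \<bar>\<theta> \<bullet> \<xi>\<bar> powr s * \<bar>\<theta> \<bullet> \<xi>\<bar>"
      by (simp add: abs_sgn)
    also have "\<dots> = \<bar>\<theta> \<bullet> \<xi>\<bar> powr (1 + s)"
      by (cases "\<theta> \<bullet> \<xi> = 0") (auto simp: powr_add)
    also have "\<dots> = (r * \<bar>\<theta> \<bullet> e\<bar>) powr (1 + s)" using r by (simp add: e(2) abs_mult)
    also have "(r * \<bar>\<theta> \<bullet> e\<bar>) powr (1 + s) = r powr (1 + s) * \<bar>\<theta> \<bullet> e\<bar> powr (1 + s)"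
      using r by (simp add: powr_mult)
    finally show "((\<bar>\<theta> \<bullet> \<xi>\<bar> powr s * sgn (\<theta> \<bullet> \<xi>)) *\<^sub>R \<theta>) \<bullet> \<xi> = r powr (1 + s) * \<bar>\<theta> \<bullet> e\<bar> powr (1 + s)" .
  qed
  also have "\<dots> = r powr (1 + s) * sphere_const TYPE('n) s"
    by (simp add: sphere_const_eq[OF e(1)])
  finally have dot: "sphere_moment s \<xi> \<bullet> \<xi> = r powr (1 + s) * sphere_const TYPE('n) s" .
  have "norm (sphere_moment s \<xi>) = \<bar>(sphere_moment s \<xi> \<bullet> \<xi>) / (\<xi> \<bullet> \<xi>)\<bar> * r"
    using arg_cong[OF sphere_moment_parallel[OF s, of \<xi>], of norm] by (simp add: r_def)
  also have "\<xi> \<bullet> \<xi> = r * r" by (simp add: r_def power2_norm_eq_inner[symmetric] power2_eq_square)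
  also have "\<bar>(sphere_moment s \<xi> \<bullet> \<xi>) / (r * r)\<bar> * r = r powr s * sphere_const TYPE('n) s"
    using r sphere_const_pos[OF s, where 'n='n] by (simp add: dot powr_add)
  finally have "(norm (sphere_moment s \<xi>))\<^sup>2 = (r powr s)\<^sup>2 * (sphere_const TYPE('n) s)\<^sup>2"
    by (simp add: power_mult_distrib)
  also have "(r powr s)\<^sup>2 = r powr (2 * s)" by (simp add: power2_eq_square powr_add[symmetric])
  finally show ?thesis by (simp add: r_def mult.commute)
qed

lemma ipow_measurable [measurable]: "ipow s \<in> borel_measurable borel"
  unfolding ipow_def[abs_def] by measurable

lemma norm_ipow: "cmod (ipow s y) = \<bar>y\<bar> powr s"
  by (simp add: ipow_def norm_mult)

lemma ipow_eq:
  "ipow s y = of_real (\<bar>y\<bar> powr s) * cos (pi * s / 2) + \<i> * (of_real (\<bar>y\<bar> powr s * sgn y) * sin (pi * s / 2))"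
  by (cases y "0::real" rule: linorder_cases) (auto simp: ipow_def complex_eq_iff)

definition sphere_multiplier :: "real \<Rightarrow> 'n \<Rightarrow> real ^ 'n \<Rightarrow> complex" where
  "sphere_multiplier s j \<xi> = (LINT \<theta>|sphere_measure. of_real (\<theta> $ j) * ipow s (\<theta> \<bullet> \<xi>))"

lemma integrable_sphere_multiplier:
  assumes "0 < s"
  shows "integrable sphere_measure (\<lambda>\<theta>. of_real (\<theta> $ j) * ipow s (\<theta> \<bullet> \<xi>))"
proof (rule integrable_sphere_bounded[where B="norm \<xi> powr s"])
  fix \<theta> :: "real ^ 'a" assume \<theta>: "norm \<theta> = 1"
  have "\<bar>\<theta> $ j\<bar> \<le> 1" using component_le_norm_cart[of \<theta> j] \<theta> by simp
  then show "norm (of_real (\<theta> $ j) * ipow s (\<theta> \<bullet> \<xi>)) \<le> norm \<xi> powr s"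
    using mult_mono[OF _ powr_abs_inner_le[OF assms \<theta>, of \<xi>], of "\<bar>\<theta> $ j\<bar>" 1] by (simp add: norm_mult norm_ipow)
qed measurable

lemma sphere_multiplier_eq:
  assumes s: "0 < s"
  shows "sphere_multiplier s j \<xi> = \<i> * of_real (sin (pi * s / 2) * sphere_moment s \<xi> $ j)"
proof -
  \<comment> \<open>The moment of the even part of (i y)^s; the map sending \<theta> to - \<theta>
    is orthogonal and reverses its sign.\<close>
  define E where "E = (LINT \<theta>|sphere_measure. \<theta> $ j * \<bar>\<theta> \<bullet> \<xi>\<bar> powr s)"
  have "E = (LINT \<theta>|sphere_measure. (- \<theta>) $ j * \<bar>(- \<theta>) \<bullet> \<xi>\<bar> powr s)"
    unfolding E_def
    by (rule integral_sphere_orthogonal[symmetric]) (auto simp: orthogonal_transformation_neg orthogonal_transformation_id)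
  then have "E = - E" unfolding E_def by simp
  then have E: "E = 0" by simp
  have i1: "integrable sphere_measure (\<lambda>\<theta>. \<theta> $ j * \<bar>\<theta> \<bullet> \<xi>\<bar> powr s)"
  proof (rule integrable_sphere_bounded[where B="norm \<xi> powr s"])
    fix \<theta> :: "real ^ 'a" assume \<theta>: "norm \<theta> = 1"
    have "\<bar>\<theta> $ j\<bar> \<le> 1" using component_le_norm_cart[of \<theta> j] \<theta> by simp
    then show "norm (\<theta> $ j * \<bar>\<theta> \<bullet> \<xi>\<bar> powr s) \<le> norm \<xi> powr s"
      using mult_mono[OF _ powr_abs_inner_le[OF s \<theta>, of \<xi>], of "\<bar>\<theta> $ j\<bar>" 1] by (simp add: abs_mult)
  qed measurable
  have mj: "sphere_moment s \<xi> $ j = (LINT \<theta>|sphere_measure. ((\<bar>\<theta> \<bullet> \<xi>\<bar> powr s * sgn (\<theta> \<bullet> \<xi>)) *\<^sub>R \<theta>) $ j)"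
    unfolding sphere_moment_def
    by (rule integral_bounded_linear[OF bounded_linear_vec_nth integrable_sphere_moment[OF s], symmetric])
  have i2: "integrable sphere_measure (\<lambda>\<theta>. ((\<bar>\<theta> \<bullet> \<xi>\<bar> powr s * sgn (\<theta> \<bullet> \<xi>)) *\<^sub>R \<theta>) $ j)"
    by (rule integrable_bounded_linear[OF bounded_linear_vec_nth integrable_sphere_moment[OF s]])
  have "sphere_multiplier s j \<xi> = (LINT \<theta>|sphere_measure. of_real (cos (pi * s / 2)) * of_real (\<theta> $ j * \<bar>\<theta> \<bullet> \<xi>\<bar> powr s)
     + \<i> * of_real (sin (pi * s / 2)) * of_real (((\<bar>\<theta> \<bullet> \<xi>\<bar> powr s * sgn (\<theta> \<bullet> \<xi>)) *\<^sub>R \<theta>) $ j))"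
    unfolding sphere_multiplier_def ipow_eq by (intro Bochner_Integration.integral_cong) (auto simp: algebra_simps)
  also have "\<dots> = of_real (cos (pi * s / 2)) * of_real E + \<i> * of_real (sin (pi * s / 2)) * of_real (sphere_moment s \<xi> $ j)"
    unfolding E_def mj using i1 i2
    by (subst Bochner_Integration.integral_add) (simp_all only: integral_mult_right_zero integral_complex_of_real integrable_mult_right integrable_of_real)
  finally show ?thesis by (simp add: E)
qed

text \<open>This is D_{n,s}; the minus sign is the square of the factor i in
  \<open>sphere_multiplier_eq\<close>.\<close>

definition grad_div_const :: "'n::finite itself \<Rightarrow> real \<Rightarrow> real" where
  "grad_div_const N s = - ((sin (pi * s / 2))\<^sup>2 * (sphere_const N s)\<^sup>2)"

lemma grad_div_const_neg:
  assumes "0 < s" "s < 1"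
  shows "grad_div_const TYPE('n::finite) s < 0"
proof -
  have "pi * s < pi * 2" using assms by (intro mult_strict_left_mono) auto
  then have "0 < sin (pi * s / 2)" using assms by (intro sin_gt_zero) auto
  then show ?thesis using sphere_const_pos[OF assms(1), where 'n='n] by (simp add: grad_div_const_def)
qed

lemma sum_sphere_multiplier_square:
  fixes \<xi> :: "real ^ 'n"
  assumes s: "0 < s"
  shows "(\<Sum>j\<in>UNIV. (sphere_multiplier s j \<xi>)\<^sup>2) = of_real (grad_div_const TYPE('n) s * norm \<xi> powr (2 * s))"
proof -
  have "(\<Sum>j\<in>UNIV. (sphere_multiplier s j \<xi>)\<^sup>2) = of_real (- ((sin (pi * s / 2))\<^sup>2 * (\<Sum>j\<in>UNIV. (sphere_moment s \<xi> $ j)\<^sup>2)))"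
    unfolding sphere_multiplier_eq[OF s]
    by (simp add: power_mult_distrib sum_distrib_left sum_negf)
  also have "(\<Sum>j\<in>UNIV. (sphere_moment s \<xi> $ j)\<^sup>2) = (norm (sphere_moment s \<xi>))\<^sup>2"
    unfolding power2_norm_eq_inner inner_vec_def by (simp add: power2_eq_square)
  finally show ?thesis by (simp add: norm_sphere_moment[OF s] grad_div_const_def mult.assoc)
qed

text \<open>The inner product \<theta> \<bullet> \<theta>' is a sum of separated products, so the
  double integral factors into the squares of the components of the symbol.\<close>

lemma sphere_double_integral:
  fixes \<xi> :: "real ^ 'n"
  assumes s: "0 < s"
  shows "(LINT \<theta>|sphere_measure. LINT \<theta>'|sphere_measure.
      of_real (\<theta> \<bullet> \<theta>') * ipow s (\<theta> \<bullet> \<xi>) * ipow s (\<theta>' \<bullet> \<xi>))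
    = of_real (grad_div_const TYPE('n) s * norm \<xi> powr (2 * s))"
proof -
  note i = integrable_sphere_multiplier[OF s]
  have ii: "integrable sphere_measure (\<lambda>\<theta>. c * (of_real (\<theta> $ j) * ipow s (\<theta> \<bullet> \<xi>)))"
    and ij: "integrable sphere_measure (\<lambda>\<theta>. of_real (\<theta> $ j) * ipow s (\<theta> \<bullet> \<xi>) * c)" for c j
    by (rule integrable_mult_right[OF i], rule integrable_mult_left[OF i])
  have "(LINT \<theta>'|sphere_measure. of_real (\<theta> \<bullet> \<theta>') * ipow s (\<theta> \<bullet> \<xi>) * ipow s (\<theta>' \<bullet> \<xi>))
     = (\<Sum>j\<in>UNIV. (of_real (\<theta> $ j) * ipow s (\<theta> \<bullet> \<xi>)) * sphere_multiplier s j \<xi>)" for \<theta>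
  proof -
    have "(LINT \<theta>'|sphere_measure. of_real (\<theta> \<bullet> \<theta>') * ipow s (\<theta> \<bullet> \<xi>) * ipow s (\<theta>' \<bullet> \<xi>))
      = (LINT \<theta>'|sphere_measure. (\<Sum>j\<in>UNIV. (of_real (\<theta> $ j) * ipow s (\<theta> \<bullet> \<xi>)) * (of_real (\<theta>' $ j) * ipow s (\<theta>' \<bullet> \<xi>))))"
      by (intro Bochner_Integration.integral_cong refl)
        (simp add: inner_vec_def sum_distrib_right sum_distrib_left mult_ac)
    also have "\<dots> = (\<Sum>j\<in>UNIV. (of_real (\<theta> $ j) * ipow s (\<theta> \<bullet> \<xi>)) * sphere_multiplier s j \<xi>)"
      unfolding sphere_multiplier_def
      by (subst Bochner_Integration.integral_sum) (simp_all only: ii integral_mult_right_zero)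
    finally show ?thesis .
  qed
  then have "(LINT \<theta>|sphere_measure. LINT \<theta>'|sphere_measure. of_real (\<theta> \<bullet> \<theta>') * ipow s (\<theta> \<bullet> \<xi>) * ipow s (\<theta>' \<bullet> \<xi>))
     = (LINT \<theta>|sphere_measure. (\<Sum>j\<in>UNIV. (of_real (\<theta> $ j) * ipow s (\<theta> \<bullet> \<xi>)) * sphere_multiplier s j \<xi>))" by simp
  also have "\<dots> = (\<Sum>j\<in>UNIV. (sphere_multiplier s j \<xi>)\<^sup>2)"
    unfolding power2_eq_square
    by (subst Bochner_Integration.integral_sum) (simp_all only: ij integral_mult_left_zero sphere_multiplier_def)
  finally show ?thesis by (simp add: sum_sphere_multiplier_square[OF s])
qed

section \<open>The kernel of the fractional Laplacian\<close>

lemma nn_integral_powr_exp: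
  assumes a: "0 < a" and r: "0 < (r::real)"
  shows "(\<integral>\<^sup>+t. ennreal (indicator {0<..} t * (t powr (a - 1) * exp (- (r * t)))) \<partial>lborel) = ennreal (Gamma a * r powr (- a))"
proof -
  define X where "X = (\<integral>\<^sup>+t. ennreal (indicator {0<..} t * (t powr (a - 1) * exp (- (r * t)))) \<partial>lborel)"
  have "ennreal (Gamma a) = (\<integral>\<^sup>+t. ennreal (indicator {0..} t * t powr (a - 1) / exp t) \<partial>lborel)"
    by (rule Gamma_conv_nn_integral_real[OF a])
  also have "\<dots> = (\<integral>\<^sup>+t. ennreal (indicator {0<..} t * t powr (a - 1) / exp t) \<partial>lborel)"
    using AE_lborel_singleton[of "0::real"] by (intro nn_integral_cong_AE) (auto elim!: eventually_mono simp: indicator_def)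
  also have "\<dots> = ennreal \<bar>r\<bar> * (\<integral>\<^sup>+t. ennreal (indicator {0<..} (0 + r * t) * (0 + r * t) powr (a - 1) / exp (0 + r * t)) \<partial>lborel)"
    using r by (intro nn_integral_real_affine) auto
  also have "(\<lambda>t. ennreal (indicator {0<..} (0 + r * t) * (0 + r * t) powr (a - 1) / exp (0 + r * t)))
     = (\<lambda>t. ennreal (r powr (a - 1)) * ennreal (indicator {0<..} t * (t powr (a - 1) * exp (- (r * t)))))"
    using r by (auto simp: fun_eq_iff ennreal_mult[symmetric] indicator_def zero_less_mult_iff powr_mult exp_minus field_simps)
  also have "ennreal \<bar>r\<bar> * (\<integral>\<^sup>+t. ennreal (r powr (a - 1)) * ennreal (indicator {0<..} t * (t powr (a - 1) * exp (- (r * t)))) \<partial>lborel)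
     = ennreal r * (ennreal (r powr (a - 1)) * X)"
    unfolding X_def using r by (subst nn_integral_cmult) auto
  also have "\<dots> = ennreal (r powr a) * X"
    using r by (simp add: mult.assoc[symmetric] ennreal_mult[symmetric] powr_diff)
  finally have "ennreal (r powr (- a)) * ennreal (Gamma a) = (ennreal (r powr (- a)) * ennreal (r powr a)) * X"
    by (simp add: mult.assoc)
  also have "ennreal (r powr (- a)) * ennreal (r powr a) = 1"
    using r by (simp add: ennreal_mult[symmetric] powr_add[symmetric])
  finally show ?thesis
    using a by (simp add: X_def ennreal_mult[symmetric] mult.commute Gamma_real_nonneg)
qed

text \<open>Write 1 - exp(- b / t) as the integral of b exp(- b r) over r between 0 and 1 / t. The
  region t r \<le> 1 is symmetric in both variables; in the other order the inner integral is a
  power of r and the outer one a Gamma integral at 1 - s.\<close>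

lemma nn_integral_powr_one_minus_exp:
  assumes s: "0 < s" "s < 1" and b: "0 < (b::real)"
  shows "(\<integral>\<^sup>+t. ennreal (indicator {0<..} t * (t powr (s - 1) * (1 - exp (- (b / t))))) \<partial>lborel)
     = ennreal (b powr s * (Gamma (1 - s) / s))"
proof -
  have G: "0 < 1 - s" using s by simp
  define h where "h t r = ennreal (indicator {0<..} t * indicator {0<..} r * (if t * r \<le> 1 then 1 else 0) * (t powr (s - 1) * (b * exp (- (b * r)))))" for t r :: real
  have hm [measurable]: "(\<lambda>(t, r). h t r) \<in> borel_measurable (lborel \<Otimes>\<^sub>M lborel)" unfolding h_def by measurable
  have "ennreal (indicator {0<..} t * (t powr (s - 1) * (1 - exp (- (b / t))))) = (\<integral>\<^sup>+r. h t r \<partial>lborel)" for t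
  proof (cases "0 < t")
    case True
    have "(\<integral>\<^sup>+r. ennreal (b * exp (- (b * r))) * indicator {0..1 / t} r \<partial>lborel) = ennreal (- exp (- (b * (1 / t))) - - exp (- (b * 0)))"
      using True b by (intro nn_integral_FTC_Icc) (auto intro!: derivative_eq_intros)
    then have "ennreal (t powr (s - 1) * (1 - exp (- (b / t)))) = ennreal (t powr (s - 1)) * (\<integral>\<^sup>+r. ennreal (b * exp (- (b * r))) * indicator {0..1 / t} r \<partial>lborel)"
      using True b by (simp add: ennreal_mult[symmetric])
    also have "\<dots> = (\<integral>\<^sup>+r. ennreal (t powr (s - 1)) * (ennreal (b * exp (- (b * r))) * indicator {0..1 / t} r) \<partial>lborel)"
      by (rule nn_integral_cmult[symmetric]) measurable
    also have "\<dots> = (\<integral>\<^sup>+r. h t r \<partial>lborel)"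
      using AE_lborel_singleton[of "0::real"]
      by (intro nn_integral_cong_AE)
        (use True b in \<open>auto elim!: eventually_mono simp: h_def indicator_def ennreal_mult[symmetric] field_simps\<close>)
    finally show ?thesis using True by simp
  qed (simp add: h_def)
  then have "(\<integral>\<^sup>+t. ennreal (indicator {0<..} t * (t powr (s - 1) * (1 - exp (- (b / t))))) \<partial>lborel) = (\<integral>\<^sup>+t. \<integral>\<^sup>+r. h t r \<partial>lborel \<partial>lborel)"
    by simp
  also have "\<dots> = (\<integral>\<^sup>+r. \<integral>\<^sup>+t. h t r \<partial>lborel \<partial>lborel)"
    by (rule lborel_pair.Fubini') (use hm in simp)
  also have "\<dots> = (\<integral>\<^sup>+r. ennreal (b / s) * ennreal (indicator {0<..} r * (r powr ((1 - s) - 1) * exp (- (b * r)))) \<partial>lborel)"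
  proof (intro nn_integral_cong)
    fix r :: real
    show "(\<integral>\<^sup>+t. h t r \<partial>lborel) = ennreal (b / s) * ennreal (indicator {0<..} r * (r powr ((1 - s) - 1) * exp (- (b * r))))"
    proof (cases "0 < r")
      case True
      have "((\<lambda>t. t powr (s - 1)) has_integral ((1 / r) powr (s - 1 + 1) / (s - 1 + 1))) {0..1 / r}"
        using s True by (intro has_integral_powr_from_0) auto
      then have "(\<integral>\<^sup>+t. ennreal (indicator {0..1 / r} t * t powr (s - 1)) \<partial>lborel) = ennreal ((1 / r) powr (s - 1 + 1) / (s - 1 + 1))"
        by (intro nn_integral_has_integral_lebesgue) auto
      also have "(1 / r) powr (s - 1 + 1) / (s - 1 + 1) = r powr (- s) / s"
        using True by (simp add: powr_minus powr_divide divide_simps)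
      finally have I: "(\<integral>\<^sup>+t. ennreal (indicator {0..1 / r} t * t powr (s - 1)) \<partial>lborel) = ennreal (r powr (- s) / s)" .
      have "(\<integral>\<^sup>+t. h t r \<partial>lborel) = (\<integral>\<^sup>+t. ennreal (b * exp (- (b * r))) * ennreal (indicator {0..1 / r} t * t powr (s - 1)) \<partial>lborel)"
        using AE_lborel_singleton[of "0::real"]
        by (intro nn_integral_cong_AE)
          (use True b in \<open>auto elim!: eventually_mono simp: h_def indicator_def ennreal_mult[symmetric] field_simps\<close>)
      also have "\<dots> = ennreal (b * exp (- (b * r))) * ennreal (r powr (- s) / s)"
        by (subst nn_integral_cmult) (auto simp: I)
      finally show ?thesis using True b s by (simp add: ennreal_mult[symmetric] mult_ac)
    qed (simp add: h_def)
  qed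
  also have "\<dots> = ennreal (b / s) * ennreal (Gamma (1 - s) * b powr (- (1 - s)))"
    unfolding nn_integral_powr_exp[OF G b, symmetric] by (rule nn_integral_cmult) measurable
  also have "\<dots> = ennreal (b / s * (Gamma (1 - s) * b powr (- (1 - s))))"
    using s b by (subst ennreal_mult[symmetric]) (auto simp: Gamma_real_nonneg)
  also have "b / s * (Gamma (1 - s) * b powr (- (1 - s))) = b powr s * (Gamma (1 - s) / s)"
    using b by (simp add: powr_diff)
  finally show ?thesis .
qed

section \<open>The singular kernel as a mixture of Gaussians\<close>

definition frac_kernel :: "real \<Rightarrow> real ^ 'n \<Rightarrow> real" where
  "frac_kernel s z = norm z powr (- (real CARD('n) + 2 * s))"

lemma frac_kernel_measurable [measurable]: "frac_kernel s \<in> borel_measurable borel"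
  unfolding frac_kernel_def[abs_def] by measurable

lemma frac_kernel_nonneg: "0 \<le> frac_kernel s z"
  by (simp add: frac_kernel_def)

lemma frac_kernel_uminus [simp]: "frac_kernel s (- z) = frac_kernel s z"
  by (simp add: frac_kernel_def)

text \<open>The Gamma integral at exponent a with rate |z|^2; a is half the order n + 2 s of the
  singularity.\<close>

lemma frac_kernel_subordination:
  fixes z :: "real ^ 'n"
  assumes s: "0 < s" and z: "z \<noteq> 0"
  defines "a \<equiv> s + real CARD('n) / 2"
  shows "ennreal (Gamma a * frac_kernel s z)
    = (\<integral>\<^sup>+t. ennreal (indicator {0<..} t * (t powr (a - 1) * exp (- (t * (norm z)\<^sup>2)))) \<partial>lborel)"
proof -
  have "frac_kernel s z = ((norm z)\<^sup>2) powr (- a)"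
  proof -
    have "(norm z)\<^sup>2 = norm z powr 2" using z by (simp add: powr_numeral)
    then have "((norm z)\<^sup>2) powr (- a) = norm z powr (2 * - a)" by (simp only: powr_powr)
    also have "2 * - a = - (real CARD('n) + 2 * s)" by (simp add: a_def)
    finally show ?thesis by (simp add: frac_kernel_def)
  qed
  moreover have "0 < a" using s by (simp add: a_def add_pos_nonneg)
  ultimately show ?thesis
    using nn_integral_powr_exp[of a "(norm z)\<^sup>2"] z by (simp add: mult.commute)
qed

text \<open>The mass of an n-dimensional Gaussian contributes t^(-n/2), which cancels the n/2 in the
  subordination exponent: the integral in t that remains depends on the dimension only through a
  constant factor.\<close>

lemma gaussian_sqrt_powr:
  assumes "0 < t" "0 < (c::real)"
  shows "t powr (s + real n / 2 - 1) * sqrt (c / t) ^ n = c powr (real n / 2) * t powr (s - 1)"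
proof -
  have "sqrt (c / t) ^ n = (c / t) powr (real n / 2)"
    using assms by (simp add: powr_half_sqrt[symmetric] powr_realpow[symmetric] powr_powr del: powr_realpow)
  also have "\<dots> = c powr (real n / 2) * t powr (- (real n / 2))"
    using assms by (simp add: powr_divide powr_minus_divide)
  finally have "t powr (s + real n / 2 - 1) * sqrt (c / t) ^ n
     = c powr (real n / 2) * (t powr (s + real n / 2 - 1) * t powr (- (real n / 2)))" by simp
  also have "t powr (s + real n / 2 - 1) * t powr (- (real n / 2)) = t powr (s - 1)"
    by (simp add: powr_add[symmetric])
  finally show ?thesis .
qed

text \<open>The Gaussian transform at frequency 0 minus its real part at \<xi>.\<close>

lemma nn_integral_one_minus_cos_gaussian:
  fixes \<xi> :: "real ^ 'n"
  assumes t: "0 < t"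
  shows "(\<integral>\<^sup>+z. ennreal ((1 - cos (\<xi> \<bullet> z)) * exp (- (t * (norm z)\<^sup>2))) \<partial>lborel)
    = ennreal (sqrt (pi / t) ^ CARD('n) * (1 - exp (- ((norm \<xi>)\<^sup>2 / 4 / t))))"
proof -
  note g = integral_gaussian[OF t, where 'a="real ^ 'n"] and f = fourier_gaussian[OF t, of \<xi>]
  have eq: "(1 - cos (\<xi> \<bullet> z)) * exp (- (t * (norm z)\<^sup>2)) = exp (- t * (norm z)\<^sup>2)
     - Re (complex_of_real (exp (- t * (norm z)\<^sup>2)) * cis (- (z \<bullet> \<xi>)))" for z
    by (simp add: left_diff_distrib inner_commute)
  have int: "integrable lborel (\<lambda>z. (1 - cos (\<xi> \<bullet> z)) * exp (- (t * (norm z)\<^sup>2)))"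
    unfolding eq using g f by (intro Bochner_Integration.integrable_diff integrable_Re) auto
  have "(LINT z|lborel. (1 - cos (\<xi> \<bullet> z)) * exp (- (t * (norm z)\<^sup>2)))
     = (LINT z|lborel. exp (- t * (norm (z :: real ^ 'n))\<^sup>2)) - (LINT z|lborel. Re (complex_of_real (exp (- t * (norm z)\<^sup>2)) * cis (- (z \<bullet> \<xi>))))"
    unfolding eq by (rule Bochner_Integration.integral_diff[OF g(1) integrable_Re[OF f(1)]])
  also have "\<dots> = sqrt (pi / t) ^ CARD('n)
     - Re (complex_of_real (sqrt (pi / t) ^ CARD('n) * exp (- (norm \<xi>)\<^sup>2 / (4 * t))))"
    unfolding integral_Re[OF f(1)] f(2) g(2) by simp
  also have "\<dots> = sqrt (pi / t) ^ CARD('n) * (1 - exp (- ((norm \<xi>)\<^sup>2 / 4 / t)))"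
    by (simp only: Re_complex_of_real) (simp add: right_diff_distrib)
  finally have I: "(LINT z|lborel. (1 - cos (\<xi> \<bullet> z)) * exp (- (t * (norm z)\<^sup>2))) = \<dots>" .
  show ?thesis unfolding I[symmetric]
    by (rule nn_integral_eq_integral[OF int]) (auto intro!: AE_I2 mult_nonneg_nonneg)
qed

text \<open>The absolute value of Gamma(- s) is resolved by the functional equation, as - s is not a
  pole; Gamma(1 - s) / s is the form in which the integral in t produces this factor.\<close>

lemma frac_laplacian_const_pos: "0 < s \<Longrightarrow> s < 1 \<Longrightarrow> 0 < frac_laplacian_const TYPE('n::finite) s"
  and frac_laplacian_const_eq: "0 < s \<Longrightarrow> s < 1 \<Longrightarrow>
    frac_laplacian_const TYPE('n::finite) s = 4 powr s * Gamma (s + real CARD('n) / 2) / (pi powr (real CARD('n) / 2) * (Gamma (1 - s) / s))"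
proof -
  assume s: "0 < s" "s < 1"
  have g1: "0 < Gamma (1 - s)" using s by (intro Gamma_real_pos) simp
  have g2: "0 < Gamma (s + real CARD('n) / 2)" using s by (intro Gamma_real_pos add_pos_nonneg) auto
  have "- s \<notin> \<int>\<^sub>\<le>\<^sub>0"
  proof
    assume "- s \<in> \<int>\<^sub>\<le>\<^sub>0"
    then have "- s \<in> \<int>" by (rule nonpos_Ints_Int)
    then obtain m :: int where m: "- s = of_int m" unfolding Ints_def by blast
    then have "(of_int m :: real) < 0" using s by linarith
    then have "m \<le> - 1" by simp
    then have "(of_int m :: real) \<le> of_int (- 1)" by (simp only: of_int_le_iff)
    then show False using m s by simp
  qed
  then have "Gamma (- s + 1) = - s * Gamma (- s)" by (intro Gamma_plus1)
  then have "Gamma (- s) = - (Gamma (1 - s) / s)" using s by (simp add: field_simps)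
  then have abs: "\<bar>Gamma (- s)\<bar> = Gamma (1 - s) / s" using s g1 by simp
  show "frac_laplacian_const TYPE('n) s = 4 powr s * Gamma (s + real CARD('n) / 2) / (pi powr (real CARD('n) / 2) * (Gamma (1 - s) / s))"
    by (simp add: frac_laplacian_const_def abs)
  then show "0 < frac_laplacian_const TYPE('n) s" using s g1 g2 by simp
qed

text \<open>Under the Gaussian mixture the integral in z is taken first. This explains the constant:
  Gamma(s + n/2) normalises the mixture, pi^(n/2) is the Gaussian mass, 4^s stems from the exponent
  |\<xi>|^2 / (4 t), and Gamma(1 - s) / s is the final integral in t.\<close>

lemma nn_integral_one_minus_cos_frac_kernel:
  fixes \<xi> :: "real ^ 'n"
  assumes s: "0 < s" "s < 1"
  shows "(\<integral>\<^sup>+z. ennreal ((1 - cos (\<xi> \<bullet> z)) * frac_kernel s z) \<partial>lborel)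
    = ennreal (norm \<xi> powr (2 * s) / frac_laplacian_const TYPE('n) s)"
proof (cases "\<xi> = 0")
  case False
  define a where "a = s + real CARD('n) / 2"
  have g: "0 < Gamma a" using s unfolding a_def by (intro Gamma_real_pos add_pos_nonneg) auto
  have G1: "0 < Gamma (1 - s)" using s by (intro Gamma_real_pos) simp
  have b: "0 < (norm \<xi>)\<^sup>2 / 4" using False by simp
  define J where "J = (\<integral>\<^sup>+z. ennreal ((1 - cos (\<xi> \<bullet> z)) * frac_kernel s z) \<partial>lborel)"
  define h where "h t z = ennreal (indicator {0<..} t * (t powr (a - 1) * ((1 - cos (\<xi> \<bullet> z)) * exp (- (t * (norm z)\<^sup>2)))))" for t and z :: "real ^ 'n"
  have hm [measurable]: "(\<lambda>(t, z). h t z) \<in> borel_measurable (lborel \<Otimes>\<^sub>M lborel)"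
    unfolding h_def by measurable
  have "ennreal (Gamma a) * J = (\<integral>\<^sup>+z. ennreal (Gamma a) * ennreal ((1 - cos (\<xi> \<bullet> z)) * frac_kernel s z) \<partial>lborel)"
    unfolding J_def by (rule nn_integral_cmult[symmetric]) measurable
  also have "\<dots> = (\<integral>\<^sup>+z. \<integral>\<^sup>+t. h t z \<partial>lborel \<partial>lborel)"
  proof (intro nn_integral_cong_AE)
    show "AE z in lborel. ennreal (Gamma a) * ennreal ((1 - cos (\<xi> \<bullet> z)) * frac_kernel s z) = (\<integral>\<^sup>+t. h t z \<partial>lborel)"
      using AE_lborel_singleton[of "0 :: real ^ 'n"]
    proof eventually_elim
      case (elim z)
      have "ennreal (Gamma a) * ennreal ((1 - cos (\<xi> \<bullet> z)) * frac_kernel s z) = ennreal (1 - cos (\<xi> \<bullet> z)) * ennreal (Gamma a * frac_kernel s z)"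
        using g frac_kernel_nonneg[of s z] by (simp add: ennreal_mult[symmetric] mult_ac)
      also have "\<dots> = (\<integral>\<^sup>+t. ennreal (1 - cos (\<xi> \<bullet> z)) * ennreal (indicator {0<..} t * (t powr (a - 1) * exp (- (t * (norm z)\<^sup>2)))) \<partial>lborel)"
        unfolding a_def frac_kernel_subordination[OF s(1) elim] by (rule nn_integral_cmult[symmetric]) measurable
      also have "\<dots> = (\<integral>\<^sup>+t. h t z \<partial>lborel)"
        by (intro nn_integral_cong) (simp add: h_def ennreal_mult[symmetric] mult_ac)
      finally show ?case .
    qed
  qed
  also have "\<dots> = (\<integral>\<^sup>+t. \<integral>\<^sup>+z. h t z \<partial>lborel \<partial>lborel)"
    by (rule lborel_pair.Fubini'[symmetric]) (use hm in simp)
  also have "\<dots> = (\<integral>\<^sup>+t. ennreal (pi powr (real CARD('n) / 2)) * ennreal (indicator {0<..} t * (t powr (s - 1) * (1 - exp (- ((norm \<xi>)\<^sup>2 / 4 / t))))) \<partial>lborel)"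
  proof (intro nn_integral_cong)
    fix t :: real
    show "(\<integral>\<^sup>+z. h t z \<partial>lborel) = ennreal (pi powr (real CARD('n) / 2)) * ennreal (indicator {0<..} t * (t powr (s - 1) * (1 - exp (- ((norm \<xi>)\<^sup>2 / 4 / t)))))"
    proof (cases "0 < t")
      case True
      have "(\<integral>\<^sup>+z. h t z \<partial>lborel) = (\<integral>\<^sup>+z. ennreal (t powr (a - 1)) * ennreal ((1 - cos (\<xi> \<bullet> z)) * exp (- (t * (norm z)\<^sup>2))) \<partial>lborel)"
        using True by (intro nn_integral_cong) (simp add: h_def ennreal_mult[symmetric])
      also have "\<dots> = ennreal (t powr (a - 1)) * ennreal (sqrt (pi / t) ^ CARD('n) * (1 - exp (- ((norm \<xi>)\<^sup>2 / 4 / t))))"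
        by (subst nn_integral_cmult) (auto simp only: nn_integral_one_minus_cos_gaussian[OF True], measurable)
      also have "\<dots> = ennreal ((t powr (a - 1) * sqrt (pi / t) ^ CARD('n)) * (1 - exp (- ((norm \<xi>)\<^sup>2 / 4 / t))))"
        using True by (subst ennreal_mult[symmetric]) (auto simp: mult.assoc)
      also have "\<dots> = ennreal (pi powr (real CARD('n) / 2) * (t powr (s - 1) * (1 - exp (- ((norm \<xi>)\<^sup>2 / 4 / t)))))"
        unfolding a_def using True by (subst gaussian_sqrt_powr) (auto simp: mult.assoc)
      finally show ?thesis using True by (simp add: ennreal_mult)
    qed (simp add: h_def)
  qed
  also have "\<dots> = ennreal (pi powr (real CARD('n) / 2)) * ennreal (((norm \<xi>)\<^sup>2 / 4) powr s * (Gamma (1 - s) / s))"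
    unfolding nn_integral_powr_one_minus_exp[OF s b, symmetric] by (rule nn_integral_cmult) measurable
  also have "\<dots> = ennreal (pi powr (real CARD('n) / 2) * (((norm \<xi>)\<^sup>2 / 4) powr s * (Gamma (1 - s) / s)))"
    using s G1 by (intro ennreal_mult[symmetric]) auto
  also have "pi powr (real CARD('n) / 2) * (((norm \<xi>)\<^sup>2 / 4) powr s * (Gamma (1 - s) / s))
      = Gamma a * (norm \<xi> powr (2 * s) / frac_laplacian_const TYPE('n) s)"
  proof -
    have n2: "(norm \<xi>)\<^sup>2 = norm \<xi> powr 2" using False by (simp add: powr_numeral)
    have "((norm \<xi>)\<^sup>2 / 4) powr s = ((norm \<xi>)\<^sup>2) powr s / 4 powr s"
      by (simp add: powr_divide)
    also have "((norm \<xi>)\<^sup>2) powr s = norm \<xi> powr (2 * s)" by (simp only: n2 powr_powr)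
    finally have "((norm \<xi>)\<^sup>2 / 4) powr s = norm \<xi> powr (2 * s) / 4 powr s" .
    then show ?thesis
      unfolding frac_laplacian_const_eq[OF s] a_def[symmetric] using s g G1 by (simp add: field_simps)
  qed
  also have "ennreal \<dots> = ennreal (Gamma a) * ennreal (norm \<xi> powr (2 * s) / frac_laplacian_const TYPE('n) s)"
    using g frac_laplacian_const_pos[OF s, where 'n='n] by (intro ennreal_mult) auto
  finally have "ennreal (Gamma a) * J = ennreal (Gamma a) * ennreal (norm \<xi> powr (2 * s) / frac_laplacian_const TYPE('n) s)" .
  then show ?thesis using g unfolding J_def by (subst (asm) ennreal_mult_cancel_left) auto
qed simp

text \<open>Where $|z| > \epsilon$, $e^{-t|z|^2} \le e^{-t\epsilon^2/2} e^{-t|z|^2/2}$; with subordination this reduces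
  integrability of the kernel to that of Gaussians, without polar coordinates.\<close>

lemma integrable_frac_kernel_truncated:
  assumes s: "0 < s" and e: "0 < \<epsilon>"
  shows "integrable lborel (\<lambda>z::real ^ 'n. indicator {z. \<epsilon> < norm z} z * frac_kernel s z)"
proof (rule integrableI_bounded)
  show "(\<lambda>z::real ^ 'n. indicator {z. \<epsilon> < norm z} z * frac_kernel s z) \<in> borel_measurable lborel" by measurable
  define a where "a = s + real CARD('n) / 2"
  have g: "0 < Gamma a" using s unfolding a_def by (intro Gamma_real_pos add_pos_nonneg) auto
  have e2: "0 < \<epsilon>\<^sup>2 / 2" using e by simp
  define J where "J = (\<integral>\<^sup>+z. ennreal (norm (indicator {z. \<epsilon> < norm z} z * frac_kernel s (z :: real ^ 'n))) \<partial>lborel)"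
  define h where "h t z = ennreal (indicator {0<..} t * (t powr (a - 1) * exp (- (\<epsilon>\<^sup>2 / 2 * t))) * exp (- (t / 2) * (norm z)\<^sup>2))" for t and z :: "real ^ 'n"
  have hm [measurable]: "(\<lambda>(t, z). h t z) \<in> borel_measurable (lborel \<Otimes>\<^sub>M lborel)"
    unfolding h_def by measurable
  have "ennreal (Gamma a) * J = (\<integral>\<^sup>+z. ennreal (Gamma a) * ennreal (norm (indicator {z. \<epsilon> < norm z} z * frac_kernel s (z :: real ^ 'n))) \<partial>lborel)"
    unfolding J_def by (rule nn_integral_cmult[symmetric]) measurable
  also have "\<dots> \<le> (\<integral>\<^sup>+z. \<integral>\<^sup>+t. h t z \<partial>lborel \<partial>lborel)"
  proof (intro nn_integral_mono)
    fix z :: "real ^ 'n"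
    show "ennreal (Gamma a) * ennreal (norm (indicator {z. \<epsilon> < norm z} z * frac_kernel s z)) \<le> (\<integral>\<^sup>+t. h t z \<partial>lborel)"
    proof (cases "\<epsilon> < norm z")
      case True
      then have z: "z \<noteq> 0" using e by auto
      have "ennreal (Gamma a) * ennreal (norm (indicator {z. \<epsilon> < norm z} z * frac_kernel s z)) = ennreal (Gamma a * frac_kernel s z)"
        using True g frac_kernel_nonneg[of s z] by (simp add: ennreal_mult)
      also have "\<dots> \<le> (\<integral>\<^sup>+t. h t z \<partial>lborel)"
        unfolding a_def frac_kernel_subordination[OF s z]
      proof (intro nn_integral_mono)
        fix t :: real
        show "ennreal (indicator {0<..} t * (t powr (s + real CARD('n) / 2 - 1) * exp (- (t * (norm z)\<^sup>2)))) \<le> h t z"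
        proof (cases "0 < t")
          case t: True
          have "\<epsilon>\<^sup>2 \<le> (norm z)\<^sup>2" using True e by (intro power_mono) auto
          then have "t * \<epsilon>\<^sup>2 \<le> t * (norm z)\<^sup>2" using t by (intro mult_left_mono) auto
          then have "exp (- (t * (norm z)\<^sup>2)) \<le> exp (- (\<epsilon>\<^sup>2 / 2 * t)) * exp (- (t / 2) * (norm z)\<^sup>2)"
            by (simp add: exp_add[symmetric] field_simps)
          then show ?thesis unfolding h_def a_def mult.assoc
            by (intro ennreal_leI mult_left_mono) auto
        qed (simp add: h_def)
      qed
      finally show ?thesis .
    qed simp
  qed
  also have "\<dots> = (\<integral>\<^sup>+t. \<integral>\<^sup>+z. h t z \<partial>lborel \<partial>lborel)"
    by (rule lborel_pair.Fubini'[symmetric]) (use hm in simp)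
  also have "\<dots> = (\<integral>\<^sup>+t. ennreal ((2 * pi) powr (real CARD('n) / 2)) * ennreal (indicator {0<..} t * (t powr (s - 1) * exp (- (\<epsilon>\<^sup>2 / 2 * t)))) \<partial>lborel)"
  proof (intro nn_integral_cong)
    fix t :: real
    show "(\<integral>\<^sup>+z. h t z \<partial>lborel) = ennreal ((2 * pi) powr (real CARD('n) / 2)) * ennreal (indicator {0<..} t * (t powr (s - 1) * exp (- (\<epsilon>\<^sup>2 / 2 * t))))"
    proof (cases "0 < t")
      case True
      then have t2: "0 < t / 2" by simp
      have "(\<integral>\<^sup>+z. h t z \<partial>lborel) = (\<integral>\<^sup>+z. ennreal (t powr (a - 1) * exp (- (\<epsilon>\<^sup>2 / 2 * t))) * ennreal (exp (- (t / 2) * (norm (z :: real ^ 'n))\<^sup>2)) \<partial>lborel)"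
        using True by (intro nn_integral_cong) (simp add: h_def ennreal_mult[symmetric])
      also have "\<dots> = ennreal (t powr (a - 1) * exp (- (\<epsilon>\<^sup>2 / 2 * t))) * (\<integral>\<^sup>+z. ennreal (exp (- (t / 2) * (norm (z :: real ^ 'n))\<^sup>2)) \<partial>lborel)"
        by (rule nn_integral_cmult) measurable
      also have "(\<integral>\<^sup>+z. ennreal (exp (- (t / 2) * (norm (z :: real ^ 'n))\<^sup>2)) \<partial>lborel) = ennreal (sqrt (pi / (t / 2)) ^ DIM(real ^ 'n))"
        unfolding integral_gaussian(2)[OF t2, symmetric]
        by (rule nn_integral_eq_integral[OF integral_gaussian(1)[OF t2]]) auto
      also have "pi / (t / 2) = (2 * pi) / t" by simp
      also have "ennreal (t powr (a - 1) * exp (- (\<epsilon>\<^sup>2 / 2 * t))) * ennreal (sqrt (2 * pi / t) ^ DIM(real ^ 'n))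
        = ennreal ((t powr (a - 1) * sqrt (2 * pi / t) ^ CARD('n)) * exp (- (\<epsilon>\<^sup>2 / 2 * t)))"
        using True by (subst ennreal_mult[symmetric]) (auto simp: mult_ac)
      also have "\<dots> = ennreal ((2 * pi) powr (real CARD('n) / 2) * (t powr (s - 1) * exp (- (\<epsilon>\<^sup>2 / 2 * t))))"
        unfolding a_def using True by (subst gaussian_sqrt_powr) (auto simp: mult.assoc)
      finally show ?thesis using True by (simp add: ennreal_mult)
    qed (simp add: h_def)
  qed
  also have "\<dots> = ennreal ((2 * pi) powr (real CARD('n) / 2)) * ennreal (Gamma s * (\<epsilon>\<^sup>2 / 2) powr (- s))"
    unfolding nn_integral_powr_exp[OF s e2, symmetric] by (rule nn_integral_cmult) measurable
  finally have "ennreal (Gamma a) * J < \<infinity>"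
    by (rule le_less_trans) (simp add: ennreal_mult_less_top)
  then show "J < \<infinity>" using g by (auto simp: ennreal_mult_less_top)
qed

section \<open>The fractional Laplacian as a multiplier\<close>

lemma nnL2_translate:
  fixes u :: "real ^ 'n \<Rightarrow> complex"
  assumes [measurable]: "u \<in> borel_measurable borel"
  shows "nnL2 (\<lambda>x. u (x - z)) = nnL2 u"
  using nn_integral_lborel_affine[of "\<lambda>x. ennreal ((cmod (u x))\<^sup>2)" 1 "- z"] by (simp add: nnL2_def)

lemma fou_modulated:
  fixes \<phi> :: "real ^ 'n \<Rightarrow> complex"
  shows "fou (\<lambda>y. \<phi> y * cis (- (z \<bullet> y))) x = fou \<phi> (x + z)"
  unfolding fou_def
  by (intro Bochner_Integration.integral_cong refl) (simp add: inner_add_left cis_mult add.commute)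

text \<open>Young's inequality for an L^1 kernel and an L^2 function, together with the convolution
  theorem. Convergence of the defining integral is asserted only almost everywhere; where it fails,
  the value is 0 by convention.\<close>

lemma convolution_fourier:
  fixes u :: "real ^ 'n \<Rightarrow> complex" and k :: "real ^ 'n \<Rightarrow> real"
  assumes k: "integrable lborel k" "\<And>z. 0 \<le> k z"
    and u: "square_integrable u" "has_fourier u U"
  shows "AE x in lborel. integrable lborel (\<lambda>z. of_real (k z) * u (x - z))" (is ?A)
    and "square_integrable (\<lambda>x. LINT z|lborel. of_real (k z) * u (x - z))" (is ?B)
    and "has_fourier (\<lambda>x. LINT z|lborel. of_real (k z) * u (x - z)) (\<lambda>\<xi>. fou (\<lambda>z. of_real (k z)) \<xi> * U \<xi>)" (is ?C)
proof -
  have U: "square_integrable U" by (rule has_fourier_square_integrable[OF u(2)])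
  have [measurable]: "k \<in> borel_measurable borel" "u \<in> borel_measurable borel" "U \<in> borel_measurable borel"
    using k u U by (auto simp: square_integrable_measurable)
  define K where "K = (\<integral>\<^sup>+z. ennreal (k z) \<partial>lborel)"
  have K: "K < \<infinity>" using k by (simp add: K_def integrable_iff_bounded)
  \<comment> \<open>The convolution of k with |u|^2. It has integral K times the squared norm of u,
    so it is finite almost everywhere, and it controls both the convergence and the square of the
    convolution of k with u.\<close>
  define A where "A x = (\<integral>\<^sup>+z. ennreal (k z) * ennreal ((cmod (u (x - z)))\<^sup>2) \<partial>lborel)" for x
  have [measurable]: "A \<in> borel_measurable borel" unfolding A_def by measurable
  have "(\<integral>\<^sup>+x. A x \<partial>lborel) = (\<integral>\<^sup>+z. \<integral>\<^sup>+x. ennreal (k z) * ennreal ((cmod (u (x - z)))\<^sup>2) \<partial>lborel \<partial>lborel)"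
    unfolding A_def by (rule lborel_pair.Fubini') measurable
  also have "\<dots> = (\<integral>\<^sup>+z. ennreal (k z) * nnL2 u \<partial>lborel)"
  proof (intro nn_integral_cong)
    fix z
    have "(\<integral>\<^sup>+x. ennreal (k z) * ennreal ((cmod (u (x - z)))\<^sup>2) \<partial>lborel) = ennreal (k z) * nnL2 (\<lambda>x. u (x - z))"
      unfolding nnL2_def by (rule nn_integral_cmult) measurable
    then show "(\<integral>\<^sup>+x. ennreal (k z) * ennreal ((cmod (u (x - z)))\<^sup>2) \<partial>lborel) = ennreal (k z) * nnL2 u"
      by (simp add: nnL2_translate)
  qed
  also have "\<dots> = K * nnL2 u" unfolding K_def by (rule nn_integral_multc) measurable
  finally have intA: "(\<integral>\<^sup>+x. A x \<partial>lborel) = K * nnL2 u" .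
  have Afin: "(\<integral>\<^sup>+x. A x \<partial>lborel) < \<infinity>"
    using K u(1) by (simp add: intA square_integrable_iff ennreal_mult_less_top)
  have "AE x in lborel. A x \<noteq> \<infinity>" using Afin by (intro nn_integral_PInf_AE) auto
  then show ?A
  proof eventually_elim
    case (elim x)
    show ?case
    proof (rule integrableI_bounded)
      have "(\<integral>\<^sup>+z. ennreal (norm (of_real (k z) * u (x - z))) \<partial>lborel) \<le> (\<integral>\<^sup>+z. ennreal (k z) + ennreal (k z) * ennreal ((cmod (u (x - z)))\<^sup>2) \<partial>lborel)"
      proof (intro nn_integral_mono)
        fix z
        \<comment> \<open>Completing the square gives t \<le> 1 + t^2; the summand 1 is absorbed by
          the integrability of k.\<close>
        have "cmod (u (x - z)) \<le> 1 + (cmod (u (x - z)))\<^sup>2"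
          using zero_le_power2[of "cmod (u (x - z)) - 1/2"] by (simp add: power2_eq_square algebra_simps)
        then have "k z * cmod (u (x - z)) \<le> k z * (1 + (cmod (u (x - z)))\<^sup>2)" using k(2) by (intro mult_left_mono) auto
        then show "ennreal (norm (of_real (k z) * u (x - z))) \<le> ennreal (k z) + ennreal (k z) * ennreal ((cmod (u (x - z)))\<^sup>2)"
          using k(2)[of z] by (simp add: norm_mult ennreal_mult[symmetric] ennreal_plus[symmetric] distrib_left del: ennreal_plus)
      qed
      also have "\<dots> = K + A x" unfolding K_def A_def by (rule nn_integral_add) auto
      also have "\<dots> < \<infinity>" using K elim by (simp add: less_top)
      finally show "(\<integral>\<^sup>+z. ennreal (norm (of_real (k z) * u (x - z))) \<partial>lborel) < \<infinity>" .
    qed measurable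
  qed
  define v where "v x = (LINT z|lborel. of_real (k z) * u (x - z))" for x
  have [measurable]: "v \<in> borel_measurable borel" unfolding v_def by measurable
  have "nnL2 v \<le> (\<integral>\<^sup>+x. 2 * (K * A x) \<partial>lborel)"
    unfolding nnL2_def
  proof (intro nn_integral_mono)
    fix x
    \<comment> \<open>In place of the Cauchy-Schwarz inequality, the square of the integral is
      written as a double integral and the mixed product is bounded by the sum of the squares. This
      yields 2 K A(x).\<close>
    define f where "f z = k z * cmod (u (x - z))" for z
    have f0: "0 \<le> f z" for z using k(2) by (simp add: f_def)
    have [measurable]: "f \<in> borel_measurable borel" unfolding f_def by measurable
    have "ennreal (cmod (v x)) \<le> (\<integral>\<^sup>+z. ennreal (f z) \<partial>lborel)"
      using norm_integral_le_nn_integral[of lborel "\<lambda>z. of_real (k z) * u (x - z)"] k(2)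
      by (simp add: v_def f_def norm_mult)
    then have "ennreal ((cmod (v x))\<^sup>2) \<le> (\<integral>\<^sup>+z. ennreal (f z) \<partial>lborel) * (\<integral>\<^sup>+z. ennreal (f z) \<partial>lborel)"
      by (simp add: power2_eq_square ennreal_mult mult_mono)
    also have "\<dots> = (\<integral>\<^sup>+z. \<integral>\<^sup>+y. ennreal (f z) * ennreal (f y) \<partial>lborel \<partial>lborel)"
      by (simp add: nn_integral_cmult nn_integral_multc)
    also have "\<dots> \<le> (\<integral>\<^sup>+z. \<integral>\<^sup>+y. ennreal (k z * (cmod (u (x - z)))\<^sup>2) * ennreal (k y) + ennreal (k z) * ennreal (k y * (cmod (u (x - y)))\<^sup>2) \<partial>lborel \<partial>lborel)"
    proof (intro nn_integral_mono)
      fix z y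
      have "cmod (u (x - z)) * cmod (u (x - y)) \<le> (cmod (u (x - z)))\<^sup>2 + (cmod (u (x - y)))\<^sup>2"
        using sum_squares_bound[of "cmod (u (x - z))" "cmod (u (x - y))"]
          zero_le_power2[of "cmod (u (x - z))"] zero_le_power2[of "cmod (u (x - y))"] by linarith
      then have "(k z * k y) * (cmod (u (x - z)) * cmod (u (x - y))) \<le> (k z * k y) * ((cmod (u (x - z)))\<^sup>2 + (cmod (u (x - y)))\<^sup>2)"
        using k(2) by (intro mult_left_mono) auto
      then have "f z * f y \<le> (k z * (cmod (u (x - z)))\<^sup>2) * k y + k z * (k y * (cmod (u (x - y)))\<^sup>2)"
        by (simp add: f_def algebra_simps)
      then show "ennreal (f z) * ennreal (f y) \<le> ennreal (k z * (cmod (u (x - z)))\<^sup>2) * ennreal (k y) + ennreal (k z) * ennreal (k y * (cmod (u (x - y)))\<^sup>2)"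
        using k(2) f0 by (simp add: ennreal_mult[symmetric] ennreal_plus[symmetric] del: ennreal_plus)
    qed
    also have "\<dots> = (\<integral>\<^sup>+z. ennreal (k z * (cmod (u (x - z)))\<^sup>2) \<partial>lborel) * K + K * (\<integral>\<^sup>+z. ennreal (k z * (cmod (u (x - z)))\<^sup>2) \<partial>lborel)"
      by (simp add: nn_integral_add nn_integral_cmult nn_integral_multc K_def)
    also have "(\<integral>\<^sup>+z. ennreal (k z * (cmod (u (x - z)))\<^sup>2) \<partial>lborel) = A x"
      unfolding A_def using k(2) by (simp add: ennreal_mult)
    also have "A x * K + K * A x = 2 * (K * A x)" by (simp add: mult.commute mult_2)
    finally show "ennreal ((cmod (v x))\<^sup>2) \<le> 2 * (K * A x)" .
  qed
  also have "\<dots> = 2 * (K * (K * nnL2 u))" by (simp add: nn_integral_cmult intA)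
  also have "\<dots> < \<infinity>" using K u(1) by (simp add: square_integrable_iff ennreal_mult_less_top)
  finally have v2: "square_integrable v" by (simp add: square_integrable_iff)
  then show ?B by (simp add: v_def[abs_def])
  have kc: "integrable lborel (\<lambda>z. complex_of_real (k z))" using k(1) by (rule integrable_of_real)
  define kh where "kh = fou (\<lambda>z. complex_of_real (k z))"
  have [measurable]: "kh \<in> borel_measurable borel" unfolding kh_def by measurable
  have khU: "square_integrable (\<lambda>\<xi>. kh \<xi> * U \<xi>)"
    using fou_norm_le[of "\<lambda>z. complex_of_real (k z)"] unfolding kh_def[symmetric]
    by (intro square_integrable_mult_bounded[OF U]) auto
  have "has_fourier v (\<lambda>\<xi>. kh \<xi> * U \<xi>)"
  proof (rule has_fourierI_weak[OF v2 khU])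
    fix \<phi> :: "real ^ 'n \<Rightarrow> complex" assume t: "test_function \<phi>"
    note t' = test_functionD(4,5)[OF t]
    have [measurable]: "\<phi> \<in> borel_measurable borel" using t'(2) by measurable
    define F where "F x z = of_real (k z) * u (x - z) * fou \<phi> x" for x z
    have Fm [measurable]: "case_prod F \<in> borel_measurable (lborel \<Otimes>\<^sub>M lborel)" unfolding F_def by measurable
    have Fi: "integrable (lborel \<Otimes>\<^sub>M lborel) (case_prod F)"
    proof (rule integrableI_bounded[OF Fm])
      have "(\<integral>\<^sup>+p. ennreal (norm (case_prod F p)) \<partial>(lborel \<Otimes>\<^sub>M lborel)) = (\<integral>\<^sup>+z. \<integral>\<^sup>+x. ennreal (norm (F x z)) \<partial>lborel \<partial>lborel)"
        by (subst lborel_pair.nn_integral_snd[symmetric]) auto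
      also have "\<dots> \<le> (\<integral>\<^sup>+z. ennreal (k z) * (nnL2 u + nnL2 (fou \<phi>)) \<partial>lborel)"
      proof (intro nn_integral_mono)
        fix z
        have "(\<integral>\<^sup>+x. ennreal (norm (F x z)) \<partial>lborel) \<le> (\<integral>\<^sup>+x. ennreal (k z) * (ennreal ((cmod (u (x - z)))\<^sup>2) + ennreal ((cmod (fou \<phi> x))\<^sup>2)) \<partial>lborel)"
        proof (intro nn_integral_mono)
          fix x
          have "cmod (u (x - z)) * cmod (fou \<phi> x) \<le> (cmod (u (x - z)))\<^sup>2 + (cmod (fou \<phi> x))\<^sup>2"
            using sum_squares_bound[of "cmod (u (x - z))" "cmod (fou \<phi> x)"]
              zero_le_power2[of "cmod (u (x - z))"] zero_le_power2[of "cmod (fou \<phi> x)"] by linarith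
          then have "k z * (cmod (u (x - z)) * cmod (fou \<phi> x)) \<le> k z * ((cmod (u (x - z)))\<^sup>2 + (cmod (fou \<phi> x))\<^sup>2)"
            using k(2) by (intro mult_left_mono) auto
          then show "ennreal (norm (F x z)) \<le> ennreal (k z) * (ennreal ((cmod (u (x - z)))\<^sup>2) + ennreal ((cmod (fou \<phi> x))\<^sup>2))"
            using k(2)[of z] by (simp add: F_def norm_mult ennreal_mult[symmetric] ennreal_plus[symmetric] mult.assoc del: ennreal_plus)
        qed
        also have "\<dots> = ennreal (k z) * (nnL2 (\<lambda>x. u (x - z)) + nnL2 (fou \<phi>))"
          unfolding nnL2_def by (subst nn_integral_cmult) (auto simp: nn_integral_add)
        finally show "(\<integral>\<^sup>+x. ennreal (norm (F x z)) \<partial>lborel) \<le> ennreal (k z) * (nnL2 u + nnL2 (fou \<phi>))"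
          by (simp add: nnL2_translate)
      qed
      also have "\<dots> = K * (nnL2 u + nnL2 (fou \<phi>))" unfolding K_def by (rule nn_integral_multc) measurable
      also have "\<dots> < \<infinity>" using K u(1) fou_square_integrable[OF t'] by (simp add: square_integrable_iff ennreal_mult_less_top)
      finally show "(\<integral>\<^sup>+p. ennreal (norm (case_prod F p)) \<partial>(lborel \<Otimes>\<^sub>M lborel)) < \<infinity>" .
    qed
    have U\<phi>: "integrable lborel (\<lambda>\<xi>. U \<xi> * \<phi> \<xi>)" by (rule square_integrable_mult_integrable[OF U t'(2)])
    have "(LINT x|lborel. v x * fou \<phi> x) = (LINT x|lborel. LINT z|lborel. F x z)"
      unfolding v_def F_def by simp
    also have "\<dots> = (LINT z|lborel. LINT x|lborel. F x z)"
      by (rule lborel_pair.Fubini_integral[symmetric, OF Fi])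
    also have "\<dots> = (LINT z|lborel. complex_of_real (k z) * fou (\<lambda>\<xi>. U \<xi> * \<phi> \<xi>) z)"
    proof (intro Bochner_Integration.integral_cong refl)
      fix z
      \<comment> \<open>The translation of u is moved to \<open>fou \<phi>\<close>, and a translated
        transform is the transform of a modulated \<phi>, to which the multiplication formula for u
        applies.\<close>
      have m1: "integrable lborel (\<lambda>y. \<phi> y * cis (- (z \<bullet> y)))" by (intro integrable_mult_cis t') measurable
      have m2: "square_integrable (\<lambda>y. \<phi> y * cis (- (z \<bullet> y)))"
        by (rule square_integrable_bound[OF t'(2)]) (auto simp: norm_mult)
      have "(LINT x|lborel. F x z) = of_real (k z) * (LINT x|lborel. u (x - z) * fou \<phi> x)"
        unfolding F_def by (simp add: mult.assoc)
      also have "(LINT x|lborel. u (x - z) * fou \<phi> x) = (LINT x|lborel. u x * fou \<phi> (x + z))"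
        using integral_lborel_translate[of "\<lambda>x. u (x - z) * fou \<phi> x" z] by (simp add: add.commute)
      also have "\<dots> = (LINT \<xi>|lborel. U \<xi> * (\<phi> \<xi> * cis (- (z \<bullet> \<xi>))))"
        using has_fourier_integral_mult[OF u m2 has_fourier_fou[OF m1 m2]] by (simp add: fou_modulated)
      also have "\<dots> = fou (\<lambda>\<xi>. U \<xi> * \<phi> \<xi>) z" by (simp add: fou_def mult.assoc)
      finally show "(LINT x|lborel. F x z) = complex_of_real (k z) * fou (\<lambda>\<xi>. U \<xi> * \<phi> \<xi>) z" .
    qed
    also have "\<dots> = (LINT \<xi>|lborel. kh \<xi> * (U \<xi> * \<phi> \<xi>))"
      unfolding kh_def by (rule integral_fou_mult[symmetric, OF kc U\<phi>])
    finally show "(LINT x|lborel. kh x * U x * \<phi> x) = (LINT x|lborel. v x * fou \<phi> x)" by (simp add: mult.assoc)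
  qed
  then show ?C by (simp add: v_def[abs_def] kh_def)
qed

section \<open>Truncated singular integrals and their symbols\<close>

definition trunc_kernel :: "real \<Rightarrow> real \<Rightarrow> real ^ 'n \<Rightarrow> real" where
  "trunc_kernel s \<epsilon> z = indicator {z. \<epsilon> < norm z} z * frac_kernel s z"

lemma trunc_kernel_measurable [measurable]: "trunc_kernel s \<epsilon> \<in> borel_measurable borel"
  unfolding trunc_kernel_def[abs_def] by measurable

lemma trunc_kernel_nonneg: "0 \<le> trunc_kernel s \<epsilon> z"
  by (simp add: trunc_kernel_def frac_kernel_nonneg)

definition trunc_symbol :: "real \<Rightarrow> real \<Rightarrow> real ^ 'n \<Rightarrow> real" where
  "trunc_symbol s \<epsilon> \<xi> = (LINT z|lborel. (1 - cos (\<xi> \<bullet> z)) * trunc_kernel s \<epsilon> z)"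

definition trunc_laplacian :: "real \<Rightarrow> real \<Rightarrow> (real ^ 'n \<Rightarrow> complex) \<Rightarrow> real ^ 'n \<Rightarrow> complex" where
  "trunc_laplacian s \<epsilon> u x = of_real (frac_laplacian_const TYPE('n) s) *
     (LINT z|lborel. of_real (trunc_kernel s \<epsilon> z) * (u x - u (x - z)))"

lemma trunc_laplacian_measurable [measurable]:
  assumes [measurable]: "u \<in> borel_measurable borel"
  shows "trunc_laplacian s \<epsilon> u \<in> borel_measurable borel"
  unfolding trunc_laplacian_def[abs_def] by measurable

lemma trunc_laplacian_eq:
  fixes u :: "real ^ 'n \<Rightarrow> complex"
  assumes [measurable]: "u \<in> borel_measurable borel"
  shows "of_real (frac_laplacian_const TYPE('n) s) *
     (LINT y:{y. \<epsilon> < dist x y}|lborel. (u x - u y) / of_real (norm (x - y) powr (real CARD('n) + 2 * s)))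
    = trunc_laplacian s \<epsilon> u x"
proof -
  define f where "f y = indicat_real {y. \<epsilon> < dist x y} y *\<^sub>R ((u x - u y) / of_real (norm (x - y) powr (real CARD('n) + 2 * s)))" for y
  have [measurable]: "f \<in> borel_measurable borel" unfolding f_def by measurable
  have "(LINT y|lborel. f y) = (LINT z|lborel. f (x - z))"
    by (rule integral_lborel_reflect[symmetric]) measurable
  moreover have "f (x - z) = of_real (trunc_kernel s \<epsilon> z) * (u x - u (x - z))" for z
  proof -
    have "frac_kernel s z = inverse (norm z powr (real CARD('n) + 2 * s))"
      unfolding frac_kernel_def by (rule powr_minus)
    then show ?thesis by (simp add: f_def trunc_kernel_def indicator_def dist_norm divide_inverse)
  qed
  ultimately show ?thesis by (simp add: trunc_laplacian_def set_lebesgue_integral_def f_def)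
qed

text \<open>The kernel is even, so the sine part of its transform cancels, and its mass minus its
  transform is the real integral of 1 - cos against it.\<close>

lemma fou_trunc_kernel:
  fixes \<xi> :: "real ^ 'n"
  assumes s: "0 < s" and e: "0 < \<epsilon>"
  shows "of_real (LINT z|lborel. trunc_kernel s \<epsilon> (z :: real ^ 'n)) - fou (\<lambda>z. of_real (trunc_kernel s \<epsilon> z)) \<xi> = of_real (trunc_symbol s \<epsilon> \<xi>)"
proof -
  define k where "k = (trunc_kernel s \<epsilon> :: real ^ 'n \<Rightarrow> real)"
  have k: "integrable lborel k"
    using integrable_frac_kernel_truncated[OF s e, where 'n='n] by (simp add: k_def trunc_kernel_def[abs_def])
  have kc: "integrable lborel (\<lambda>z. complex_of_real (k z))" using k by (rule integrable_of_real)
  have [measurable]: "k \<in> borel_measurable borel" using k by measurable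
  have even: "k (- z) = k z" for z by (simp add: k_def trunc_kernel_def indicator_def)
  have ci: "integrable lborel (\<lambda>z. complex_of_real (k z) * cis (- (\<xi> \<bullet> z)))" for \<xi>
    by (intro integrable_mult_cis kc) measurable
  have kcos: "integrable lborel (\<lambda>z. cos (\<xi> \<bullet> z) * k z)"
    by (rule Bochner_Integration.integrable_bound[OF k]) (auto simp: abs_mult intro!: AE_I2 mult_left_le_one_le)
  have "fou (\<lambda>z. of_real (k z)) \<xi> = fou (\<lambda>z. of_real (k z)) (- \<xi>)"
    using fou_uminus[of "\<lambda>z. complex_of_real (k z)" \<xi>] by (simp add: even)
  then have "2 * fou (\<lambda>z. of_real (k z)) \<xi> = fou (\<lambda>z. of_real (k z)) \<xi> + fou (\<lambda>z. of_real (k z)) (- \<xi>)" by simp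
  also have "\<dots> = (LINT z|lborel. complex_of_real (k z) * cis (- (\<xi> \<bullet> z)) + complex_of_real (k z) * cis (- (- \<xi> \<bullet> z)))"
    unfolding fou_def by (rule Bochner_Integration.integral_add[symmetric, OF ci ci])
  also have "\<dots> = (LINT z|lborel. complex_of_real (2 * (cos (\<xi> \<bullet> z) * k z)))"
    by (intro Bochner_Integration.integral_cong) (auto simp: complex_eq_iff)
  also have "\<dots> = 2 * complex_of_real (LINT z|lborel. cos (\<xi> \<bullet> z) * k z)"
    by (simp only: integral_complex_of_real integral_mult_right_zero) simp
  finally have f: "fou (\<lambda>z. of_real (k z)) \<xi> = complex_of_real (LINT z|lborel. cos (\<xi> \<bullet> z) * k z)" by simp
  have "trunc_symbol s \<epsilon> \<xi> = (LINT z|lborel. k z - cos (\<xi> \<bullet> z) * k z)"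
    by (simp add: trunc_symbol_def k_def left_diff_distrib)
  also have "\<dots> = (LINT z|lborel. k z) - (LINT z|lborel. cos (\<xi> \<bullet> z) * k z)"
    by (rule Bochner_Integration.integral_diff[OF k kcos])
  finally show ?thesis using f by (simp add: k_def)
qed

lemma trunc_laplacian_fourier:
  fixes u :: "real ^ 'n \<Rightarrow> complex"
  assumes s: "0 < s" and e: "0 < \<epsilon>" and u: "square_integrable u" "has_fourier u U"
  shows "square_integrable (trunc_laplacian s \<epsilon> u)"
    and "has_fourier (trunc_laplacian s \<epsilon> u) (\<lambda>\<xi>. of_real (frac_laplacian_const TYPE('n) s * trunc_symbol s \<epsilon> \<xi>) * U \<xi>)"
proof -
  define C where "C = complex_of_real (frac_laplacian_const TYPE('n) s)"
  define k where "k = (trunc_kernel s \<epsilon> :: real ^ 'n \<Rightarrow> real)"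
  have k: "integrable lborel k"
    using integrable_frac_kernel_truncated[OF s e, where 'n='n] by (simp add: k_def trunc_kernel_def[abs_def])
  have k0: "0 \<le> k z" for z by (simp add: k_def trunc_kernel_nonneg)
  have [measurable]: "u \<in> borel_measurable borel" using u by measurable
  define K where "K = complex_of_real (LINT z|lborel. k z)"
  note conv = convolution_fourier[OF k k0 u]
  define v where "v x = (LINT z|lborel. of_real (k z) * u (x - z))" for x
  have v: "square_integrable v" "has_fourier v (\<lambda>\<xi>. fou (\<lambda>z. of_real (k z)) \<xi> * U \<xi>)"
    using conv(2,3) by (simp_all add: v_def[abs_def])
  define w where "w x = C * (K * u x - v x)" for x
  have w: "square_integrable w"
    unfolding w_def by (intro square_integrable_cmult square_integrable_diff u v)
  have wU: "has_fourier w (\<lambda>\<xi>. C * (K * U \<xi> - fou (\<lambda>z. of_real (k z)) \<xi> * U \<xi>))"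
    unfolding w_def by (intro has_fourier_cmult has_fourier_diff square_integrable_cmult square_integrable_diff u v)
  \<comment> \<open>The integral of k(z) (u(x) - u(x - z)) can be split where the convolution
    converges, that is, almost everywhere.\<close>
  have AE: "AE x in lborel. w x = trunc_laplacian s \<epsilon> u x"
    using conv(1)
  proof eventually_elim
    case (elim x)
    have "(LINT z|lborel. of_real (k z) * (u x - u (x - z))) = (LINT z|lborel. of_real (k z) * u x) - v x"
      unfolding v_def right_diff_distrib using elim k by (intro Bochner_Integration.integral_diff) auto
    also have "(LINT z|lborel. of_real (k z) * u x) = K * u x"
      by (simp add: K_def)
    finally show ?case by (simp add: trunc_laplacian_def w_def C_def k_def)
  qed
  show T: "square_integrable (trunc_laplacian s \<epsilon> u)"
    by (rule square_integrable_cong_AE[OF w _ AE]) measurable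
  have "C * (K * U \<xi> - fou (\<lambda>z. of_real (k z)) \<xi> * U \<xi>) = of_real (frac_laplacian_const TYPE('n) s * trunc_symbol s \<epsilon> \<xi>) * U \<xi>" for \<xi>
    using fou_trunc_kernel[OF s e, of \<xi>] unfolding k_def[symmetric] K_def[symmetric]
    by (simp add: C_def left_diff_distrib[symmetric] mult.assoc)
  then show "has_fourier (trunc_laplacian s \<epsilon> u) (\<lambda>\<xi>. of_real (frac_laplacian_const TYPE('n) s * trunc_symbol s \<epsilon> \<xi>) * U \<xi>)"
    using has_fourier_cong_AE_arg[OF w wU T AE] by simp
qed

text \<open>The integrand is nonnegative, so the symbols lie between 0 and their limit, which
  provides domination. Their monotonicity in \<epsilon> reduces the limit along all \<epsilon> to
  the sequence 1 / (k + 1).\<close>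

lemma trunc_symbol_facts:
  fixes \<xi> :: "real ^ 'n"
  assumes s: "0 < s" "s < 1"
  defines "C \<equiv> frac_laplacian_const TYPE('n) s"
  shows "0 \<le> C * trunc_symbol s \<epsilon> \<xi>"
    and "C * trunc_symbol s \<epsilon> \<xi> \<le> norm \<xi> powr (2 * s)"
    and "\<epsilon> \<le> \<delta> \<Longrightarrow> C * trunc_symbol s \<delta> \<xi> \<le> C * trunc_symbol s \<epsilon> \<xi>"
    and "(\<lambda>k. C * trunc_symbol s (1 / real (Suc k)) \<xi>) \<longlonglongrightarrow> norm \<xi> powr (2 * s)"
proof -
  have C: "0 < C" unfolding C_def by (rule frac_laplacian_const_pos[OF s])
  define g where "g z = (1 - cos (\<xi> \<bullet> z)) * frac_kernel s z" for z
  have g0: "0 \<le> g z" for z by (simp add: g_def frac_kernel_nonneg)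
  have [measurable]: "g \<in> borel_measurable borel" unfolding g_def by measurable
  have nn: "(\<integral>\<^sup>+z. ennreal (g z) \<partial>lborel) = ennreal (norm \<xi> powr (2 * s) / C)"
    unfolding g_def C_def by (rule nn_integral_one_minus_cos_frac_kernel[OF s])
  have gi: "integrable lborel g" by (rule integrableI_nonneg) (auto simp: g0 nn)
  have gI: "(LINT z|lborel. g z) = norm \<xi> powr (2 * s) / C"
    using C by (subst integral_eq_nn_integral) (auto simp: g0 nn)
  have t: "trunc_symbol s \<epsilon> \<xi> = (LINT z|lborel. indicator {z. \<epsilon> < norm z} z * g z)" for \<epsilon>
    unfolding trunc_symbol_def trunc_kernel_def g_def by (simp add: mult_ac)
  have ti: "integrable lborel (\<lambda>z. indicator {z. \<epsilon> < norm z} z * g z)" for \<epsilon>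
    by (rule Bochner_Integration.integrable_bound[OF gi]) (auto simp: indicator_def)
  show "0 \<le> C * trunc_symbol s \<epsilon> \<xi>"
    unfolding t using C g0 by (intro mult_nonneg_nonneg integral_nonneg_AE) auto
  have "trunc_symbol s \<epsilon> \<xi> \<le> (LINT z|lborel. g z)"
    unfolding t by (rule Bochner_Integration.integral_mono[OF ti gi]) (auto simp: indicator_def g0)
  then show "C * trunc_symbol s \<epsilon> \<xi> \<le> norm \<xi> powr (2 * s)"
    using C by (simp add: gI field_simps)
  show "C * trunc_symbol s \<delta> \<xi> \<le> C * trunc_symbol s \<epsilon> \<xi>" if "\<epsilon> \<le> \<delta>"
    unfolding t using C that
    by (intro mult_left_mono Bochner_Integration.integral_mono[OF ti ti]) (auto simp: indicator_def g0)
  have "(\<lambda>k. LINT z|lborel. indicator {z. 1 / real (Suc k) < norm z} z * g z) \<longlonglongrightarrow> (LINT z|lborel. g z)"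
  proof (rule integral_dominated_convergence[OF _ _ gi])
    show "AE z in lborel. (\<lambda>k. indicator {z. 1 / real (Suc k) < norm z} z * g z) \<longlonglongrightarrow> g z"
      using AE_lborel_singleton[of "0 :: real ^ 'n"]
    proof eventually_elim
      case (elim z)
      have "\<forall>\<^sub>F k in sequentially. 1 / real (Suc k) < norm z"
        using elim by (intro order_tendstoD(2)[OF lim_1_over_n[THEN LIMSEQ_Suc]]) auto
      then show ?case
        by (intro tendsto_eventually) (auto elim!: eventually_mono simp: indicator_def)
    qed
    show "AE z in lborel. norm (indicator {z. 1 / real (Suc k) < norm z} z * g z) \<le> g z" for k
      by (intro AE_I2) (auto simp: indicator_def g0)
  qed measurable
  then have "(\<lambda>k. trunc_symbol s (1 / real (Suc k)) \<xi>) \<longlonglongrightarrow> norm \<xi> powr (2 * s) / C"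
    unfolding t gI .
  from tendsto_mult_left[OF this, of C]
  show "(\<lambda>k. C * trunc_symbol s (1 / real (Suc k)) \<xi>) \<longlonglongrightarrow> norm \<xi> powr (2 * s)" using C by simp
qed

lemma has_frac_laplacian_of_fourier:
  fixes u :: "real ^ 'n \<Rightarrow> complex"
  assumes s: "0 < s" "s < 1" and u: "square_integrable u" "has_fourier u U"
    and w: "square_integrable w" "has_fourier w (\<lambda>\<xi>. of_real (norm \<xi> powr (2 * s)) * U \<xi>)"
  shows "has_frac_laplacian s u w"
proof -
  have um [measurable]: "u \<in> borel_measurable borel" using u by measurable
  have [measurable]: "U \<in> borel_measurable borel"
    using has_fourier_square_integrable[OF u(2)] by measurable
  define C where "C = frac_laplacian_const TYPE('n) s"
  define W where "W \<xi> = of_real (norm \<xi> powr (2 * s)) * U \<xi>" for \<xi>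
  have W: "square_integrable W" using has_fourier_square_integrable[OF w(2)] by (simp add: W_def[abs_def])
  have [measurable]: "W \<in> borel_measurable borel" using W by measurable
  define M where "M \<epsilon> \<xi> = complex_of_real (C * trunc_symbol s \<epsilon> \<xi>) * U \<xi>" for \<epsilon> \<xi>
  note tf = trunc_symbol_facts[OF s, where 'n='n, folded C_def]
  have [measurable]: "M \<epsilon> \<in> borel_measurable borel" for \<epsilon>
    unfolding M_def trunc_symbol_def by measurable
  have dist: "cmod (M \<epsilon> \<xi> - W \<xi>) = (norm \<xi> powr (2 * s) - C * trunc_symbol s \<epsilon> \<xi>) * cmod (U \<xi>)" for \<epsilon> \<xi>
  proof -
    have "M \<epsilon> \<xi> - W \<xi> = - (complex_of_real (norm \<xi> powr (2 * s) - C * trunc_symbol s \<epsilon> \<xi>) * U \<xi>)"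
      by (simp add: M_def W_def algebra_simps)
    moreover have nn: "0 \<le> norm \<xi> powr (2 * s) - C * trunc_symbol s \<epsilon> \<xi>" using tf(2)[of \<epsilon> \<xi>] by simp
    ultimately show ?thesis by (simp only: norm_minus_cancel norm_mult norm_of_real abs_of_nonneg[OF nn])
  qed
  have "(\<lambda>k. \<integral>\<^sup>+\<xi>. ennreal ((cmod (M (1 / real (Suc k)) \<xi> - W \<xi>))\<^sup>2) \<partial>lborel) \<longlonglongrightarrow> (\<integral>\<^sup>+\<xi>. 0 \<partial>(lborel :: (real ^ 'n) measure))"
  proof (rule nn_integral_dominated_convergence[where w="\<lambda>\<xi>. ennreal ((cmod (W \<xi>))\<^sup>2)"])
    show "(\<integral>\<^sup>+\<xi>. ennreal ((cmod (W \<xi>))\<^sup>2) \<partial>lborel) < \<infinity>"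
      using W by (simp add: square_integrable_iff nnL2_def)
    show "AE \<xi> in lborel. ennreal ((cmod (M (1 / real (Suc k)) \<xi> - W \<xi>))\<^sup>2) \<le> ennreal ((cmod (W \<xi>))\<^sup>2)" for k
    proof (intro AE_I2 ennreal_leI power_mono)
      fix \<xi> :: "real ^ 'n"
      show "cmod (M (1 / real (Suc k)) \<xi> - W \<xi>) \<le> cmod (W \<xi>)"
        unfolding dist using tf(1)[of "1 / real (Suc k)" \<xi>] by (simp add: W_def norm_mult mult_right_mono)
    qed simp
    show "AE \<xi> in lborel. (\<lambda>k. ennreal ((cmod (M (1 / real (Suc k)) \<xi> - W \<xi>))\<^sup>2)) \<longlonglongrightarrow> 0"
    proof (intro AE_I2)
      fix \<xi> :: "real ^ 'n"
      have "(\<lambda>k. ennreal (((norm \<xi> powr (2 * s) - C * trunc_symbol s (1 / real (Suc k)) \<xi>) * cmod (U \<xi>))\<^sup>2)) \<longlonglongrightarrow>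
        ennreal (((norm \<xi> powr (2 * s) - norm \<xi> powr (2 * s)) * cmod (U \<xi>))\<^sup>2)"
        by (intro tendsto_ennrealI tendsto_power tendsto_mult tendsto_diff tendsto_const tf(4))
      then show "(\<lambda>k. ennreal ((cmod (M (1 / real (Suc k)) \<xi> - W \<xi>))\<^sup>2)) \<longlonglongrightarrow> 0" unfolding dist by simp
    qed
  qed measurable
  then have lim: "(\<lambda>k. nnL2 (\<lambda>\<xi>. M (1 / real (Suc k)) \<xi> - W \<xi>)) \<longlonglongrightarrow> 0" by (simp add: nnL2_def)
  \<comment> \<open>The distance to the limit symbol shrinks as \<epsilon> decreases, so one index k
    controls all positive \<epsilon> below 1 / (k + 1).\<close>
  have limM: "((\<lambda>\<epsilon>. nnL2 (\<lambda>\<xi>. M \<epsilon> \<xi> - W \<xi>)) \<longlongrightarrow> 0) (at_right 0)"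
  proof (rule order_tendstoI)
    fix e :: ennreal assume "0 < e"
    then obtain k :: nat where k: "nnL2 (\<lambda>\<xi>. M (1 / real (Suc k)) \<xi> - W \<xi>) < e"
      using order_tendstoD(2)[OF lim] by (auto simp: eventually_sequentially)
    have "\<forall>\<^sub>F \<epsilon> in at_right 0. \<epsilon> < 1 / real (Suc k)"
      using eventually_at_right_real[of 0 "1 / real (Suc k)"] by (auto elim: eventually_mono)
    then show "\<forall>\<^sub>F \<epsilon> in at_right 0. nnL2 (\<lambda>\<xi>. M \<epsilon> \<xi> - W \<xi>) < e"
    proof eventually_elim
      case (elim \<epsilon>)
      have "nnL2 (\<lambda>\<xi>. M \<epsilon> \<xi> - W \<xi>) \<le> nnL2 (\<lambda>\<xi>. M (1 / real (Suc k)) \<xi> - W \<xi>)"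
        unfolding nnL2_def dist
        using tf(3)[OF less_imp_le[OF elim]] tf(2)[of \<epsilon>]
        by (intro nn_integral_mono ennreal_leI power_mono mult_right_mono) auto
      with k show ?case by simp
    qed
  qed simp
  \<comment> \<open>Convergence of the transforms is carried back to the functions by the L^2 bound
    for the inverse transform.\<close>
  have "((\<lambda>\<epsilon>. nnL2 (\<lambda>x. trunc_laplacian s \<epsilon> u x - w x)) \<longlongrightarrow> 0) (at_right 0)"
  proof (rule tendsto_sandwich[OF _ _ tendsto_const ennreal_tendsto_cmult_0[OF _ limM]])
    show "\<forall>\<^sub>F \<epsilon> in at_right 0. nnL2 (\<lambda>x. trunc_laplacian s \<epsilon> u x - w x) \<le> 4 * ennreal ((2 * pi) ^ CARD('n)) * nnL2 (\<lambda>\<xi>. M \<epsilon> \<xi> - W \<xi>)"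
      using eventually_at_right_less[of 0]
    proof eventually_elim
      case (elim \<epsilon>)
      note T = trunc_laplacian_fourier[OF s(1) elim u, folded C_def, folded M_def]
      show ?case
        using nnL2_le_has_fourier[OF square_integrable_diff[OF T(1) w(1)] has_fourier_diff[OF T w[folded W_def]]] .
    qed
  qed (auto simp: ennreal_mult_less_top)
  then have "L2_tendsto (\<lambda>\<epsilon>. trunc_laplacian s \<epsilon> u) w (at_right 0)" by (simp add: L2_tendsto_nnL2)
  with w(1) show ?thesis unfolding has_frac_laplacian_def trunc_laplacian_eq[OF um] by simp
qed

lemma has_frac_laplacian_unique:
  fixes u :: "real ^ 'n \<Rightarrow> complex"
  assumes u: "square_integrable u" and "has_frac_laplacian s u v" "has_frac_laplacian s u w"
  shows "AE x in lborel. v x = w x"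
proof -
  have um [measurable]: "u \<in> borel_measurable borel" using u by measurable
  show ?thesis
    using assms(2,3) unfolding has_frac_laplacian_def trunc_laplacian_eq[OF um]
    by (intro L2_tendsto_unique[of "\<lambda>\<epsilon>. trunc_laplacian s \<epsilon> u" v w "at_right 0"])
      (auto simp: square_integrable_measurable)
qed

section \<open>Gradient and divergence as multipliers\<close>

lemma borel_measurable_vec_nth [measurable (raw)]:
  fixes f :: "'a \<Rightarrow> real ^ 'n"
  shows "f \<in> borel_measurable M \<Longrightarrow> (\<lambda>x. f x $ j) \<in> borel_measurable M"
  by (erule measurable_compose) (intro borel_measurable_continuous_onI continuous_intros)

lemma borel_measurable_ipow [measurable (raw)]:
  "f \<in> borel_measurable M \<Longrightarrow> (\<lambda>x. ipow s (f x)) \<in> borel_measurable M"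
  by (erule measurable_compose) (rule ipow_measurable)

text \<open>The functions \<open>F \<theta>\<close> need not be jointly measurable, so Fubini is
  applied to the explicit symbols N, and the pairings are compared for each \<theta> separately
  through the multiplication formula. The second conclusion serves to identify sphere integrals, the
  third to produce them.\<close>

lemma sphere_integral_fourier:
  fixes N :: "real ^ 'n \<Rightarrow> real ^ 'n \<Rightarrow> complex" and F :: "real ^ 'n \<Rightarrow> real ^ 'n \<Rightarrow> complex"
  assumes Nm: "case_prod N \<in> borel_measurable (borel \<Otimes>\<^sub>M borel)"
    and B: "square_integrable B" and bound: "\<forall>\<theta> \<xi>. norm \<theta> = 1 \<longrightarrow> cmod (N \<theta> \<xi>) \<le> cmod (B \<xi>)"
    and F_N: "\<forall>\<theta>. norm \<theta> = 1 \<longrightarrow> square_integrable (F \<theta>) \<and> has_fourier (F \<theta>) (N \<theta>)"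
  defines "G \<equiv> \<lambda>\<xi>. LINT \<theta>|sphere_measure. N \<theta> \<xi>"
  shows "square_integrable G"
    and "has_sphere_integral F g \<Longrightarrow> square_integrable g \<and> has_fourier g G"
    and "\<forall>\<theta>. norm \<theta> \<noteq> 1 \<longrightarrow> F \<theta> = (\<lambda>x. 0) \<Longrightarrow> square_integrable g \<Longrightarrow> has_fourier g G \<Longrightarrow> has_sphere_integral F g"
proof -
  interpret P: pair_sigma_finite "sphere_measure :: (real ^ 'n) measure" "lborel :: (real ^ 'n) measure" ..
  have le: "cmod (N \<theta> \<xi>) \<le> cmod (B \<xi>)" if "norm \<theta> = 1" for \<theta> \<xi> using bound that by blast
  have F: "square_integrable (F \<theta>)" "has_fourier (F \<theta>) (N \<theta>)" if "norm \<theta> = 1" for \<theta> using F_N that by blast+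
  note [measurable] = Nm
  have Bm [measurable]: "B \<in> borel_measurable borel" using B by measurable
  \<comment> \<open>\<open>sphere_measure\<close> lives on all of R^n, while N is bounded only for
    unit \<theta>. Cutting N off elsewhere gives a domination valid for every \<theta> without
    changing the integral.\<close>
  define N' where "N' \<theta> \<xi> = indicator (sphere 0 1) \<theta> * N \<theta> \<xi>" for \<theta> \<xi>
  have ind [measurable]: "(indicator (sphere 0 1) :: real ^ 'n \<Rightarrow> complex) \<in> borel_measurable borel"
    by (rule borel_measurable_indicator) simp
  have N'm: "case_prod N' \<in> borel_measurable (borel \<Otimes>\<^sub>M borel)" unfolding N'_def by measurable
  have N'm2: "case_prod N' \<in> borel_measurable (sphere_measure \<Otimes>\<^sub>M lborel)"
    using N'm by (simp cong: measurable_cong_sets sets_pair_measure_cong)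
  have N'1: "N' \<theta> \<xi> = N \<theta> \<xi>" if "norm \<theta> = 1" for \<theta> \<xi> using that by (simp add: N'_def)
  have N'0: "N' \<theta> \<xi> = 0" if "norm \<theta> \<noteq> 1" for \<theta> \<xi> using that by (simp add: N'_def indicator_def)
  have N'le: "cmod (N' \<theta> \<xi>) \<le> cmod (B \<xi>)" for \<theta> \<xi>
    using le[of \<theta> \<xi>] by (cases "norm \<theta> = 1") (auto simp: N'1 N'0)
  have G': "G \<xi> = (LINT \<theta>|sphere_measure. N' \<theta> \<xi>)" for \<xi>
    unfolding G_def using AE_sphere_measure
    by (intro integral_cong_AE) (use Nm N'm in \<open>auto elim!: eventually_mono simp: N'1\<close>)
  have Gm [measurable]: "G \<in> borel_measurable borel" unfolding G_def by measurable
  show G: "square_integrable G"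
  proof (rule square_integrable_bound[OF square_integrable_cmult[OF B, of "of_real (measure (sphere_measure :: (real ^ 'n) measure) UNIV)"] Gm])
    fix \<xi> :: "real ^ 'n"
    have "cmod (G \<xi>) \<le> (LINT \<theta>|(sphere_measure :: (real ^ 'n) measure). cmod (B \<xi>))"
      unfolding G'
      by (rule Bochner_Integration.integral_norm_bound_integral)
        (use N'm N'le in \<open>auto intro!: integrable_sphere_bounded\<close>)
    then show "cmod (G \<xi>) \<le> cmod (of_real (measure (sphere_measure :: (real ^ 'n) measure) UNIV) * B \<xi>)"
      by (simp add: norm_mult)
  qed
  have key: "has_bochner_integral sphere_measure (\<lambda>\<theta>. LINT \<xi>|lborel. N' \<theta> \<xi> * k \<xi>) (LINT \<xi>|lborel. G \<xi> * k \<xi>)"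
    if k: "square_integrable k" for k
  proof -
    have [measurable]: "k \<in> borel_measurable borel" using k by measurable
    have "integrable (sphere_measure \<Otimes>\<^sub>M lborel) (\<lambda>(\<theta>, \<xi>). N' \<theta> \<xi> * k \<xi>)"
    proof (rule P.integrable_pair_bound[where a="\<lambda>_. 1" and b="\<lambda>\<xi>. B \<xi> * k \<xi>"])
      show "(\<lambda>(\<theta>, \<xi>). N' \<theta> \<xi> * k \<xi>) \<in> borel_measurable (sphere_measure \<Otimes>\<^sub>M lborel)"
        using N'm2 by measurable
      show "integrable lborel (\<lambda>\<xi>. B \<xi> * k \<xi>)" by (rule square_integrable_mult_integrable[OF B k])
      show "cmod (N' \<theta> \<xi> * k \<xi>) \<le> norm (1 :: complex) * norm (B \<xi> * k \<xi>)" for \<theta> \<xi>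
        using N'le[of \<theta> \<xi>] by (simp add: norm_mult mult_right_mono)
    qed simp
    note i = this
    have "(LINT \<theta>|sphere_measure. LINT \<xi>|lborel. N' \<theta> \<xi> * k \<xi>) = (LINT \<xi>|lborel. LINT \<theta>|sphere_measure. N' \<theta> \<xi> * k \<xi>)"
      by (rule P.Fubini_integral[symmetric, OF i])
    also have "\<dots> = (LINT \<xi>|lborel. G \<xi> * k \<xi>)" unfolding G' by simp
    finally show ?thesis using P.integrable_fst[OF i] by (simp add: has_bochner_integral_iff)
  qed
  show "square_integrable g \<and> has_fourier g G" if g: "has_sphere_integral F g"
  proof (rule conjI)
    show g2: "square_integrable g" using g by (simp add: has_sphere_integral_def)
    show "has_fourier g G"
    proof (rule has_fourierI_weak[OF g2 G])
      fix \<phi> :: "real ^ 'n \<Rightarrow> complex" assume t: "test_function \<phi>"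
      note t' = test_functionD(4,5)[OF t]
      have hb: "has_bochner_integral sphere_measure (\<lambda>\<theta>. LINT x|lborel. F \<theta> x * fou \<phi> x) (LINT x|lborel. g x * fou \<phi> x)"
        using g fou_square_integrable[OF t'] by (simp add: has_sphere_integral_def)
      note kb = key[OF t'(2)]
      have "(LINT \<theta>|sphere_measure. LINT \<xi>|lborel. N' \<theta> \<xi> * \<phi> \<xi>) = (LINT \<theta>|sphere_measure. LINT x|lborel. F \<theta> x * fou \<phi> x)"
      proof (rule integral_cong_AE)
        show "(\<lambda>\<theta>. LINT \<xi>|lborel. N' \<theta> \<xi> * \<phi> \<xi>) \<in> borel_measurable sphere_measure"
          using kb by (auto simp: has_bochner_integral_iff dest: borel_measurable_integrable)
        show "(\<lambda>\<theta>. LINT x|lborel. F \<theta> x * fou \<phi> x) \<in> borel_measurable sphere_measure"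
          using hb by (auto simp: has_bochner_integral_iff dest: borel_measurable_integrable)
        show "AE \<theta> in sphere_measure. (LINT \<xi>|lborel. N' \<theta> \<xi> * \<phi> \<xi>) = (LINT x|lborel. F \<theta> x * fou \<phi> x)"
          using AE_sphere_measure
        proof eventually_elim
          case (elim \<theta>)
          then show ?case using has_fourier_test_function[OF F(1)[OF elim] F(2)[OF elim] t] by (simp add: N'1)
        qed
      qed
      then show "(LINT x|lborel. G x * \<phi> x) = (LINT x|lborel. g x * fou \<phi> x)"
        using hb kb by (simp add: has_bochner_integral_iff)
    qed
  qed
  \<comment> \<open>As \<open>F \<theta>\<close> is 0 off the sphere, the pairings agree for every
    \<theta> and not just for almost every one, so measurability in \<theta> is inherited from the
    symbols.\<close>
  show "has_sphere_integral F g" if F0: "\<forall>\<theta>. norm \<theta> \<noteq> 1 \<longrightarrow> F \<theta> = (\<lambda>x. 0)" and g: "square_integrable g" "has_fourier g G"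
    unfolding has_sphere_integral_def
  proof (intro conjI ballI allI impI)
    show "square_integrable g" by fact
    show "square_integrable (F \<theta>)" if "\<theta> \<in> sphere 0 1" for \<theta> using F(1) that by simp
    fix h :: "real ^ 'n \<Rightarrow> complex" assume h: "square_integrable h"
    \<comment> \<open>Testing against all of L^2 is possible because every h is itself a transform;
      the multiplication formula then exchanges h for k.\<close>
    obtain k where k: "square_integrable k" "has_fourier k h" using has_fourier_surj[OF h] by blast
    have "(LINT \<xi>|lborel. N' \<theta> \<xi> * k \<xi>) = (LINT x|lborel. F \<theta> x * h x)" for \<theta>
    proof (cases "norm \<theta> = 1")
      case True
      then show ?thesis using has_fourier_integral_mult[OF F(1)[OF True] F(2)[OF True] k] by (simp add: N'1)
    qed (simp add: N'0 F0)
    moreover have "(LINT \<xi>|lborel. G \<xi> * k \<xi>) = (LINT x|lborel. g x * h x)"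
      by (rule has_fourier_integral_mult[OF g k])
    ultimately show "has_bochner_integral sphere_measure (\<lambda>\<theta>. LINT x|lborel. F \<theta> x * h x) (LINT x|lborel. g x * h x)"
      using key[OF k(1)] by simp
  qed
qed

section \<open>Bounds for the symbols and multiplier form of the operators\<close>

lemma sphere_multiplier_measurable [measurable]: "sphere_multiplier s j \<in> borel_measurable borel"
  unfolding sphere_multiplier_def[abs_def] by measurable

lemma norm_sphere_multiplier_le:
  fixes \<xi> :: "real ^ 'n"
  assumes s: "0 < s"
  shows "cmod (sphere_multiplier s j \<xi>) \<le> sphere_const TYPE('n) s * norm \<xi> powr s"
proof -
  have "(norm (sphere_moment s \<xi>))\<^sup>2 = (sphere_const TYPE('n) s * norm \<xi> powr s)\<^sup>2"
    unfolding norm_sphere_moment[OF s] by (simp add: power_mult_distrib power2_eq_square powr_add[symmetric])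
  moreover have "0 \<le> sphere_const TYPE('n) s * norm \<xi> powr s"
    using sphere_const_pos[OF s, where 'n='n] by (intro mult_nonneg_nonneg) simp_all
  ultimately have "norm (sphere_moment s \<xi>) = sphere_const TYPE('n) s * norm \<xi> powr s"
    by (rule power2_eq_imp_eq[OF _ norm_ge_zero])
  moreover have "cmod (sphere_multiplier s j \<xi>) = \<bar>sin (pi * s / 2)\<bar> * \<bar>sphere_moment s \<xi> $ j\<bar>"
    unfolding sphere_multiplier_eq[OF s] by (simp add: norm_mult abs_mult)
  moreover have "\<dots> \<le> 1 * norm (sphere_moment s \<xi>)"
    by (intro mult_mono component_le_norm_cart) auto
  ultimately show ?thesis by simp
qed

lemma norm_ipow_inner_le:
  assumes "0 < s" "norm \<theta> = 1"
  shows "cmod (ipow s (\<theta> \<bullet> \<xi>)) \<le> norm \<xi> powr s"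
  using powr_abs_inner_le[OF assms] by (simp add: norm_ipow)

text \<open>Used with r = s for the gradient and with r = 2 s for the divergence of the gradient and
  the fractional Laplacian.\<close>

lemma sobolev_weight:
  fixes U :: "real ^ 'n \<Rightarrow> complex"
  assumes U: "square_integrable U" "square_integrable (\<lambda>\<xi>. of_real ((1 + (norm \<xi>)\<^sup>2) powr (2 * s / 2)) * U \<xi>)"
    and r: "0 \<le> r" "r \<le> 2 * s"
  shows "square_integrable (\<lambda>\<xi>. of_real (norm \<xi> powr r) * U \<xi>)"
proof (rule square_integrable_bound[OF U(2)])
  have [measurable]: "U \<in> borel_measurable borel" using U by measurable
  show "(\<lambda>\<xi>. of_real (norm \<xi> powr r) * U \<xi>) \<in> borel_measurable borel" by measurable
  fix \<xi> :: "real ^ 'n"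
  have "norm \<xi> powr r = ((norm \<xi>)\<^sup>2) powr (r / 2)"
  proof (cases "\<xi> = 0")
    case False
    then have "(norm \<xi>)\<^sup>2 = norm \<xi> powr 2" by (simp add: powr_numeral)
    then have "((norm \<xi>)\<^sup>2) powr (r / 2) = norm \<xi> powr (2 * (r / 2))" by (simp only: powr_powr)
    then show ?thesis by simp
  qed simp
  also have "\<dots> \<le> (1 + (norm \<xi>)\<^sup>2) powr (r / 2)" using r by (intro powr_mono2) auto
  also have "\<dots> \<le> (1 + (norm \<xi>)\<^sup>2) powr (2 * s / 2)" using r by (intro powr_mono) auto
  finally show "cmod (of_real (norm \<xi> powr r) * U \<xi>) \<le> cmod (of_real ((1 + (norm \<xi>)\<^sup>2) powr (2 * s / 2)) * U \<xi>)"
    by (simp add: norm_mult mult_right_mono)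
qed

text \<open>Existence and identification are separate because \<open>Grad\<close> is a choice: the
  second part has to hold for every function satisfying \<open>has_Grad\<close>.\<close>

lemma Grad_fourier:
  fixes u :: "real ^ 'n \<Rightarrow> complex"
  assumes s: "0 < s" "s < 1" and u: "square_integrable u" "has_fourier u U"
    and Us: "square_integrable (\<lambda>\<xi>. of_real (norm \<xi> powr s) * U \<xi>)"
  shows "\<exists>g. has_Grad s u g"
    and "has_Grad s u g \<Longrightarrow> square_integrable (\<lambda>x. g x $ j)
      \<and> has_fourier (\<lambda>x. g x $ j) (\<lambda>\<xi>. sphere_multiplier s j \<xi> * U \<xi>)"
proof -
  have [measurable]: "U \<in> borel_measurable borel"
    using has_fourier_square_integrable[OF u(2)] by measurable
  define V where "V \<theta> \<xi> = ipow s (\<theta> \<bullet> \<xi>) * U \<xi>" for \<theta> \<xi>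
  have Vle: "cmod (V \<theta> \<xi>) \<le> cmod (of_real (norm \<xi> powr s) * U \<xi>)" if "norm \<theta> = 1" for \<theta> \<xi>
    using norm_ipow_inner_le[OF s(1) that, of \<xi>] by (simp add: V_def norm_mult mult_right_mono)
  have V: "square_integrable (V \<theta>)" if "norm \<theta> = 1" for \<theta>
    by (rule square_integrable_bound[OF Us _ Vle[OF that]]) (simp add: V_def[abs_def])
  have iff: "has_frac_deriv s \<theta> u v \<longleftrightarrow> square_integrable v \<and> has_fourier v (V \<theta>)" if "norm \<theta> = 1" for \<theta> v
    using has_frac_deriv_iff[OF s that u] V[OF that] by (simp add: V_def[abs_def])
  define N where "N j \<theta> \<xi> = of_real (\<theta> $ j) * V \<theta> \<xi>" for j \<theta> \<xi>
  have Nm: "case_prod (N j) \<in> borel_measurable (borel \<Otimes>\<^sub>M borel)" for j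
    unfolding N_def V_def by measurable
  have Nle: "cmod (N j \<theta> \<xi>) \<le> cmod (of_real (norm \<xi> powr s) * U \<xi>)" if "norm \<theta> = 1" for j \<theta> \<xi>
  proof -
    have "\<bar>\<theta> $ j\<bar> \<le> 1" using component_le_norm_cart[of \<theta> j] that by simp
    then have "cmod (N j \<theta> \<xi>) \<le> 1 * cmod (V \<theta> \<xi>)"
      unfolding N_def norm_mult norm_of_real by (intro mult_right_mono) auto
    with Vle[OF that, of \<xi>] show ?thesis by simp
  qed
  have Nint: "(LINT \<theta>|sphere_measure. N j \<theta> \<xi>) = sphere_multiplier s j \<xi> * U \<xi>" for j \<xi>
    unfolding N_def V_def sphere_multiplier_def by (simp add: mult.assoc[symmetric])
  have bound: "\<forall>\<theta> \<xi>. norm \<theta> = 1 \<longrightarrow> cmod (N j \<theta> \<xi>) \<le> cmod (of_real (norm \<xi> powr s) * U \<xi>)" for j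
    using Nle by blast
  note sif = sphere_integral_fourier[OF Nm Us bound, unfolded Nint]
  have FN: "square_integrable (\<lambda>x. of_real (\<theta> $ j) * F x)" "has_fourier (\<lambda>x. of_real (\<theta> $ j) * F x) (N j \<theta>)"
    if "square_integrable F" "has_fourier F (V \<theta>)" for F \<theta> j
    using that by (auto simp: N_def[abs_def] intro: square_integrable_cmult has_fourier_cmult)
  show "square_integrable (\<lambda>x. g x $ j) \<and> has_fourier (\<lambda>x. g x $ j) (\<lambda>\<xi>. sphere_multiplier s j \<xi> * U \<xi>)" if g: "has_Grad s u g"
  proof -
    obtain F where F: "\<forall>\<theta>\<in>sphere 0 1. has_frac_deriv s \<theta> u (F \<theta>)"
      and I: "\<forall>j. has_sphere_integral (\<lambda>\<theta> x. of_real (\<theta> $ j) * F \<theta> x) (\<lambda>x. g x $ j)"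
      using g unfolding has_Grad_def by blast
    have "\<forall>\<theta>. norm \<theta> = 1 \<longrightarrow> square_integrable (F \<theta>) \<and> has_fourier (F \<theta>) (V \<theta>)"
      using F iff by simp
    then have "\<forall>\<theta>. norm \<theta> = 1 \<longrightarrow> square_integrable (\<lambda>x. of_real (\<theta> $ j) * F \<theta> x) \<and> has_fourier (\<lambda>x. of_real (\<theta> $ j) * F \<theta> x) (N j \<theta>)"
      using FN by blast
    from sif(2)[OF this I[rule_format]] show ?thesis .
  qed
  have "\<exists>v. square_integrable v \<and> has_fourier v (V \<theta>)" if "norm \<theta> = 1" for \<theta>
    by (rule has_fourier_surj[OF V[OF that]])
  then obtain f where f: "\<And>\<theta>. norm \<theta> = 1 \<Longrightarrow> square_integrable (f \<theta>) \<and> has_fourier (f \<theta>) (V \<theta>)"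
    by metis
  \<comment> \<open>The derivatives are chosen for each unit vector without regard to measurability;
    the value 0 elsewhere meets the requirement of \<open>sphere_integral_fourier\<close>.\<close>
  define F where "F \<theta> = (if norm \<theta> = 1 then f \<theta> else (\<lambda>x. 0))" for \<theta>
  have F: "square_integrable (F \<theta>)" "has_fourier (F \<theta>) (V \<theta>)" if "norm \<theta> = 1" for \<theta>
    using f[OF that] that by (auto simp: F_def)
  have FF: "\<forall>\<theta>. norm \<theta> = 1 \<longrightarrow> square_integrable (\<lambda>x. of_real (\<theta> $ j) * F \<theta> x) \<and> has_fourier (\<lambda>x. of_real (\<theta> $ j) * F \<theta> x) (N j \<theta>)" for j
    using FN F by blast
  have "square_integrable (\<lambda>\<xi>. sphere_multiplier s j \<xi> * U \<xi>)" for j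
    by (rule sif(1)[OF FF])
  then have "\<exists>v. square_integrable v \<and> has_fourier v (\<lambda>\<xi>. sphere_multiplier s j \<xi> * U \<xi>)" for j
    by (rule has_fourier_surj)
  then obtain w where w: "\<And>j. square_integrable (w j)" "\<And>j. has_fourier (w j) (\<lambda>\<xi>. sphere_multiplier s j \<xi> * U \<xi>)"
    by metis
  have "has_Grad s u (\<lambda>x. \<chi> j. w j x)"
    unfolding has_Grad_def
  proof (intro exI[of _ F] conjI ballI allI)
    show "has_frac_deriv s \<theta> u (F \<theta>)" if "\<theta> \<in> sphere 0 1" for \<theta>
      using that iff F by simp
    show "has_sphere_integral (\<lambda>\<theta> x. of_real (\<theta> $ j) * F \<theta> x) (\<lambda>x. (\<chi> j. w j x) $ j)" for j
    proof -
      have "has_sphere_integral (\<lambda>\<theta> x. of_real (\<theta> $ j) * F \<theta> x) (w j)"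
        by (rule sif(3)[OF FF _ w]) (auto simp: F_def)
      then show ?thesis by simp
    qed
  qed
  then show "\<exists>g. has_Grad s u g" by blast
qed

text \<open>The field enters through the transforms of its components. The symbol of the gradient
  and that of the derivative are both of order s, so the bound is a multiple of |\<xi>|^(2 s) |U|,
  and the full Sobolev order 2 s is used.\<close>

lemma Div_fourier:
  fixes g :: "real ^ 'n \<Rightarrow> complex ^ 'n"
  assumes s: "0 < s" "s < 1"
    and g: "\<And>j. square_integrable (\<lambda>x. g x $ j)" "\<And>j. has_fourier (\<lambda>x. g x $ j) (\<lambda>\<xi>. sphere_multiplier s j \<xi> * U \<xi>)"
    and Um [measurable]: "U \<in> borel_measurable borel"
    and U2s: "square_integrable (\<lambda>\<xi>. of_real (norm \<xi> powr (2 * s)) * U \<xi>)"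
  shows "\<exists>d. has_Div s g d"
    and "has_Div s g d \<Longrightarrow> square_integrable d
      \<and> has_fourier d (\<lambda>\<xi>. of_real (grad_div_const TYPE('n) s * norm \<xi> powr (2 * s)) * U \<xi>)"
proof -
  define \<kappa> where "\<kappa> = sphere_const TYPE('n) s"
  have \<kappa>: "0 < \<kappa>" unfolding \<kappa>_def by (rule sphere_const_pos[OF s(1)])
  define V where "V j \<theta> \<xi> = ipow s (\<theta> \<bullet> \<xi>) * (sphere_multiplier s j \<xi> * U \<xi>)" for j \<theta> \<xi>
  \<comment> \<open>The majorant of the sum over all components, whence the factor n;
    \<open>B1\<close> bounds a single component.\<close>
  define B where "B \<xi> = of_real (real CARD('n) * \<kappa>) * (of_real (norm \<xi> powr (2 * s)) * U \<xi>)" for \<xi>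
  define B1 where "B1 \<xi> = of_real \<kappa> * (of_real (norm \<xi> powr (2 * s)) * U \<xi>)" for \<xi>
  have B: "square_integrable B" unfolding B_def by (intro square_integrable_cmult U2s)
  have B1: "square_integrable B1" unfolding B1_def by (intro square_integrable_cmult U2s)
  have Vle: "cmod (V j \<theta> \<xi>) \<le> cmod (B1 \<xi>)" if "norm \<theta> = 1" for j \<theta> \<xi>
  proof -
    have "cmod (V j \<theta> \<xi>) \<le> norm \<xi> powr s * ((\<kappa> * norm \<xi> powr s) * cmod (U \<xi>))"
      unfolding V_def norm_mult \<kappa>_def
      by (intro mult_mono norm_ipow_inner_le[OF s(1) that] norm_sphere_multiplier_le[OF s(1)])
        (use \<kappa> in \<open>simp_all add: \<kappa>_def\<close>)
    also have "\<dots> = \<kappa> * ((norm \<xi> powr s * norm \<xi> powr s) * cmod (U \<xi>))" by (simp only: mult_ac)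
    also have "norm \<xi> powr s * norm \<xi> powr s = norm \<xi> powr (2 * s)" by (simp add: powr_add[symmetric])
    also have "\<kappa> * (norm \<xi> powr (2 * s) * cmod (U \<xi>)) = cmod (B1 \<xi>)"
      using \<kappa> by (simp add: B1_def norm_mult)
    finally show ?thesis .
  qed
  have Vm [measurable]: "V j \<theta> \<in> borel_measurable borel" for j \<theta>
    unfolding V_def by measurable
  have V: "square_integrable (V j \<theta>)" if "norm \<theta> = 1" for j \<theta>
    by (rule square_integrable_bound[OF B1 Vm Vle[OF that]])
  have iff: "has_frac_deriv s \<theta> (\<lambda>x. g x $ j) v \<longleftrightarrow> square_integrable v \<and> has_fourier v (V j \<theta>)" if "norm \<theta> = 1" for \<theta> v j
    using has_frac_deriv_iff[OF s that g(1)[of j] g(2)[of j]] V[OF that, of j] by (simp add: V_def[abs_def])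
  define N where "N \<theta> \<xi> = (\<Sum>j\<in>UNIV. of_real (\<theta> $ j) * V j \<theta> \<xi>)" for \<theta> \<xi>
  have Nm: "case_prod N \<in> borel_measurable (borel \<Otimes>\<^sub>M borel)"
    unfolding N_def V_def by measurable
  have Nle: "cmod (N \<theta> \<xi>) \<le> cmod (B \<xi>)" if "norm \<theta> = 1" for \<theta> \<xi>
  proof -
    have "cmod (N \<theta> \<xi>) \<le> (\<Sum>j\<in>(UNIV :: 'n set). cmod (B1 \<xi>))"
      unfolding N_def
    proof (rule sum_norm_le)
      fix j
      have "\<bar>\<theta> $ j\<bar> \<le> 1" using component_le_norm_cart[of \<theta> j] that by simp
      then have "cmod (of_real (\<theta> $ j) * V j \<theta> \<xi>) \<le> 1 * cmod (V j \<theta> \<xi>)"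
        unfolding norm_mult norm_of_real by (intro mult_right_mono) auto
      with Vle[OF that, of j \<xi>] show "norm (of_real (\<theta> $ j) * V j \<theta> \<xi>) \<le> cmod (B1 \<xi>)" by simp
    qed
    also have "\<dots> = cmod (B \<xi>)" by (simp add: B_def B1_def norm_mult)
    finally show ?thesis .
  qed
  \<comment> \<open>The transform of each component of g does not depend on \<theta>, so integrating
    over the sphere produces the same symbol a second time: its square appears, without
    conjugation.\<close>
  have Nint: "(LINT \<theta>|sphere_measure. N \<theta> \<xi>) = of_real (grad_div_const TYPE('n) s * norm \<xi> powr (2 * s)) * U \<xi>" for \<xi>
  proof -
    have "N \<theta> \<xi> = (\<Sum>j\<in>UNIV. (of_real (\<theta> $ j) * ipow s (\<theta> \<bullet> \<xi>)) * (sphere_multiplier s j \<xi> * U \<xi>))" for \<theta>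
      by (simp add: N_def V_def mult.assoc)
    then have "(LINT \<theta>|sphere_measure. N \<theta> \<xi>) = (LINT \<theta>|sphere_measure. (\<Sum>j\<in>UNIV. (of_real (\<theta> $ j) * ipow s (\<theta> \<bullet> \<xi>)) * (sphere_multiplier s j \<xi> * U \<xi>)))"
      by simp
    also have "\<dots> = (\<Sum>j\<in>UNIV. sphere_multiplier s j \<xi> * (sphere_multiplier s j \<xi> * U \<xi>))"
      by (subst Bochner_Integration.integral_sum)
        (simp_all only: integrable_mult_left[OF integrable_sphere_multiplier[OF s(1)]] integral_mult_left_zero sphere_multiplier_def)
    also have "\<dots> = (\<Sum>j\<in>UNIV. (sphere_multiplier s j \<xi>)\<^sup>2) * U \<xi>"
      by (simp add: sum_distrib_right power2_eq_square mult.assoc)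
    finally show ?thesis by (simp only: sum_sphere_multiplier_square[OF s(1)])
  qed
  have bound: "\<forall>\<theta> \<xi>. norm \<theta> = 1 \<longrightarrow> cmod (N \<theta> \<xi>) \<le> cmod (B \<xi>)"
    using Nle by blast
  note sif = sphere_integral_fourier[OF Nm B bound, unfolded Nint]
  have FN: "square_integrable (\<lambda>x. \<Sum>j\<in>UNIV. of_real (\<theta> $ j) * F j x)" "has_fourier (\<lambda>x. \<Sum>j\<in>UNIV. of_real (\<theta> $ j) * F j x) (N \<theta>)"
    if "\<And>j. square_integrable (F j)" "\<And>j. has_fourier (F j) (V j \<theta>)" for F \<theta>
    using that
    by (auto simp: N_def[abs_def] intro!: square_integrable_sum has_fourier_sum square_integrable_cmult has_fourier_cmult)
  show "square_integrable d \<and> has_fourier d (\<lambda>\<xi>. of_real (grad_div_const TYPE('n) s * norm \<xi> powr (2 * s)) * U \<xi>)"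
    if d: "has_Div s g d"
  proof -
    obtain F where F: "\<forall>\<theta>\<in>sphere 0 1. \<forall>j. has_frac_deriv s \<theta> (\<lambda>x. g x $ j) (\<lambda>x. F \<theta> x $ j)"
      and I: "has_sphere_integral (\<lambda>\<theta> x. \<Sum>j\<in>UNIV. of_real (\<theta> $ j) * F \<theta> x $ j) d"
      using d unfolding has_Div_def by blast
    have V: "square_integrable (\<lambda>x. F \<theta> x $ j)" "has_fourier (\<lambda>x. F \<theta> x $ j) (V j \<theta>)" if "norm \<theta> = 1" for \<theta> j
      using F iff that by simp_all
    have "\<forall>\<theta>. norm \<theta> = 1 \<longrightarrow> square_integrable (\<lambda>x. \<Sum>j\<in>UNIV. of_real (\<theta> $ j) * F \<theta> x $ j)
        \<and> has_fourier (\<lambda>x. \<Sum>j\<in>UNIV. of_real (\<theta> $ j) * F \<theta> x $ j) (N \<theta>)"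
      using FN[OF V] by blast
    from sif(2)[OF this I] show ?thesis .
  qed
  have "\<forall>j \<theta>. \<exists>v. norm \<theta> = 1 \<longrightarrow> square_integrable v \<and> has_fourier v (V j \<theta>)"
    using has_fourier_surj[OF V] by blast
  then obtain f where f: "norm \<theta> = 1 \<Longrightarrow> square_integrable (f j \<theta>) \<and> has_fourier (f j \<theta>) (V j \<theta>)" for j \<theta>
    by metis
  define F where "F \<theta> x = (\<chi> j. if norm \<theta> = 1 then f j \<theta> x else 0)" for \<theta> x
  have F: "square_integrable (\<lambda>x. F \<theta> x $ j)" "has_fourier (\<lambda>x. F \<theta> x $ j) (V j \<theta>)" if "norm \<theta> = 1" for \<theta> j
    using f[OF that] that by (auto simp: F_def)
  have FF: "\<forall>\<theta>. norm \<theta> = 1 \<longrightarrow> square_integrable (\<lambda>x. \<Sum>j\<in>UNIV. of_real (\<theta> $ j) * F \<theta> x $ j)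
      \<and> has_fourier (\<lambda>x. \<Sum>j\<in>UNIV. of_real (\<theta> $ j) * F \<theta> x $ j) (N \<theta>)"
    using FN[OF F] by blast
  have sq: "square_integrable (\<lambda>\<xi>. of_real (grad_div_const TYPE('n) s * norm \<xi> powr (2 * s)) * U \<xi>)"
    by (rule sif(1)[OF FF])
  from has_fourier_surj[OF sq] obtain w where w: "square_integrable w"
      "has_fourier w (\<lambda>\<xi>. of_real (grad_div_const TYPE('n) s * norm \<xi> powr (2 * s)) * U \<xi>)" by blast
  have "has_Div s g w"
    unfolding has_Div_def
  proof (intro exI[of _ F] conjI ballI allI)
    show "has_frac_deriv s \<theta> (\<lambda>x. g x $ j) (\<lambda>x. F \<theta> x $ j)" if "\<theta> \<in> sphere 0 1" for \<theta> j
      using that iff F by simp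
    show "has_sphere_integral (\<lambda>\<theta> x. \<Sum>j\<in>UNIV. of_real (\<theta> $ j) * F \<theta> x $ j) w"
      by (rule sif(3)[OF FF _ w]) (auto simp: F_def)
  qed
  then show "\<exists>d. has_Div s g d" by blast
qed

theorem theorem3p2:
  fixes s :: real and u :: "real ^ 'n \<Rightarrow> complex"
  assumes "0 < s" and "s < 1" and "u \<in> sobolev (2 * s)"
  shows "\<exists>D::real. D < 0 \<and>
    (\<forall>D'::real.
       (\<forall>\<xi>::real ^ 'n.
          (LINT \<theta>|sphere_measure. LINT \<theta>'|sphere_measure.
             of_real (\<theta> \<bullet> \<theta>') * ipow s (\<theta> \<bullet> \<xi>) * ipow s (\<theta>' \<bullet> \<xi>))
          = of_real (D' * norm \<xi> powr (2 * s))) \<longleftrightarrow> D' = D) \<and>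
    has_Grad s u (Grad s u) \<and>
    has_Div s (Grad s u) (Div s (Grad s u)) \<and>
    has_frac_laplacian s u (frac_laplacian s u) \<and>
    (AE x in lborel. Div s (Grad s u) x = of_real D * frac_laplacian s u x)"
proof (intro exI conjI allI)
  note s = assms(1,2)
  obtain U where u: "square_integrable u" "has_fourier u U"
    and Uw: "square_integrable (\<lambda>\<xi>. of_real ((1 + (norm \<xi>)\<^sup>2) powr (2 * s / 2)) * U \<xi>)"
    using assms(3) by (auto simp: sobolev_def)
  have U: "square_integrable U" by (rule has_fourier_square_integrable[OF u(2)])
  have Um: "U \<in> borel_measurable borel" using U by measurable
  have Us: "square_integrable (\<lambda>\<xi>. of_real (norm \<xi> powr s) * U \<xi>)"
    using s by (intro sobolev_weight[OF U Uw]) auto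
  have U2s: "square_integrable (\<lambda>\<xi>. of_real (norm \<xi> powr (2 * s)) * U \<xi>)"
    using s by (intro sobolev_weight[OF U Uw]) auto
  show "grad_div_const TYPE('n) s < 0" by (rule grad_div_const_neg[OF s])
  show "(\<forall>\<xi>::real ^ 'n.
          (LINT \<theta>|sphere_measure. LINT \<theta>'|sphere_measure.
             of_real (\<theta> \<bullet> \<theta>') * ipow s (\<theta> \<bullet> \<xi>) * ipow s (\<theta>' \<bullet> \<xi>))
          = of_real (D' * norm \<xi> powr (2 * s))) \<longleftrightarrow> D' = grad_div_const TYPE('n) s" for D'
  proof -
    have "D' = grad_div_const TYPE('n) s"
      if "\<forall>\<xi>::real ^ 'n. complex_of_real (grad_div_const TYPE('n) s * norm \<xi> powr (2 * s)) = of_real (D' * norm \<xi> powr (2 * s))"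
      \<comment> \<open>At a unit vector the power of the norm is 1, and the identity there already
        determines D'.\<close>
      using that[rule_format, of "axis undefined 1"] by simp
    then show ?thesis unfolding sphere_double_integral[OF s(1)] by blast
  qed
  show G: "has_Grad s u (Grad s u)"
    unfolding Grad_def by (rule someI_ex[OF Grad_fourier(1)[OF s u Us]])
  note gf = Grad_fourier(2)[OF s u Us G]
  note df = Div_fourier[OF s conjunct1[OF gf] conjunct2[OF gf] Um U2s]
  show Dv: "has_Div s (Grad s u) (Div s (Grad s u))"
    unfolding Div_def by (rule someI_ex[OF df(1)])
  obtain w where w: "square_integrable w" "has_fourier w (\<lambda>\<xi>. of_real (norm \<xi> powr (2 * s)) * U \<xi>)"
    using has_fourier_surj[OF U2s] by blast
  have lw: "has_frac_laplacian s u w" by (rule has_frac_laplacian_of_fourier[OF s u w])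
  then show L: "has_frac_laplacian s u (frac_laplacian s u)"
    unfolding frac_laplacian_def by (rule someI[of "has_frac_laplacian s u"])
  \<comment> \<open>The chosen \<open>frac_laplacian s u\<close> is known only through its defining
    relation; uniqueness of the L^2 limit identifies it with w.\<close>
  have "AE x in lborel. frac_laplacian s u x = w x"
    by (rule has_frac_laplacian_unique[OF u(1) L lw])
  moreover have "AE x in lborel. Div s (Grad s u) x = of_real (grad_div_const TYPE('n) s) * w x"
  \<comment> \<open>Both sides have the transform D_{n,s} |\<xi>|^(2 s) U, and the transform is
    injective modulo null sets.\<close>
  proof (rule has_fourier_inj)
    show "square_integrable (Div s (Grad s u))"
      "has_fourier (Div s (Grad s u)) (\<lambda>\<xi>. of_real (grad_div_const TYPE('n) s * norm \<xi> powr (2 * s)) * U \<xi>)"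
      using df(2)[OF Dv] by auto
    show "square_integrable (\<lambda>x. of_real (grad_div_const TYPE('n) s) * w x)"
      by (intro square_integrable_cmult w)
    show "has_fourier (\<lambda>x. of_real (grad_div_const TYPE('n) s) * w x) (\<lambda>\<xi>. of_real (grad_div_const TYPE('n) s * norm \<xi> powr (2 * s)) * U \<xi>)"
      using has_fourier_cmult[OF w, of "of_real (grad_div_const TYPE('n) s)"] by (simp add: mult.assoc)
  qed
  ultimately show "AE x in lborel. Div s (Grad s u) x = of_real (grad_div_const TYPE('n) s) * frac_laplacian s u x"
    by eventually_elim simp
qed

end
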